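(* Let $N\ge3$, $p>p_S$ and $n\ge1$. Then $\lambda_n(\gamma)\to\lambda_n^*$ as $\gamma\to\infty$, where $\lambda_n^*:=(s_n^* )^2$ and $s_n^*$ is the $n$-th positive critical point of $u^*$.
   Context: $f(U):=-U+U^p$, $p_S:=\frac{N+2}{N-2}$, $\theta:=\frac{2}{p-1}$, $A:=\{\theta(N-2-\theta)\}^{1/(p-1)}$, $m:=\{\theta(N-2-\theta)\}^{-1/2}$, $\alpha:=m(N-2-2\theta)$. $u^*(s):=As^{-\theta}y^*(m^{-1}\log s)$ where $y^*$ is the unique solution on $\mathbb{R}$ of $y''+\alpha y'-y+y^p-m^2e^{2mt}y=0$ with $y(t)\to1$ as $t\to-\infty$; $u^*$ has infinitely many positive critical points $s_1^*<s_2^*<\cdots$. Problem (N): $U''+\frac{N-1}{r}U'+\lambda f(U)=0$ on $(0,1)$, $U'(0)=U'(1)=0$, $U>0$. For $\gamma>1$, $(\lambda_n(\gamma),U_n(\cdot,\gamma))$ denotes the solution on the branch $\mathcal C_n$ (closure of the curve of nonconstant solutions of (N) bifurcating from $(\mu_n/(p-1),1)$, $\mu_n$ the $n$-th nonzero radial Neumann eigenvalue of $-\Delta$ on the unit ball) with $U_n(0,\gamma)=\gamma$; equivalently $\sqrt{\lambda_n(\gamma)}$ is the $n$-th positive critical point of the solution $u(s,\gamma)$ of $u''+\frac{N-1}{s}u'+f(u)=0$, $u(0)=\gamma$, $u'(0)=0$. *)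

theory Defs
  imports "HOL-Analysis.Analysis"
begin

text \<open>Nonlinearity f(U) = -U + U^p (used only for positive arguments).\<close>
definition fnl :: "real \<Rightarrow> real \<Rightarrow> real" where
  "fnl p u = - u + u powr p"

definition theta :: "real \<Rightarrow> real" where
  "theta p = 2 / (p - 1)"

definition Aconst :: "nat \<Rightarrow> real \<Rightarrow> real" where
  "Aconst N p = (theta p * (real N - 2 - theta p)) powr (1 / (p - 1))"

definition mconst :: "nat \<Rightarrow> real \<Rightarrow> real" where
  "mconst N p = (theta p * (real N - 2 - theta p)) powr (- 1 / 2)"

definition alphaconst :: "nat \<Rightarrow> real \<Rightarrow> real" where
  "alphaconst N p = mconst N p * (real N - 2 - 2 * theta p)"

definition crit :: "(real \<Rightarrow> real) \<Rightarrow> real \<Rightarrow> bool" where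
  "crit u s \<longleftrightarrow> (u has_real_derivative 0) (at s)"

definition nth_pos_crit :: "(real \<Rightarrow> real) \<Rightarrow> nat \<Rightarrow> real \<Rightarrow> bool" where
  "nth_pos_crit u n s \<longleftrightarrow> 0 < s \<and> crit u s \<and>
     finite {t. 0 < t \<and> t < s \<and> crit u t} \<and>
     card {t. 0 < t \<and> t < s \<and> crit u t} = n - 1"

definition radial_sol :: "nat \<Rightarrow> real \<Rightarrow> real \<Rightarrow> (real \<Rightarrow> real) \<Rightarrow> real \<Rightarrow> bool" where
  "radial_sol N p \<gamma> u T \<longleftrightarrow> 0 < T \<and> u 0 = \<gamma> \<and>
     (\<forall>s\<in>{0..<T}. 0 < u s) \<and> continuous_on {0..<T} u \<and>
     (u has_real_derivative 0) (at 0 within {0..<T}) \<and>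
     (\<exists>u'. \<forall>s\<in>{0<..<T}. (u has_real_derivative u' s) (at s) \<and>
        (u' has_real_derivative (- (real N - 1) / s * u' s - fnl p (u s))) (at s))"

definition lambda_n :: "nat \<Rightarrow> real \<Rightarrow> nat \<Rightarrow> real \<Rightarrow> real" where
  "lambda_n N p n \<gamma> =
     (THE s. \<exists>u T. radial_sol N p \<gamma> u T \<and> s < T \<and> nth_pos_crit u n s)\<^sup>2"

definition ystar :: "nat \<Rightarrow> real \<Rightarrow> real \<Rightarrow> real" where
  "ystar N p = (THE y. (\<forall>t. 0 < y t) \<and> ((y \<longlongrightarrow> 1) at_bot) \<and>
     (\<exists>y'. \<forall>t. (y has_real_derivative y' t) (at t) \<and>
        (y' has_real_derivative
           (- alphaconst N p * y' t + y t - y t powr p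
            + (mconst N p)\<^sup>2 * exp (2 * mconst N p * t) * y t)) (at t)))"

definition ustar :: "nat \<Rightarrow> real \<Rightarrow> real \<Rightarrow> real" where
  "ustar N p s = Aconst N p * s powr (- theta p) * ystar N p (ln s / mconst N p)"

definition sstar :: "nat \<Rightarrow> real \<Rightarrow> nat \<Rightarrow> real" where
  "sstar N p n = (THE s. nth_pos_crit (ustar N p) n s)"

definition lambda_star :: "nat \<Rightarrow> real \<Rightarrow> nat \<Rightarrow> real" where
  "lambda_star N p n = (sstar N p n)\<^sup>2"

end

theory Submission
  imports Defs
begin

text \<open>In the Emden variables \<open>t = ln s / m\<close>, \<open>u = A s\<^sup>-\<^sup>\<theta> y\<close>, \<open>z = y'\<close> the energy
  \<open>z\<^sup>2/2 - y\<^sup>2 (1 + m\<^sup>2 exp (2mt))/2 + y\<^sup>p\<^sup>+\<^sup>1/(p + 1)\<close> decreases along every solution.  The regular solution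
  with \<open>u 0 = \<gamma>\<close> starts at energy \<open>0\<close> and, at a time \<open>\<tau> \<gamma> \<rightarrow> -\<infinity>\<close>, has lost an amount bounded below
  uniformly in \<open>\<gamma>\<close>.  The remaining energy budget forces it into any prescribed neighbourhood of
  \<open>(y, z) = (1, 0)\<close> within a bounded time, where it stays until \<open>t = -M\<close>.  Near \<open>(1, 0)\<close> the distance of two
  solutions does not grow, so the regular solutions are Cauchy as \<open>\<gamma> \<rightarrow> \<infinity>\<close>; their limit is \<open>y\<^sup>*\<close>, and its
  uniqueness follows from the same estimate.  The critical points of \<open>u\<close> are the zeros of \<open>z - m\<theta> y\<close>.  For the
  limit these are simple and unbounded, and there are none for \<open>t \<le> -M\<close>, uniformly in \<open>\<gamma>\<close>, so the
  \<open>n\<close>-th zero converges.\<close>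

section \<open>Estimates for second order equations\<close>

text \<open>Supercriticality enters twice: it makes the damping \<alpha> positive, and it gives the
  Pohozaev functional the sign that keeps regular solutions positive. The obstacle is uniformity:
  \<open>\<tau> \<gamma>\<close> recedes to minus infinity while the window of interest stays fixed,
  so a Gronwall bound over the time in between is useless. Two facts replace it whose constants
  depend neither on \<gamma> nor on the elapsed time: a quantitative LaSalle argument (bounded
  energy forces a block of fixed length with almost no dissipation) and a Lyapunov function for the
  difference of two solutions. The initial loss is uniform because \<open>\<tau> \<gamma>\<close>
  marks the natural scale \<open>s = O(\<gamma> powr (- (p - 1) / 2))\<close> of the regular
  solution, on which the powers of \<gamma> cancel. Since \<open>lambda_n\<close>,
  \<open>ystar\<close> and \<open>sstar\<close> are definite descriptions, existence and uniqueness
  have to be proved as well: for the singular solution, for radial solutions at the singular point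
  \<open>s = 0\<close>, and for the n-th critical point.\<close>

lemma powr_diff_le:
  fixes p x y B :: real
  assumes "1 < p" "0 \<le> x" "x \<le> B" "0 \<le> y" "y \<le> B"
  shows "\<bar>x powr p - y powr p\<bar> \<le> p * B powr (p - 1) * \<bar>x - y\<bar>"
proof -
  have *: "\<bar>y powr p - x powr p\<bar> \<le> p * B powr (p - 1) * (y - x)"
    if "0 \<le> x" "x < y" "y \<le> B" for x y :: real
  proof -
    have d: "((\<lambda>x. x powr p) has_real_derivative p * z powr (p - 1)) (at z)" if "x < z" for z
      using that \<open>0 \<le> x\<close> by (auto intro!: derivative_eq_intros)
    have "continuous_on {x..y} (\<lambda>x. x powr p)"
      using assms(1) \<open>0 \<le> x\<close> by (intro continuous_on_powr' continuous_intros) auto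
    then obtain l z where z: "z > x" "z < y" "DERIV (\<lambda>x. x powr p) z :> l"
      "y powr p - x powr p = (y - x) * l"
      using MVT[OF \<open>x < y\<close>, of "\<lambda>x. x powr p"] d by (auto simp: real_differentiable_def)
    have l: "l = p * z powr (p - 1)" using DERIV_unique z(1,3) d by blast
    have "z powr (p - 1) \<le> B powr (p - 1)" using z that assms by (intro powr_mono2) auto
    then have "l \<le> p * B powr (p - 1)" "0 \<le> l" using assms(1) by (auto simp: l)
    then show ?thesis using z that assms
      by (simp add: abs_mult mult.commute[of "y-x"] mult_right_mono)
  qed
  show ?thesis
    using *[of x y] *[of y x] assms
    by (cases x y rule: linorder_cases) (auto simp: abs_minus_commute)
qed

text \<open>Absorbing the damping term with its favourable sign is what makes the estimate
  usable up to the singular point \<open>s = 0\<close>, where \<open>a s = (N - 1) / s\<close>.\<close>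

lemma gronwall_damped:
  fixes d e :: "real \<Rightarrow> real"
  assumes ab: "a \<le> b" and C: "0 \<le> C"
    and d: "\<And>s. s \<in> {a..b} \<Longrightarrow> (d has_real_derivative e s) (at s)"
    and e: "\<And>s. s \<in> {a..b} \<Longrightarrow> (e has_real_derivative - k s * e s + q s) (at s)"
    and k: "\<And>s. s \<in> {a..b} \<Longrightarrow> 0 \<le> k s"
    and q: "\<And>s. s \<in> {a..b} \<Longrightarrow> \<bar>q s\<bar> \<le> C * \<bar>d s\<bar>"
  shows "(d b)\<^sup>2 + (e b)\<^sup>2 \<le> ((d a)\<^sup>2 + (e a)\<^sup>2) * exp ((1 + C) * (b - a))"
proof -
  define H where "H s = ((d s)\<^sup>2 + (e s)\<^sup>2) * exp (- (1 + C) * s)" for s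
  have "H b \<le> H a"
  proof (rule DERIV_nonpos_imp_nonincreasing[OF ab])
    fix s assume s: "a \<le> s" "s \<le> b"
    have "(H has_real_derivative (2 * d s * e s + 2 * e s * (- k s * e s + q s)
       - (1 + C) * ((d s)\<^sup>2 + (e s)\<^sup>2)) * exp (- (1 + C) * s)) (at s)"
      unfolding H_def using s
      by (auto intro!: derivative_eq_intros d e simp: algebra_simps)
    moreover have "2 * d s * e s + 2 * e s * (- k s * e s + q s) - (1 + C) * ((d s)\<^sup>2 + (e s)\<^sup>2) \<le> 0"
    proof -
      have "e s * q s \<le> \<bar>e s\<bar> * \<bar>q s\<bar>" by (metis abs_ge_self abs_mult)
      also have "\<dots> \<le> \<bar>e s\<bar> * (C * \<bar>d s\<bar>)" using q[of s] s by (intro mult_left_mono) auto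
      finally have 1: "2 * (e s * q s) \<le> C * (2 * \<bar>e s\<bar> * \<bar>d s\<bar>)" by (simp add: mult_ac)
      have "2 * \<bar>e s\<bar> * \<bar>d s\<bar> \<le> (d s)\<^sup>2 + (e s)\<^sup>2"
        using sum_squares_bound[of "\<bar>e s\<bar>" "\<bar>d s\<bar>"] by simp
      then have 2: "C * (2 * \<bar>e s\<bar> * \<bar>d s\<bar>) \<le> C * ((d s)\<^sup>2 + (e s)\<^sup>2)"
        using C by (rule mult_left_mono)
      have 3: "2 * d s * e s \<le> (d s)\<^sup>2 + (e s)\<^sup>2" using sum_squares_bound[of "d s" "e s"] by simp
      have 4: "0 \<le> k s * (e s)\<^sup>2" using k s by simp
      show ?thesis using 1 2 3 4 by (simp add: algebra_simps power2_eq_square)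
    qed
    ultimately show "\<exists>y. (H has_real_derivative y) (at s) \<and> y \<le> 0"
      by (meson exp_ge_zero mult_nonpos_nonneg)
  qed
  then have "((d b)\<^sup>2 + (e b)\<^sup>2) * exp (- (1 + C) * b) * exp ((1 + C) * b)
     \<le> ((d a)\<^sup>2 + (e a)\<^sup>2) * exp (- (1 + C) * a) * exp ((1 + C) * b)"
    unfolding H_def by (intro mult_right_mono) auto
  then show ?thesis by (simp add: mult.assoc flip: exp_add) (simp add: algebra_simps)
qed

text \<open>Backwards in time damping has the wrong sign, so here the forcing may depend on
  \<open>e\<close>, and the weight \<open>exp (K * s)\<close> makes \<open>d^2 + e^2\<close>
  nondecreasing. A common zero at \<open>b\<close> then spreads to the left.\<close>

lemma backward_uniqueness:
  fixes d e :: "real \<Rightarrow> real"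
  assumes ab: "a \<le> b"
    and d: "\<And>s. s \<in> {a..b} \<Longrightarrow> (d has_real_derivative e s) (at s)"
    and e: "\<And>s. s \<in> {a..b} \<Longrightarrow> (e has_real_derivative q s) (at s)"
    and q: "\<And>s. s \<in> {a..b} \<Longrightarrow> \<bar>q s\<bar> \<le> C * (\<bar>d s\<bar> + \<bar>e s\<bar>)"
    and z: "d b = 0" "e b = 0"
  shows "d a = 0 \<and> e a = 0"
proof -
  have C: "\<bar>q s\<bar> \<le> \<bar>C\<bar> * (\<bar>d s\<bar> + \<bar>e s\<bar>)" if "s \<in> {a..b}" for s
    by (rule order.trans[OF q[OF that]]) (auto intro!: mult_right_mono)
  \<comment> \<open>The 1 absorbs \<open>2 d e\<close>, the \<open>3 * \<bar>C\<bar>\<close> absorbs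
    \<open>2 e q\<close>.\<close>
  define K where "K = 1 + 3 * \<bar>C\<bar>"
  define H where "H s = ((d s)\<^sup>2 + (e s)\<^sup>2) * exp (K * s)" for s
  have "H a \<le> H b"
  proof (rule DERIV_nonneg_imp_nondecreasing[OF ab])
    fix s assume s: "a \<le> s" "s \<le> b"
    have "(H has_real_derivative (2 * d s * e s + 2 * e s * q s
       + K * ((d s)\<^sup>2 + (e s)\<^sup>2)) * exp (K * s)) (at s)"
      unfolding H_def using s
      by (auto intro!: derivative_eq_intros d e simp: algebra_simps)
    moreover have "0 \<le> 2 * d s * e s + 2 * e s * q s + K * ((d s)\<^sup>2 + (e s)\<^sup>2)"
    proof -
      have "\<bar>e s * q s\<bar> \<le> \<bar>e s\<bar> * (\<bar>C\<bar> * (\<bar>d s\<bar> + \<bar>e s\<bar>))"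
        unfolding abs_mult using C[of s] s by (intro mult_left_mono) auto
      also have "\<dots> = \<bar>C\<bar> * (\<bar>e s\<bar> * \<bar>d s\<bar> + (e s)\<^sup>2)"
        by (simp add: algebra_simps power2_eq_square)
      finally have 1: "\<bar>e s * q s\<bar> \<le> \<bar>C\<bar> * (\<bar>e s\<bar> * \<bar>d s\<bar> + (e s)\<^sup>2)" .
      have 2: "2 * (\<bar>e s\<bar> * \<bar>d s\<bar>) \<le> (d s)\<^sup>2 + (e s)\<^sup>2"
        using sum_squares_bound[of "\<bar>e s\<bar>" "\<bar>d s\<bar>"] by simp
      then have "2 * (\<bar>e s\<bar> * \<bar>d s\<bar> + (e s)\<^sup>2) \<le> 3 * ((d s)\<^sup>2 + (e s)\<^sup>2)"
        using zero_le_power2[of "d s"] by argo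
      then have "\<bar>C\<bar> * (2 * (\<bar>e s\<bar> * \<bar>d s\<bar> + (e s)\<^sup>2)) \<le> \<bar>C\<bar> * (3 * ((d s)\<^sup>2 + (e s)\<^sup>2))"
        by (rule mult_left_mono) simp
      moreover have "2 * \<bar>e s * q s\<bar> \<le> \<bar>C\<bar> * (2 * (\<bar>e s\<bar> * \<bar>d s\<bar> + (e s)\<^sup>2))"
        using 1 by linarith
      ultimately have 3: "2 * \<bar>e s * q s\<bar> \<le> 3 * \<bar>C\<bar> * ((d s)\<^sup>2 + (e s)\<^sup>2)" by linarith
      have 4: "\<bar>2 * d s * e s\<bar> \<le> (d s)\<^sup>2 + (e s)\<^sup>2" using 2 by (simp add: abs_mult mult_ac)
      have "2 * e s * q s = 2 * (e s * q s)" by simp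
      then have "- (3 * \<bar>C\<bar> * ((d s)\<^sup>2 + (e s)\<^sup>2)) \<le> 2 * e s * q s"
        using 3 abs_ge_minus_self[of "e s * q s"] by linarith
      moreover have "- ((d s)\<^sup>2 + (e s)\<^sup>2) \<le> 2 * d s * e s"
        using 4 abs_ge_minus_self[of "2 * d s * e s"] by linarith
      ultimately show ?thesis unfolding K_def distrib_right mult_1 by linarith
    qed
    ultimately show "\<exists>y. (H has_real_derivative y) (at s) \<and> 0 \<le> y"
      by (meson exp_ge_zero mult_nonneg_nonneg)
  qed
  then have "(d a)\<^sup>2 + (e a)\<^sup>2 \<le> 0" using z by (simp add: H_def mult_le_0_iff)
  then show ?thesis by (simp add: sum_power2_le_zero_iff)
qed

text \<open>Such a function would be concave and positive on a half line, hence nondecreasing; then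
  its second derivative stays below the negative constant \<open>- c * \<phi> S\<close> and the
  first derivative must become negative.\<close>

lemma no_positive_oscillator:
  fixes \<phi> :: "real \<Rightarrow> real"
  assumes c: "0 < c"
    and d1: "\<And>s. S \<le> s \<Longrightarrow> (\<phi> has_real_derivative \<phi>' s) (at s)"
    and d2: "\<And>s. S \<le> s \<Longrightarrow> (\<phi>' has_real_derivative \<phi>'' s) (at s)"
    and pos: "\<And>s. S \<le> s \<Longrightarrow> 0 < \<phi> s"
    and le: "\<And>s. S \<le> s \<Longrightarrow> \<phi>'' s \<le> - c * \<phi> s"
  shows False
proof -
  have dec: "\<phi>' t \<le> \<phi>' s" if "S \<le> s" "s \<le> t" for s t
  proof (rule DERIV_nonpos_imp_nonincreasing[OF that(2)])
    fix x assume "s \<le> x" "x \<le> t"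
    then have "\<phi>'' x \<le> 0" using le[of x] pos[of x] c that
      by (smt (verit) mult_minus_left mult_pos_pos)
    then show "\<exists>y. (\<phi>' has_real_derivative y) (at x) \<and> y \<le> 0" using d2[of x] \<open>s \<le> x\<close> that by (intro exI[of _ "\<phi>'' x"]) auto
  qed
  have nn: "0 \<le> \<phi>' s" if "S \<le> s" for s
  proof (rule ccontr)
    assume "\<not> 0 \<le> \<phi>' s"
    then have neg: "\<phi>' s < 0" by simp
    \<comment> \<open>The tangent at \<open>s\<close> vanishes at this \<open>t\<close>, and a
      concave function lies below its tangent.\<close>
    define t where "t = s + \<phi> s / (- \<phi>' s)"
    have st: "s \<le> t" using neg pos[OF that] by (simp add: t_def divide_nonneg_neg)
    have "\<phi> t - \<phi>' s * t \<le> \<phi> s - \<phi>' s * s"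
    proof (rule DERIV_nonpos_imp_nonincreasing[OF st])
      fix x assume "s \<le> x" "x \<le> t"
      then show "\<exists>y. ((\<lambda>x. \<phi> x - \<phi>' s * x) has_real_derivative y) (at x) \<and> y \<le> 0"
        using dec[of s x] that
        by (intro exI[of _ "\<phi>' x - \<phi>' s"]) (auto intro!: derivative_eq_intros d1)
    qed
    then have "\<phi> t \<le> \<phi> s + \<phi>' s * (t - s)" by (simp add: algebra_simps)
    also have "\<dots> = 0" using neg by (simp add: t_def)
    finally show False using pos[of t] st that by simp
  qed
  have mono: "\<phi> S \<le> \<phi> s" if "S \<le> s" for s
    by (rule DERIV_nonneg_imp_nondecreasing[OF that]) (use d1 nn in blast)
  define t where "t = S + (\<phi>' S + 1) / (c * \<phi> S)"
  have pS: "0 < c * \<phi> S" using c pos by simp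
  have St: "S \<le> t" using nn[of S] pS by (simp add: t_def)
  have "\<phi>' t + c * \<phi> S * t \<le> \<phi>' S + c * \<phi> S * S"
  proof (rule DERIV_nonpos_imp_nonincreasing[OF St])
    fix x assume x: "S \<le> x" "x \<le> t"
    have "\<phi>'' x + c * \<phi> S \<le> 0" using le[OF x(1)] mult_left_mono[OF mono[OF x(1)], of c] c by linarith
    then show "\<exists>y. ((\<lambda>x. \<phi>' x + c * \<phi> S * x) has_real_derivative y) (at x) \<and> y \<le> 0"
      using x by (intro exI[of _ "\<phi>'' x + c * \<phi> S"]) (auto intro!: derivative_eq_intros d2)
  qed
  then have "\<phi>' t \<le> \<phi>' S - c * \<phi> S * (t - S)" by (simp add: algebra_simps)
  also have "c * \<phi> S * (t - S) = \<phi>' S + 1" using pS c pos[of S] by (simp add: t_def)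
  also have "\<phi>' S - (\<phi>' S + 1) = -1" by simp
  finally show False using nn[OF St] by simp
qed

text \<open>Divergence form of the radial equation: with \<open>k = N - 1\<close> the weight
  \<open>s ^ k\<close> cancels the singular first order term.\<close>

lemma flux_deriv:
  fixes v :: "real \<Rightarrow> real"
  assumes "0 < s" "(v has_real_derivative - real k / s * v s - f) (at s)"
  shows "((\<lambda>s. s ^ k * v s) has_real_derivative - (s ^ k) * f) (at s)"
proof (rule DERIV_cong[OF DERIV_mult[OF DERIV_pow assms(2)]])
  show "real k * s ^ (k - Suc 0) * v s + (- real k / s * v s - f) * s ^ k = - (s ^ k) * f"
    using assms(1) by (cases k) (auto simp: field_simps)
qed

section \<open>Convergence of the n-th zero\<close>

lemma nonzero_deriv_const_sign:
  fixes h :: "real \<Rightarrow> real"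
  assumes "continuous_on {a..b} h" "\<And>t. t \<in> {a..b} \<Longrightarrow> h t \<noteq> 0"
  shows "(\<forall>t\<in>{a..b}. 0 < h t) \<or> (\<forall>t\<in>{a..b}. h t < 0)"
proof (rule ccontr)
  assume "\<not> ?thesis"
  then obtain x y where "x \<in> {a..b}" "\<not> 0 < h x" "y \<in> {a..b}" "\<not> h y < 0" by blast
  then have xy: "x \<in> {a..b}" "y \<in> {a..b}" "h x \<le> 0" "0 \<le> h y" by auto
  have "connected (h ` {a..b})" using assms(1) by (intro connected_continuous_image) auto
  then have "is_interval (h ` {a..b})" by (simp add: is_interval_connected_1)
  then have "0 \<in> h ` {a..b}"
    by (rule mem_is_interval_1_I[of _ "h x" "h y"]) (use xy in auto)
  then show False using assms(2) by auto
qed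

lemma strict_mono_from_deriv:
  fixes h :: "real \<Rightarrow> real"
  assumes d: "\<And>t. t \<in> {a..b} \<Longrightarrow> (h has_real_derivative h' t) (at t)"
    and s: "(\<forall>t\<in>{a..b}. 0 < h' t) \<or> (\<forall>t\<in>{a..b}. h' t < 0)"
    and xy: "x \<in> {a..b}" "y \<in> {a..b}" "x < y"
  shows "h x \<noteq> h y"
proof -
  have in_ab: "t \<in> {a..b}" if "x \<le> t" "t \<le> y" for t using that xy by auto
  show ?thesis using s
  proof
    assume "\<forall>t\<in>{a..b}. 0 < h' t"
    then have "h x < h y" using in_ab d by (intro DERIV_pos_imp_increasing[OF xy(3)]) blast
    then show ?thesis by simp
  next
    assume "\<forall>t\<in>{a..b}. h' t < 0"
    then have "h y < h x" using in_ab d by (intro DERIV_neg_imp_decreasing[OF xy(3)]) blast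
    then show ?thesis by simp
  qed
qed

text \<open>Zeros accumulating at a point make the difference quotients along them vanish, so the
  derivative would vanish at that point too.\<close>

lemma finite_simple_zeros:
  fixes g :: "real \<Rightarrow> real"
  assumes g: "\<And>t. (g has_real_derivative g' t) (at t)"
    and simple: "\<And>t. g t = 0 \<Longrightarrow> g' t \<noteq> 0"
  shows "finite {t. a \<le> t \<and> t \<le> b \<and> g t = 0}"
proof (rule ccontr)
  assume inf: "infinite {t. a \<le> t \<and> t \<le> b \<and> g t = 0}"
  have "compact {a..b}" by simp
  then obtain x where x: "x \<in> {a..b}" "x islimpt {t. a \<le> t \<and> t \<le> b \<and> g t = 0}"
    using inf unfolding compact_eq_Bolzano_Weierstrass by (metis (no_types, lifting) atLeastAtMost_iff mem_Collect_eq subsetI)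
  define Z where "Z = {t. a \<le> t \<and> t \<le> b \<and> g t = 0}"
  obtain f where f: "\<And>n. f n \<in> Z - {x}" "f \<longlonglongrightarrow> x"
    using x(2) unfolding islimpt_sequential Z_def by blast
  have lim: "(\<lambda>n. g (f n)) \<longlonglongrightarrow> g x" using f(2) DERIV_isCont[OF g] isCont_tendsto_compose by blast
  moreover have "(\<lambda>n. g (f n)) = (\<lambda>n. 0)" using f(1) by (auto simp: Z_def)
  ultimately have gx: "g x = 0" by (simp add: LIMSEQ_const_iff)
  have "((\<lambda>y. (g y - g x) / (y - x)) \<longlongrightarrow> g' x) (at x)"
    using g[of x] by (simp add: has_field_derivative_iff)
  then have "(\<lambda>n. (g (f n) - g x) / (f n - x)) \<longlonglongrightarrow> g' x"
    by (rule filterlim_compose) (use f in \<open>auto simp: filterlim_at\<close>)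
  moreover have "(\<lambda>n. (g (f n) - g x) / (f n - x)) = (\<lambda>n. 0)" using f(1) gx by (auto simp: Z_def)
  ultimately have "g' x = 0" by (simp add: LIMSEQ_const_iff)
  then show False using simple[OF gx] by simp
qed

text \<open>Convergence on compact sets cannot stop zeros from entering from minus infinity and
  shifting the count; \<open>left\<close> and \<open>Left\<close> exclude this with one common
  \<open>a\<close>. What remains is a bijection of zeros: exactly one zero of \<open>G k\<close> in
  each small interval around a zero of \<open>g\<close>, where the derivative has a fixed sign, and
  none in the compact rest.\<close>

lemma nth_zero_converges:
  fixes g :: "real \<Rightarrow> real" and G :: "'a \<Rightarrow> real \<Rightarrow> real"
  assumes g: "\<And>t. (g has_real_derivative g' t) (at t)"
    and G: "\<forall>\<^sub>F k in F. \<forall>t. (G k has_real_derivative G' k t) (at t)"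
    and cg': "\<And>t. isCont g' t"
    and cG': "\<forall>\<^sub>F k in F. \<forall>t. isCont (G' k) t"
    and conv: "\<And>a b e. 0 < e \<Longrightarrow> \<forall>\<^sub>F k in F. \<forall>t\<in>{a..b}. \<bar>G k t - g t\<bar> < e"
    and conv': "\<And>a b e. 0 < e \<Longrightarrow> \<forall>\<^sub>F k in F. \<forall>t\<in>{a..b}. \<bar>G' k t - g' t\<bar> < e"
    and left: "\<And>t. t \<le> a \<Longrightarrow> g t \<noteq> 0"
    and Left: "\<forall>\<^sub>F k in F. \<forall>t\<le>a. G k t \<noteq> 0"
    and simple: "\<And>t. g t = 0 \<Longrightarrow> g' t \<noteq> 0"
    and t0: "g t0 = 0" and e: "0 < e"
  shows "\<forall>\<^sub>F k in F. \<exists>t. \<bar>t - t0\<bar> < e \<and> G k t = 0 \<and> finite {\<tau>. \<tau> < t \<and> G k \<tau> = 0} \<and>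
     card {\<tau>. \<tau> < t \<and> G k \<tau> = 0} = card {\<tau>. \<tau> < t0 \<and> g \<tau> = 0}"
proof -
  define Z where "Z = {t. t \<le> t0 \<and> g t = 0}"
  have finZ: "finite Z"
  proof (rule finite_subset)
    show "Z \<subseteq> {t. a \<le> t \<and> t \<le> t0 \<and> g t = 0}" unfolding Z_def using left linear[of a] by blast
  qed (rule finite_simple_zeros[OF g simple])
  have Za: "a < z" if "z \<in> Z" for z using left[of z] that by (force simp: Z_def not_le)
  have t0Z: "t0 \<in> Z" using t0 by (simp add: Z_def)
  have "\<exists>r>0. \<forall>t. \<bar>t - z\<bar> \<le> r \<longrightarrow> g' t \<noteq> 0" if "z \<in> Z" for z
  proof -
    have nz: "g' z \<noteq> 0" using that simple by (simp add: Z_def)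
    have "\<forall>\<^sub>F t in nhds z. g' t \<noteq> 0"
      using cg'[of z] nz unfolding continuous_at tendsto_at_iff_tendsto_nhds
      by (rule tendsto_imp_eventually_ne)
    then obtain d where "d > 0" "\<And>t. dist t z < d \<Longrightarrow> g' t \<noteq> 0"
      unfolding eventually_nhds_metric by blast
    then show ?thesis by (intro exI[of _ "d/2"]) (auto simp: dist_real_def)
  qed
  then obtain \<rho> where \<rho>: "\<And>z. z \<in> Z \<Longrightarrow> 0 < \<rho> z"
    "\<And>z t. z \<in> Z \<Longrightarrow> \<bar>t - z\<bar> \<le> \<rho> z \<Longrightarrow> g' t \<noteq> 0" by metis
  define R where "R = insert e (\<rho> ` Z \<union> (\<lambda>z. z - a) ` Z)"
  \<comment> \<open>Half the minimum, so that \<open>g'\<close> keeps its sign on radius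
    \<open>2 * r\<close>. Zeros of \<open>g\<close> up to \<open>t0\<close> are then more than
    \<open>2 * r\<close> apart, and the intervals of radius \<open>r\<close> are disjoint, lie right
    of \<open>a\<close> and fit into the tolerance \<open>e\<close>.\<close>
  define r where "r = Min R / 2"
  have R: "finite R" "R \<noteq> {}" using finZ by (auto simp: R_def)
  have "\<forall>x\<in>R. 0 < x" using \<rho>(1) e Za by (auto simp: R_def)
  then have r0: "0 < r" using R by (simp add: r_def)
  have rR: "2 * r \<le> x" if "x \<in> R" for x using Min_le[OF R(1) that] by (simp add: r_def)
  have r\<rho>: "2 * r \<le> \<rho> z" if "z \<in> Z" for z using that by (intro rR) (simp add: R_def)
  have ra: "a < z - r" if "z \<in> Z" for z
    using rR[of "z - a"] that r0 by (simp add: R_def)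
  have re: "r < e" using rR[of e] r0 by (simp add: R_def)
  have sgn: "(\<forall>t\<in>{z - 2*r..z + 2*r}. 0 < g' t) \<or> (\<forall>t\<in>{z - 2*r..z + 2*r}. g' t < 0)" if "z \<in> Z" for z
  proof (rule nonzero_deriv_const_sign)
    show "continuous_on {z - 2*r..z + 2*r} g'" using cg' by (simp add: continuous_at_imp_continuous_on)
    show "g' t \<noteq> 0" if "t \<in> {z - 2*r..z + 2*r}" for t
      using \<rho>(2)[OF \<open>z \<in> Z\<close>, of t] r\<rho>[OF \<open>z \<in> Z\<close>] that by (auto simp: abs_le_iff)
  qed
  have sep: "w = z" if "z \<in> Z" "g w = 0" "\<bar>w - z\<bar> \<le> 2 * r" for w z
  proof (rule ccontr)
    assume "w \<noteq> z"
    have gz: "g z = 0" using that by (simp add: Z_def)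
    have "g (min w z) \<noteq> g (max w z)"
      by (rule strict_mono_from_deriv[OF g sgn[OF that(1)]]) (use that r0 \<open>w \<noteq> z\<close> in \<open>auto simp: abs_le_iff min_def max_def\<close>)
    then show False using gz that(2) by (auto simp: min_def max_def split: if_splits)
  qed
  \<comment> \<open>The set reaches to \<open>t0 + r\<close> because the zero of \<open>G k\<close>
    near \<open>t0\<close> may lie to the right of \<open>t0\<close>.\<close>
  define K where "K = {a..t0 + r} - (\<Union>z\<in>Z. {z - r<..<z + r})"
  have compK: "compact K" unfolding K_def by (intro compact_diff) (auto intro: open_UN)
  have gK: "g t \<noteq> 0" if "t \<in> K" for t
  proof
    assume "g t = 0"
    have "t \<notin> Z" using that r0 unfolding K_def by force
    then have "t0 < t" using \<open>g t = 0\<close> by (simp add: Z_def)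
    moreover have "t \<le> t0 + r" using that by (simp add: K_def)
    ultimately show False using sep[OF t0Z \<open>g t = 0\<close>] r0 by auto
  qed
  have contg: "continuous_on S g" for S using g by (meson DERIV_isCont continuous_at_imp_continuous_on)
  obtain c where c: "0 < c" "\<And>t. t \<in> K \<Longrightarrow> c \<le> \<bar>g t\<bar>"
  proof (cases "K = {}")
    case False
    then obtain x where "x \<in> K" "\<forall>y\<in>K. \<bar>g x\<bar> \<le> \<bar>g y\<bar>"
      using continuous_attains_inf[OF compK, of "\<lambda>t. \<bar>g t\<bar>"] contg continuous_on_rabs by blast
    then show ?thesis using that[of "\<bar>g x\<bar>"] gK by auto
  qed (use that[of 1] in auto)
  \<comment> \<open>At these endpoints \<open>\<bar>g\<bar>\<close> is at least \<open>c\<close>, so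
    \<open>G k\<close> inherits the sign of \<open>g\<close> there; this feeds the intermediate
    value theorem.\<close>
  have Kz: "z - r \<in> K \<and> z + r \<in> K" if "z \<in> Z" for z
  proof -
    have "\<not> (w - r < x \<and> x < w + r)" if "w \<in> Z" "x = z - r \<or> x = z + r" for w x
    proof
      assume "w - r < x \<and> x < w + r"
      then have "w = z" using sep[OF \<open>z \<in> Z\<close>, of w] that by (auto simp: Z_def)
      then show False using that \<open>w - r < x \<and> x < w + r\<close> by auto
    qed
    then have "x \<notin> (\<Union>w\<in>Z. {w - r<..<w + r})" if "x = z - r \<or> x = z + r" for x
      using that by (metis (no_types, lifting) UN_E greaterThanLessThan_iff)
    moreover have "z \<le> t0" using that by (simp add: Z_def)
    then have "z - r \<in> {a..t0 + r}" "z + r \<in> {a..t0 + r}" using ra[OF that] r0 by auto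
    ultimately show ?thesis unfolding K_def by blast
  qed
  define I where "I = (\<Union>z\<in>Z. {z - r..z + r})"
  have compI: "compact I" unfolding I_def using finZ by (intro compact_UN) auto
  obtain c' where c': "0 < c'" "\<And>t. t \<in> I \<Longrightarrow> c' \<le> \<bar>g' t\<bar>"
  proof (cases "I = {}")
    case False
    have "continuous_on I g'" using cg' by (simp add: continuous_at_imp_continuous_on)
    then obtain x where x: "x \<in> I" "\<forall>y\<in>I. \<bar>g' x\<bar> \<le> \<bar>g' y\<bar>"
      using continuous_attains_inf[OF compI False, of "\<lambda>t. \<bar>g' t\<bar>"] continuous_on_rabs by blast
    moreover have "g' x \<noteq> 0"
    proof -
      obtain z where z: "z \<in> Z" "x \<in> {z - r..z + r}" using x(1) by (auto simp: I_def)
      then have "x \<in> {z - 2*r..z + 2*r}" using r0 by auto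
      then show ?thesis using sgn[OF z(1)] by (metis less_irrefl)
    qed
    ultimately show ?thesis using that[of "\<bar>g' x\<bar>"] by auto
  qed (use that[of 1] in auto)
  show ?thesis
    using G cG' Left conv[OF c(1), of a "t0 + r"] conv'[OF c'(1), of a "t0 + r"]
  proof eventually_elim
    case (elim k)
    have Isub: "t \<in> {a..t0 + r}" if "z \<in> Z" "t \<in> {z - r..z + r}" for z t
      using that ra[of z] by (auto simp: Z_def)
    have GK: "G k t \<noteq> 0" if "t \<in> K" for t
      using elim(4) c(2)[OF that] that unfolding K_def by force
    have Gsgn: "(\<forall>t\<in>{z - r..z + r}. 0 < G' k t) \<or> (\<forall>t\<in>{z - r..z + r}. G' k t < 0)" if "z \<in> Z" for z
    proof (rule nonzero_deriv_const_sign)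
      show "continuous_on {z - r..z + r} (G' k)" using elim(2) by (simp add: continuous_at_imp_continuous_on)
      show "G' k t \<noteq> 0" if "t \<in> {z - r..z + r}" for t
      proof -
        have "t \<in> I" using that \<open>z \<in> Z\<close> by (auto simp: I_def)
        then have "c' \<le> \<bar>g' t\<bar>" "\<bar>G' k t - g' t\<bar> < c'" using c'(2) elim(5) Isub[OF \<open>z \<in> Z\<close> that] by auto
        then show ?thesis by auto
      qed
    qed
    have uniq: "s = t" if "z \<in> Z" "s \<in> {z - r..z + r}" "t \<in> {z - r..z + r}" "G k s = 0" "G k t = 0" for z s t
    proof -
      have "\<not> x < y" if "x \<in> {z - r..z + r}" "y \<in> {z - r..z + r}" "G k x = 0" "G k y = 0" for x y
        using strict_mono_from_deriv[OF _ Gsgn[OF \<open>z \<in> Z\<close>], of "G k" x y] elim(1) that by auto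
      then have "\<not> s < t" "\<not> t < s" using that by blast+
      then show ?thesis by simp
    qed
    have "\<exists>t. t \<in> {z - r..z + r} \<and> G k t = 0" if z: "z \<in> Z" for z
    proof -
      have gz: "g z = 0" using z by (simp add: Z_def)
      have close: "\<bar>G k (z - r) - g (z - r)\<bar> < \<bar>g (z - r)\<bar>" "\<bar>G k (z + r) - g (z + r)\<bar> < \<bar>g (z + r)\<bar>"
        using Kz[OF z] c(2)[of "z - r"] c(2)[of "z + r"]
          bspec[OF elim(4), of "z - r"] bspec[OF elim(4), of "z + r"]
        unfolding K_def by (meson DiffD1 less_le_trans)+
      have cont: "continuous_on {z - r..z + r} (G k)"
        using elim(1) by (meson DERIV_isCont continuous_at_imp_continuous_on)
      show ?thesis using sgn[OF z]
      proof
        assume sg: "\<forall>t\<in>{z - 2*r..z + 2*r}. 0 < g' t"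
        have "g x < g y" if "x < y" "z - r \<le> x" "y \<le> z + r" for x y
        proof (rule DERIV_pos_imp_increasing[OF \<open>x < y\<close>])
          fix t assume "x \<le> t" "t \<le> y"
          then have "t \<in> {z - 2*r..z + 2*r}" using that r0 by auto
          then show "\<exists>y. (g has_real_derivative y) (at t) \<and> 0 < y" using g sg by blast
        qed
        from this[of "z - r" z] this[of z "z + r"]
        have "G k (z - r) \<le> 0" "0 \<le> G k (z + r)" using close gz r0 by auto
        then show ?thesis using IVT'[of "G k" "z - r" 0 "z + r"] cont r0 by auto
      next
        assume sg: "\<forall>t\<in>{z - 2*r..z + 2*r}. g' t < 0"
        have "g y < g x" if "x < y" "z - r \<le> x" "y \<le> z + r" for x y
        proof (rule DERIV_neg_imp_decreasing[OF \<open>x < y\<close>])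
          fix t assume "x \<le> t" "t \<le> y"
          then have "t \<in> {z - 2*r..z + 2*r}" using that r0 by auto
          then show "\<exists>y. (g has_real_derivative y) (at t) \<and> y < 0" using g sg by blast
        qed
        from this[of "z - r" z] this[of z "z + r"]
        have "G k (z - r) \<ge> 0" "0 \<ge> G k (z + r)" using close gz r0 by auto
        then show ?thesis using IVT2'[of "G k" "z + r" 0 "z - r"] cont r0 by auto
      qed
    qed
    then obtain \<psi> where \<psi>: "\<And>z. z \<in> Z \<Longrightarrow> \<psi> z \<in> {z - r..z + r}" "\<And>z. z \<in> Z \<Longrightarrow> G k (\<psi> z) = 0" by metis
    have mono: "\<psi> z < \<psi> w" if "z \<in> Z" "w \<in> Z" "z < w" for z w
    proof -
      have "\<not> \<bar>w - z\<bar> \<le> 2 * r" using sep[of z w] that by (auto simp: Z_def)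
      then show ?thesis using \<psi>(1)[OF that(1)] \<psi>(1)[OF that(2)] that(3) by auto
    qed
    have img: "{\<tau>. \<tau> < \<psi> t0 \<and> G k \<tau> = 0} = \<psi> ` {\<tau>. \<tau> < t0 \<and> g \<tau> = 0}" (is "?L = ?R")
    proof
      show "?R \<subseteq> ?L" using mono[OF _ t0Z] \<psi>(2) by (auto simp: Z_def)
      show "?L \<subseteq> ?R"
      proof
        fix \<tau> assume \<tau>: "\<tau> \<in> ?L"
        then have "a < \<tau>" using elim(3) not_le by blast
        moreover have "\<tau> \<le> t0 + r" using \<tau> \<psi>(1)[OF t0Z] by auto
        ultimately obtain z where z: "z \<in> Z" "\<tau> \<in> {z - r<..<z + r}"
          using GK[of \<tau>] \<tau> unfolding K_def by auto
        then have "\<tau> = \<psi> z" using uniq[OF z(1)] \<psi> \<tau> by auto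
        moreover have "z \<noteq> t0" using \<tau> calculation by auto
        ultimately show "\<tau> \<in> ?R" using z(1) by (auto simp: Z_def)
      qed
    qed
    have "inj_on \<psi> {\<tau>. \<tau> < t0 \<and> g \<tau> = 0}"
    proof (rule inj_onI)
      fix x y assume "x \<in> {\<tau>. \<tau> < t0 \<and> g \<tau> = 0}" "y \<in> {\<tau>. \<tau> < t0 \<and> g \<tau> = 0}" "\<psi> x = \<psi> y"
      then show "x = y" using mono[of x y] mono[of y x]
        by (cases x y rule: linorder_cases) (auto simp: Z_def)
    qed
    moreover have "finite {\<tau>. \<tau> < t0 \<and> g \<tau> = 0}" by (rule finite_subset[OF _ finZ]) (auto simp: Z_def)
    moreover have "\<bar>\<psi> t0 - t0\<bar> < e" using \<psi>(1)[OF t0Z] re by auto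
    ultimately show ?case using \<psi>(2)[OF t0Z]
      by (intro exI[of _ "\<psi> t0"]) (simp add: img card_image)
  qed
qed

section \<open>The Emden equation and its energy\<close>

locale supercritical =
  fixes N :: nat and p :: real
  assumes N3: "3 \<le> N" and pS: "(real N + 2) / (real N - 2) < p"
begin

abbreviation "\<theta> \<equiv> theta p"
abbreviation "A \<equiv> Aconst N p"
abbreviation "m \<equiv> mconst N p"
abbreviation "\<alpha> \<equiv> alphaconst N p"

section \<open>Relations between the constants of the change of variables\<close>

lemma N_minus_1: "real (N - 1) = real N - 1" using N3 by simp

lemma power_N: "s ^ N = s * s ^ (N - 1)" for s :: real using N3 by (simp flip: power_Suc)

lemma p_gt_1: "1 < p"
proof -
  have "1 < (real N + 2) / (real N - 2)" using N3 by (simp add: field_simps)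
  then show ?thesis using pS by simp
qed

lemma theta_pos: "0 < \<theta>" using p_gt_1 by (simp add: theta_def)

lemma theta_p: "\<theta> * p = \<theta> + 2"
  using p_gt_1 by (simp add: theta_def field_simps)

text \<open>This is the lower bound on \<open>p\<close> solved for \<open>\<theta>\<close>; it
  amounts to positivity of the damping \<open>\<alpha>\<close>.\<close>

lemma two_theta_less: "2 * \<theta> < real N - 2"
proof -
  have "4 / (real N - 2) < p - 1" using pS N3 by (simp add: field_simps)
  then show ?thesis using p_gt_1 N3 by (simp add: theta_def field_simps)
qed

text \<open>Equals \<open>A powr (p - 1)\<close>, the value for which
  \<open>A * s powr (- \<theta>)\<close> solves the pure power equation
  \<open>u'' + (N - 1) / s * u' + u powr p = 0\<close>. Scaling time by
  \<open>m = \<kappa> powr (- 1 / 2)\<close> makes the coefficient of \<open>y\<close> equal to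
  1.\<close>

definition "\<kappa> = \<theta> * (real N - 2 - \<theta>)"

lemma kappa_pos: "0 < \<kappa>"
  using theta_pos two_theta_less by (simp add: \<kappa>_def)

lemma m_pos: "0 < m" using kappa_pos by (simp add: mconst_def \<kappa>_def[symmetric])

lemma m_sq: "m\<^sup>2 * \<kappa> = 1"
proof -
  have "m\<^sup>2 = \<kappa> powr (- 1)"
    by (simp add: mconst_def \<kappa>_def[symmetric] powr_powr flip: powr_numeral[of "_ powr _"])
  then show ?thesis using kappa_pos by (simp add: powr_minus_divide)
qed

lemma A_pos: "0 < A" using kappa_pos by (simp add: Aconst_def \<kappa>_def[symmetric])

lemma A_powr_p: "A powr p * m\<^sup>2 = A"
proof -
  have "A powr (p - 1) = \<kappa>" using p_gt_1 kappa_pos by (simp add: Aconst_def \<kappa>_def[symmetric] powr_powr)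
  then have "A powr p = A * \<kappa>" using A_pos by (simp add: powr_diff field_simps)
  then show ?thesis using m_sq by (simp add: field_simps)
qed

lemma alpha_pos: "0 < \<alpha>" using m_pos two_theta_less by (simp add: alphaconst_def)

text \<open>Equivalently \<open>exp (m * \<theta> * t)\<close> solves
  \<open>y'' + \<alpha> * y' - y = 0\<close>. A constant \<open>u\<close> becomes a multiple of this
  exponential, which is how the solution \<open>u = 1\<close> is handled later.\<close>

lemma alpha_theta: "m\<^sup>2 * \<theta>\<^sup>2 + \<alpha> * (m * \<theta>) = 1"
proof -
  have "m\<^sup>2 * \<theta>\<^sup>2 + \<alpha> * (m * \<theta>) = m\<^sup>2 * \<kappa>"
    by (simp add: alphaconst_def \<kappa>_def power2_eq_square algebra_simps)
  then show ?thesis using m_sq by simp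
qed

section \<open>The first order system and its dissipated energy\<close>

definition rhs :: "real \<Rightarrow> real \<Rightarrow> real \<Rightarrow> real" where
  "rhs t y z = - \<alpha> * z + y - y powr p + m\<^sup>2 * exp (2 * m * t) * y"

definition emden :: "(real \<Rightarrow> real) \<Rightarrow> (real \<Rightarrow> real) \<Rightarrow> bool" where
  "emden y z \<longleftrightarrow> (\<forall>t. 0 < y t \<and> (y has_real_derivative z t) (at t) \<and>
     (z has_real_derivative rhs t (y t) (z t)) (at t))"

definition energy :: "(real \<Rightarrow> real) \<Rightarrow> (real \<Rightarrow> real) \<Rightarrow> real \<Rightarrow> real" where
  "energy y z t = (z t)\<^sup>2 / 2 - (y t)\<^sup>2 * (1 + m\<^sup>2 * exp (2 * m * t)) / 2 + y t powr (p + 1) / (p + 1)"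

lemma emdenD:
  assumes "emden y z"
  shows "0 < y t" "(y has_real_derivative z t) (at t)"
    "(z has_real_derivative rhs t (y t) (z t)) (at t)"
  using assms by (auto simp: emden_def)

text \<open>The damping contributes the first loss. The second comes from the explicit time
  dependence: the growing coefficient \<open>m\<^sup>2 * exp (2 * m * t)\<close> enters the energy
  with a minus sign.\<close>

lemma energy_deriv:
  assumes "emden y z"
  shows "(energy y z has_real_derivative
    - \<alpha> * (z t)\<^sup>2 - m ^ 3 * exp (2 * m * t) * (y t)\<^sup>2) (at t)"
proof -
  have y: "0 < y t" and p: "p + 1 \<noteq> 0" using emdenD(1)[OF assms] p_gt_1 by auto
  have "((\<lambda>t. y t powr (p + 1)) has_real_derivative (p + 1) * y t powr p * z t) (at t)"
    using DERIV_chain2[OF has_real_derivative_powr[OF y, of "p + 1"] emdenD(2)[OF assms]] by simp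
  then have "((\<lambda>t. y t powr (p + 1) / (p + 1)) has_real_derivative y t powr p * z t) (at t)"
    using p using DERIV_cdivide[of "\<lambda>t. y t powr (p + 1)" _ t UNIV "p + 1"] by fastforce
  moreover have "((\<lambda>t. (z t)\<^sup>2 / 2 - (y t)\<^sup>2 * (1 + m\<^sup>2 * exp (2 * m * t)) / 2) has_real_derivative
    z t * rhs t (y t) (z t) - (y t * z t * (1 + m\<^sup>2 * exp (2 * m * t)) + (y t)\<^sup>2 * (m\<^sup>2 * exp (2 * m * t) * (2 * m)) / 2)) (at t)"
    by (auto intro!: derivative_eq_intros emdenD(2,3)[OF assms] simp: power2_eq_square algebra_simps)
  ultimately have "(energy y z has_real_derivative
    z t * rhs t (y t) (z t) - (y t * z t * (1 + m\<^sup>2 * exp (2 * m * t)) + (y t)\<^sup>2 * (m\<^sup>2 * exp (2 * m * t) * (2 * m)) / 2)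
      + y t powr p * z t) (at t)"
    unfolding energy_def by (rule DERIV_add[rotated])
  moreover have "z t * rhs t (y t) (z t) - (y t * z t * (1 + m\<^sup>2 * exp (2 * m * t)) + (y t)\<^sup>2 * (m\<^sup>2 * exp (2 * m * t) * (2 * m)) / 2)
      + y t powr p * z t = - \<alpha> * (z t)\<^sup>2 - m ^ 3 * exp (2 * m * t) * (y t)\<^sup>2"
  proof -
    have "Z * (- a * Z + Y - P + M\<^sup>2 * E * Y) - (Y * Z * (1 + M\<^sup>2 * E) + Y\<^sup>2 * (M\<^sup>2 * E * (2 * M)) / 2) + P * Z
       = - a * Z\<^sup>2 - M ^ 3 * E * Y\<^sup>2" for a Z Y P E M :: real
      by (simp add: algebra_simps power2_eq_square power3_eq_cube)
    then show ?thesis unfolding rhs_def .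
  qed
  ultimately show ?thesis by (simp only:)
qed

lemma energy_antimono:
  assumes "emden y z" "s \<le> t"
  shows "energy y z t \<le> energy y z s"
proof (rule DERIV_nonpos_imp_nonincreasing[OF assms(2)])
  fix x
  have "0 \<le> \<alpha> * (z x)\<^sup>2" "0 \<le> m ^ 3 * exp (2 * m * x) * (y x)\<^sup>2"
    using alpha_pos m_pos by simp_all
  then show "\<exists>l. (energy y z has_real_derivative l) (at x) \<and> l \<le> 0"
    using energy_deriv[OF assms(1), of x] by (intro exI[of _ "- \<alpha> * (z x)\<^sup>2 - m ^ 3 * exp (2 * m * x) * (y x)\<^sup>2"] conjI) auto
qed

lemma energy_drop:
  assumes "emden y z" "s \<le> t" "\<And>x. s \<le> x \<Longrightarrow> x \<le> t \<Longrightarrow> c \<le> (z x)\<^sup>2"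
  shows "energy y z t \<le> energy y z s - \<alpha> * c * (t - s)"
proof -
  have "energy y z t + \<alpha> * c * t \<le> energy y z s + \<alpha> * c * s"
  proof (rule DERIV_nonpos_imp_nonincreasing[OF assms(2)])
    fix x assume x: "s \<le> x" "x \<le> t"
    have "0 \<le> m ^ 3 * exp (2 * m * x) * (y x)\<^sup>2" using m_pos by simp
    moreover have "\<alpha> * c \<le> \<alpha> * (z x)\<^sup>2" using assms(3)[OF x] alpha_pos by simp
    ultimately show "\<exists>l. ((\<lambda>t. energy y z t + \<alpha> * c * t) has_real_derivative l) (at x) \<and> l \<le> 0"
      using energy_deriv[OF assms(1), of x]
      by (intro exI[of _ "- \<alpha> * (z x)\<^sup>2 - m ^ 3 * exp (2 * m * x) * (y x)\<^sup>2 + \<alpha> * c"] conjI)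
         (auto intro!: derivative_eq_intros)
  qed
  then show ?thesis by (simp add: algebra_simps)
qed

section \<open>The potential well of the autonomous equation\<close>

definition well :: "real \<Rightarrow> real" where
  "well y = - y\<^sup>2 / 2 + y powr (p + 1) / (p + 1)"

lemma energy_well: "energy y z t = (z t)\<^sup>2 / 2 + well (y t) - (y t)\<^sup>2 * (m\<^sup>2 * exp (2 * m * t)) / 2"
  by (simp add: energy_def well_def field_simps)

lemma well_deriv: "0 < y \<Longrightarrow> (well has_real_derivative y powr p - y) (at y)"
proof -
  assume y: "0 < y"
  have "((\<lambda>y. y powr (p + 1) / (p + 1)) has_real_derivative (p + 1) * y powr p / (p + 1)) (at y)"
    using DERIV_cdivide[OF has_real_derivative_powr[OF y, of "p + 1"], of "p + 1"] by simp
  then have 1: "((\<lambda>y. y powr (p + 1) / (p + 1)) has_real_derivative y powr p) (at y)"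
    using p_gt_1 by simp
  have 2: "((\<lambda>y. - y\<^sup>2 / 2) has_real_derivative - y) (at y)"
    by (auto intro!: derivative_eq_intros)
  show ?thesis unfolding well_def using DERIV_add[OF 2 1] by simp
qed

lemma powr_p_less: "0 < y \<Longrightarrow> y < 1 \<Longrightarrow> y powr p < y"
  using powr_less_mono'[of y 1 p] p_gt_1 by simp

lemma powr_p_greater: "1 < y \<Longrightarrow> y < y powr p"
  using powr_less_mono[of 1 p y] p_gt_1 by simp

lemma well_strict_decreasing: "0 < x \<Longrightarrow> x < y \<Longrightarrow> y \<le> 1 \<Longrightarrow> well y < well x"
proof -
  assume xy: "0 < x" "x < y" "y \<le> 1"
  show ?thesis
  proof (rule DERIV_neg_imp_decreasing_open[OF xy(2)])
    show "\<exists>l. (well has_real_derivative l) (at t) \<and> l < 0" if "x < t" "t < y" for t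
      using that xy well_deriv[of t] powr_p_less[of t] by (intro exI[of _ "t powr p - t"]) auto
    show "continuous_on {x..y} well"
      using well_deriv xy by (intro continuous_at_imp_continuous_on ballI DERIV_isCont[OF well_deriv]) auto
  qed
qed

lemma well_strict_increasing: "1 \<le> x \<Longrightarrow> x < y \<Longrightarrow> well x < well y"
proof -
  assume xy: "1 \<le> x" "x < y"
  show ?thesis
  proof (rule DERIV_pos_imp_increasing_open[OF xy(2)])
    show "\<exists>l. (well has_real_derivative l) (at t) \<and> l > 0" if "x < t" "t < y" for t
      using that xy well_deriv[of t] powr_p_greater[of t] by (intro exI[of _ "t powr p - t"]) auto
    show "continuous_on {x..y} well"
      using well_deriv xy by (intro continuous_at_imp_continuous_on ballI DERIV_isCont[OF well_deriv]) auto
  qed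
qed

lemma well_min: "0 < y \<Longrightarrow> well 1 \<le> well y"
  using well_strict_decreasing[of y 1] well_strict_increasing[of 1 y]
  by (cases y "1::real" rule: linorder_cases) auto

text \<open>\<open>\<delta>\<close> is the smaller of the barrier heights at
  \<open>1 - \<epsilon>\<close> and \<open>1 + \<epsilon>\<close>; further out the well is higher
  still by monotonicity.\<close>

lemma well_coercive:
  assumes "0 < \<eta>"
  obtains \<delta> where "0 < \<delta>" "\<And>y. 0 < y \<Longrightarrow> well y < well 1 + \<delta> \<Longrightarrow> \<bar>y - 1\<bar> < \<eta>"
proof -
  \<comment> \<open>The cap 1/2 keeps \<open>1 - \<epsilon>\<close> in the positive range where
    \<open>well\<close> is decreasing.\<close>
  define \<epsilon> where "\<epsilon> = min \<eta> (1/2)"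
  have e: "0 < \<epsilon>" "\<epsilon> \<le> \<eta>" "\<epsilon> < 1" using assms by (auto simp: \<epsilon>_def)
  define \<delta> where "\<delta> = min (well (1 - \<epsilon>) - well 1) (well (1 + \<epsilon>) - well 1)"
  have "0 < \<delta>" using well_strict_decreasing[of "1-\<epsilon>" 1] well_strict_increasing[of 1 "1+\<epsilon>"] e
    by (simp add: \<delta>_def)
  moreover have "\<bar>y - 1\<bar> < \<eta>" if y: "0 < y" "well y < well 1 + \<delta>" for y
  proof (rule ccontr)
    assume "\<not> \<bar>y - 1\<bar> < \<eta>"
    then have "y \<le> 1 - \<epsilon> \<or> 1 + \<epsilon> \<le> y" using e by auto
    then show False
    proof
      assume "y \<le> 1 - \<epsilon>"
      then have "well (1 - \<epsilon>) \<le> well y"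
        using well_strict_decreasing[of y "1-\<epsilon>"] y e by (cases "y = 1 - \<epsilon>") auto
      then show False using y by (simp add: \<delta>_def)
    next
      assume "1 + \<epsilon> \<le> y"
      then have "well (1 + \<epsilon>) \<le> well y"
        using well_strict_increasing[of "1+\<epsilon>" y] e by (cases "y = 1 + \<epsilon>") auto
      then show False using y by (simp add: \<delta>_def)
    qed
  qed
  ultimately show ?thesis using that by blast
qed

section \<open>Solutions of nonpositive energy and their uniform bounds\<close>

definition orbit :: "(real \<Rightarrow> real) \<Rightarrow> (real \<Rightarrow> real) \<Rightarrow> bool" where
  "orbit y z \<longleftrightarrow> emden y z \<and> (\<forall>t. energy y z t \<le> 0)"

lemma orbitD: "orbit y z \<Longrightarrow> emden y z" "orbit y z \<Longrightarrow> energy y z t \<le> 0"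
  by (auto simp: orbit_def)

text \<open>Regular and singular solutions share the sign of the energy, so bounds drawn from it
  hold with the same constants for all of them. Each bound results from dropping one of the two
  positive terms of the energy.\<close>

lemma orbit_bounds:
  assumes "orbit y z"
  shows "y t powr (p - 1) \<le> (p + 1) / 2 * (1 + m\<^sup>2 * exp (2 * m * t))"
    and "(z t)\<^sup>2 \<le> (y t)\<^sup>2 * (1 + m\<^sup>2 * exp (2 * m * t))"
proof -
  define Q where "Q = 1 + m\<^sup>2 * exp (2 * m * t)"
  have y: "0 < y t" using emdenD(1)[OF orbitD(1)[OF assms]] .
  have p1: "y t powr (p + 1) = (y t)\<^sup>2 * y t powr (p - 1)"
    using y by (simp add: powr_add powr_diff power2_eq_square)
  have E: "(z t)\<^sup>2 / 2 - (y t)\<^sup>2 * Q / 2 + (y t)\<^sup>2 * y t powr (p - 1) / (p + 1) \<le> 0"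
    using orbitD(2)[OF assms, of t] by (simp add: energy_def p1 Q_def)
  have nn: "0 \<le> (y t)\<^sup>2 * y t powr (p - 1) / (p + 1)" using p_gt_1 by simp
  show "(z t)\<^sup>2 \<le> (y t)\<^sup>2 * (1 + m\<^sup>2 * exp (2 * m * t))"
    using E nn unfolding Q_def[symmetric] by linarith
  have "(y t)\<^sup>2 * y t powr (p - 1) / (p + 1) \<le> (y t)\<^sup>2 * Q / 2"
    using E zero_le_power2[of "z t"] by linarith
  then have "(y t)\<^sup>2 * (y t powr (p - 1) / (p + 1)) \<le> (y t)\<^sup>2 * (Q / 2)" by simp
  then have "y t powr (p - 1) / (p + 1) \<le> Q / 2"
    using y by (metis mult_le_cancel_left_pos zero_less_power)
  then show "y t powr (p - 1) \<le> (p + 1) / 2 * (1 + m\<^sup>2 * exp (2 * m * t))"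
    unfolding Q_def[symmetric] using p_gt_1 by (simp add: field_simps)
qed

text \<open>\<open>B\<close> depends on \<open>T\<close> only, not on the orbit: the coefficient
  \<open>exp (2 * m * t)\<close> increases, so its value at \<open>T\<close> controls the whole half
  line to the left.\<close>

lemma orbit_bounded:
  obtains B where "1 \<le> B" "\<And>y z t. orbit y z \<Longrightarrow> t \<le> T \<Longrightarrow> y t \<le> B"
    "\<And>y z t. orbit y z \<Longrightarrow> t \<le> T \<Longrightarrow> \<bar>z t\<bar> \<le> B"
    "\<And>y z t. orbit y z \<Longrightarrow> t \<le> T \<Longrightarrow> \<bar>rhs t (y t) (z t)\<bar> \<le> B"
proof -
  define Q where "Q = 1 + m\<^sup>2 * exp (2 * m * T)"
  define b where "b = ((p + 1) / 2 * Q) powr (1 / (p - 1))"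
  define B where "B = 1 + b * Q + (\<alpha> * (b * Q) + b * Q + b powr p)"
  have Q: "1 \<le> Q" by (simp add: Q_def)
  have b: "0 \<le> b" by (simp add: b_def)
  have y: "y t \<le> b" and z: "\<bar>z t\<bar> \<le> b * Q" and r: "\<bar>rhs t (y t) (z t)\<bar> \<le> \<alpha> * (b * Q) + b * Q + b powr p"
    if o: "orbit y z" and t: "t \<le> T" for y z t
  proof -
    have y0: "0 < y t" using emdenD(1)[OF orbitD(1)[OF o]] .
    have et: "exp (2 * m * t) \<le> exp (2 * m * T)" using m_pos t by simp
    then have q: "1 + m\<^sup>2 * exp (2 * m * t) \<le> Q" unfolding Q_def by (intro add_left_mono mult_left_mono) auto
    have "y t = (y t powr (p - 1)) powr (1 / (p - 1))" using y0 p_gt_1 by (simp add: powr_powr)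
    also have "\<dots> \<le> b" unfolding b_def
    proof (rule powr_mono2)
      show "y t powr (p - 1) \<le> (p + 1) / 2 * Q"
        by (rule order.trans[OF orbit_bounds(1)[OF o] mult_left_mono[OF q]]) (use p_gt_1 in simp)
    qed (use p_gt_1 in auto)
    finally show yb: "y t \<le> b" .
    have "(z t)\<^sup>2 \<le> (b * Q)\<^sup>2"
    proof -
      have "(z t)\<^sup>2 \<le> (y t)\<^sup>2 * (1 + m\<^sup>2 * exp (2 * m * t))" by (rule orbit_bounds(2)[OF o])
      also have "\<dots> \<le> b\<^sup>2 * Q\<^sup>2"
      proof (rule mult_mono)
        show "(y t)\<^sup>2 \<le> b\<^sup>2" using yb y0 by (intro power_mono) auto
        show "1 + m\<^sup>2 * exp (2 * m * t) \<le> Q\<^sup>2" using q Q self_le_power[of Q 2] by simp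
      qed auto
      finally show ?thesis by (simp add: power_mult_distrib)
    qed
    then show zb: "\<bar>z t\<bar> \<le> b * Q" using abs_le_square_iff[of "z t" "b * Q"] b Q by simp
    have "0 \<le> y t * (1 + m\<^sup>2 * exp (2 * m * t))" using y0 by simp
    moreover have "y t * (1 + m\<^sup>2 * exp (2 * m * t)) \<le> b * Q" using yb q y0 b by (intro mult_mono) auto
    moreover have "0 \<le> y t powr p" "y t powr p \<le> b powr p" using y0 yb p_gt_1 by (auto intro: powr_mono2)
    moreover have "\<bar>\<alpha> * z t\<bar> \<le> \<alpha> * (b * Q)" using zb alpha_pos by (simp add: abs_mult)
    moreover have "rhs t (y t) (z t) = - (\<alpha> * z t) + y t * (1 + m\<^sup>2 * exp (2 * m * t)) - y t powr p"
      by (simp add: rhs_def algebra_simps)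
    ultimately show "\<bar>rhs t (y t) (z t)\<bar> \<le> \<alpha> * (b * Q) + b * Q + b powr p" by linarith
  qed
  have nn: "0 \<le> b * Q" "0 \<le> \<alpha> * (b * Q)" "b \<le> b * Q" using b Q alpha_pos by (auto simp: mult_le_cancel_left1)
  show ?thesis
  proof (rule that[of B])
    show "1 \<le> B" using nn powr_ge_zero[of b p] unfolding B_def by linarith
    show "y t \<le> B" if "orbit y z" "t \<le> T" for y z t using y[OF that] nn powr_ge_zero[of b p] unfolding B_def by linarith
    show "\<bar>z t\<bar> \<le> B" if "orbit y z" "t \<le> T" for y z t using z[OF that] nn powr_ge_zero[of b p] unfolding B_def by linarith
    show "\<bar>rhs t (y t) (z t)\<bar> \<le> B" if "orbit y z" "t \<le> T" for y z t
      using r[OF that] nn unfolding B_def by linarith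
  qed
qed

text \<open>Only the middle term of the energy is negative, so an energy below \<open>- c\<close>
  keeps \<open>y\<close> off the trivial equilibrium 0.\<close>

lemma energy_lower:
  assumes "emden y z" "energy y z t \<le> - c"
  shows "2 * c \<le> (y t)\<^sup>2 * (1 + m\<^sup>2 * exp (2 * m * t))"
proof -
  have "0 \<le> y t powr (p + 1) / (p + 1)" using p_gt_1 by simp
  then show ?thesis using assms(2) zero_le_power2[of "z t"] unfolding energy_def by linarith
qed

lemma orbit_away_from_0:
  assumes em: "emden y z" and e: "energy y z t \<le> - c" and t: "t \<le> 0"
  shows "sqrt (2 * c / (1 + m\<^sup>2)) \<le> y t"
proof -
  have m1: "0 < 1 + m\<^sup>2" by (simp add: add_pos_nonneg)
  have "exp (2 * m * t) \<le> 1" using m_pos t by (simp add: mult_nonneg_nonpos)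
  then have "1 + m\<^sup>2 * exp (2 * m * t) \<le> 1 + m\<^sup>2" by (simp add: mult_left_le)
  then have "(y t)\<^sup>2 * (1 + m\<^sup>2 * exp (2 * m * t)) \<le> (y t)\<^sup>2 * (1 + m\<^sup>2)" by (rule mult_left_mono) simp
  then have "2 * c \<le> (y t)\<^sup>2 * (1 + m\<^sup>2)" using energy_lower[OF em e] by linarith
  then have "2 * c / (1 + m\<^sup>2) \<le> (y t)\<^sup>2" using m1 by (simp add: pos_divide_le_eq)
  then show ?thesis using emdenD(1)[OF em, of t] by (simp add: real_le_lsqrt)
qed

section \<open>Trapping near the bottom of the well\<close>

lemma exp_small_left:
  assumes "0 < e"
  obtains M where "0 \<le> M" "\<And>t. t \<le> - M \<Longrightarrow> exp (2 * m * t) < e"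
proof (rule that[of "\<bar>ln e / (2 * m)\<bar> + 1"])
  fix t assume "t \<le> - (\<bar>ln e / (2 * m)\<bar> + 1)"
  then have "t < ln e / (2 * m)" by linarith
  then have "2 * m * t < ln e" using m_pos by (simp add: field_simps)
  then have "exp (2 * m * t) < exp (ln e)" by (simp only: exp_less_cancel_iff)
  then show "exp (2 * m * t) < e" using assms by simp
qed simp

text \<open>The energy differs from \<open>z^2 / 2 + well y\<close> by the nonautonomous term alone,
  which is uniformly small left of \<open>- M\<close>. Near its minimum the energy therefore
  controls the distance to \<open>(1, 0)\<close>, and it never increases again.\<close>

lemma trapping:
  assumes "0 < \<eta>"
  obtains \<delta> M where "0 < \<delta>" "0 \<le> M"
    "\<And>y z s t. orbit y z \<Longrightarrow> energy y z s \<le> well 1 + \<delta> \<Longrightarrow> s \<le> t \<Longrightarrow> t \<le> - M \<Longrightarrow> \<bar>y t - 1\<bar> < \<eta> \<and> \<bar>z t\<bar> < \<eta>"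
proof -
  obtain \<delta>' where d': "0 < \<delta>'" "\<And>y. 0 < y \<Longrightarrow> well y < well 1 + \<delta>' \<Longrightarrow> \<bar>y - 1\<bar> < \<eta>"
    using well_coercive[OF assms] by blast
  \<comment> \<open>One \<open>\<delta>\<close> pays for the excess energy and one for the
    nonautonomous term, so \<open>2 * \<delta>\<close> has to respect both the barrier
    \<open>\<delta>'\<close> and the kinetic bound \<open>\<eta>\<^sup>2 / 2\<close>.\<close>
  define \<delta> where "\<delta> = min \<delta>' (\<eta>\<^sup>2 / 2) / 2"
  have d: "0 < \<delta>" "2 * \<delta> \<le> \<delta>'" "2 * \<delta> \<le> \<eta>\<^sup>2 / 2" using d'(1) assms by (auto simp: \<delta>_def)
  obtain B where B: "1 \<le> B" "\<And>y z t. orbit y z \<Longrightarrow> t \<le> 0 \<Longrightarrow> y t \<le> B"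
    using orbit_bounded[of 0] by metis
  have Bm: "0 < B\<^sup>2 * m\<^sup>2" using B(1) m_pos by simp
  then obtain M where M: "0 \<le> M" "\<And>t. t \<le> - M \<Longrightarrow> exp (2 * m * t) < \<delta> / (B\<^sup>2 * m\<^sup>2)"
    using exp_small_left[of "\<delta> / (B\<^sup>2 * m\<^sup>2)"] d(1) by (metis divide_pos_pos)
  show ?thesis
  proof (rule that[OF d(1) M(1)])
    fix y z s t assume o: "orbit y z" and e: "energy y z s \<le> well 1 + \<delta>" and st: "s \<le> t" and t: "t \<le> - M"
    have y0: "0 < y t" using emdenD(1)[OF orbitD(1)[OF o]] .
    have "(y t)\<^sup>2 * (m\<^sup>2 * exp (2 * m * t)) \<le> B\<^sup>2 * (m\<^sup>2 * exp (2 * m * t))"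
      using B(2)[OF o, of t] t M(1) y0 by (intro mult_right_mono power_mono) auto
    also have "\<dots> < \<delta>" using M(2)[OF t] Bm by (simp add: field_simps)
    finally have pert: "(y t)\<^sup>2 * (m\<^sup>2 * exp (2 * m * t)) < \<delta>" .
    have "energy y z t \<le> well 1 + \<delta>" using energy_antimono[OF orbitD(1)[OF o] st] e by simp
    then have E: "(z t)\<^sup>2 / 2 + well (y t) < well 1 + 2 * \<delta>" using pert d(1) unfolding energy_well by linarith
    have "well (y t) < well 1 + \<delta>'" using E d(2) zero_le_power2[of "z t"] by linarith
    then have 1: "\<bar>y t - 1\<bar> < \<eta>" using d'(2) y0 by blast
    have "(z t)\<^sup>2 < \<eta>\<^sup>2" using E d(3) well_min[OF y0] by linarith
    then have "\<bar>z t\<bar> < \<eta>" using assms power2_less_imp_less[of "\<bar>z t\<bar>" \<eta>] by simp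
    with 1 show "\<bar>y t - 1\<bar> < \<eta> \<and> \<bar>z t\<bar> < \<eta>" ..
  qed
qed

section \<open>Approach to the equilibrium\<close>

text \<open>A LaSalle argument with explicit time. From \<open>s\<close> on the energy stays between
  \<open>- D\<close> and \<open>- c\<close>, so among \<open>K\<close> consecutive blocks of length
  2 one loses less than \<open>q\<close>. On that block the speed is below \<open>\<zeta>\<close>,
  so somewhere the acceleration and with it the force \<open>y powr p - y\<close> is small;
  \<open>y\<close> is then near 1, because energy below \<open>- c\<close> excludes the equilibrium
  0.\<close>

lemma orbit_reaches_well:
  assumes c: "0 < c" and \<delta>: "0 < \<delta>"
  obtains L M where "0 \<le> L" "0 \<le> M"
    "\<And>y z s. orbit y z \<Longrightarrow> energy y z s \<le> - c \<Longrightarrow> s + L \<le> - M \<Longrightarrow> energy y z (s + L) \<le> well 1 + \<delta>"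
proof -
  obtain B where B: "1 \<le> B" "\<And>y z t. orbit y z \<Longrightarrow> t \<le> 0 \<Longrightarrow> y t \<le> B"
    "\<And>y z t. orbit y z \<Longrightarrow> t \<le> 0 \<Longrightarrow> \<bar>rhs t (y t) (z t)\<bar> \<le> B"
    using orbit_bounded[of 0] by metis
  define c1 where "c1 = sqrt (2 * c / (1 + m\<^sup>2))"
  have m1: "0 < 1 + m\<^sup>2" by (simp add: add_pos_nonneg)
  have c1: "0 < c1" unfolding c1_def using c m1 by simp
  have ylow: "c1 \<le> y t" if "orbit y z" "energy y z t \<le> - c" "t \<le> 0" for y z t
    unfolding c1_def by (rule orbit_away_from_0[OF orbitD(1)[OF that(1)] that(2,3)])
  \<comment> \<open>Values of \<open>y\<close> away from both equilibria: \<open>c1\<close> excludes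
    0 and the condition on \<open>well\<close> a neighbourhood of 1. On this compact set the force
    is at least some \<open>\<mu>\<close>.\<close>
  define S where "S = {y \<in> {c1..B}. well 1 + \<delta> / 2 \<le> well y}"
  have cw: "continuous_on {c1..B} well"
    using c1 by (intro continuous_at_imp_continuous_on ballI DERIV_isCont[OF well_deriv]) auto
  have "S = {c1..B} \<inter> well -` {well 1 + \<delta> / 2..}" by (auto simp: S_def)
  then have "closed S" using continuous_closed_preimage[OF cw] by simp
  moreover have "bounded S" by (rule bounded_subset[of "{c1..B}"]) (auto simp: S_def)
  ultimately have "compact S" by (simp add: compact_eq_bounded_closed)
  obtain \<mu> where \<mu>: "0 < \<mu>" "\<And>y. y \<in> S \<Longrightarrow> \<mu> \<le> \<bar>y powr p - y\<bar>"
  proof (cases "S = {}")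
    case False
    have "continuous_on S (\<lambda>y. \<bar>y powr p - y\<bar>)"
      using c1 by (intro continuous_intros continuous_on_powr') (auto simp: S_def)
    then obtain x where x: "x \<in> S" "\<forall>y\<in>S. \<bar>x powr p - x\<bar> \<le> \<bar>y powr p - y\<bar>"
      using continuous_attains_inf[OF \<open>compact S\<close> False] by blast
    have "x \<noteq> 1" "0 < x" using x(1) c1 \<delta> by (auto simp: S_def)
    then have "x powr p \<noteq> x" using powr_p_less[of x] powr_p_greater[of x] by linarith
    then show ?thesis using that[of "\<bar>x powr p - x\<bar>"] x by auto
  qed (use that[of 1] in auto)
  \<comment> \<open>The first bound makes acceleration, damping and nonautonomous term together
    smaller than \<open>\<mu>\<close>; the other two give
    \<open>\<zeta>\<^sup>2 \<le> \<delta>\<close>.\<close>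
  define \<zeta> where "\<zeta> = min (\<mu> / (2 + \<alpha>)) (min 1 \<delta>)"
  have z: "0 < \<zeta>" "\<zeta> \<le> 1" "\<zeta> \<le> \<delta>" using \<mu>(1) \<delta> alpha_pos by (auto simp: \<zeta>_def)
  have "\<zeta> \<le> \<mu> / (2 + \<alpha>)" by (simp add: \<zeta>_def)
  then have z\<mu>: "\<zeta> * (2 + \<alpha>) \<le> \<mu>" using alpha_pos by (simp add: pos_le_divide_eq)
  have "\<zeta> * \<zeta> \<le> \<zeta> * 1" using z by (intro mult_left_mono) auto
  then have z2: "\<zeta>\<^sup>2 \<le> \<delta>" using z unfolding power2_eq_square by linarith
  \<comment> \<open>As \<open>z\<close> is \<open>B\<close>-Lipschitz, a speed
    \<open>\<zeta>\<close> persists as at least \<open>\<zeta> / 2\<close> for time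
    \<open>h\<close>, and \<open>q\<close> below is the energy this costs. The cap 1 makes
    \<open>h\<close> fit into half a block.\<close>
  define h where "h = min 1 (\<zeta> / (2 * B))"
  have "B * h \<le> B * (\<zeta> / (2 * B))" using B(1) by (intro mult_left_mono) (auto simp: h_def)
  then have h: "0 < h" "h \<le> 1" "B * h \<le> \<zeta> / 2"
    using z B(1) by (auto simp: h_def)
  define q where "q = \<alpha> * (\<zeta>\<^sup>2 / 4) * h"
  have q: "0 < q" using alpha_pos z h by (simp add: q_def)
  \<comment> \<open>\<open>- D\<close> bounds the energy from below for \<open>t \<le> 0\<close>:
    the well is at least \<open>well 1\<close> and the nonautonomous term at most
    \<open>B\<^sup>2 * m\<^sup>2 / 2\<close>.\<close>
  define D where "D = B\<^sup>2 * m\<^sup>2 / 2 - well 1"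
  obtain K where K: "D < real K * q" using reals_Archimedean3[OF q] by blast
  have "0 < \<zeta> / (B * m\<^sup>2)" using z(1) B(1) m_pos by simp
  then obtain M where M: "0 \<le> M" "\<And>t. t \<le> - M \<Longrightarrow> exp (2 * m * t) < \<zeta> / (B * m\<^sup>2)"
    using exp_small_left by blast
  show ?thesis
  proof (rule that[of "2 * real K" M])
    fix y z s assume o: "orbit y z" and e: "energy y z s \<le> - c" and sM: "s + 2 * real K \<le> - M"
    note em = orbitD(1)[OF o]
    have low: "- D \<le> energy y z t" if "t \<le> 0" for t
    proof -
      have "exp (2 * m * t) \<le> 1" using m_pos that by (simp add: mult_nonneg_nonpos)
      then have "m\<^sup>2 * exp (2 * m * t) \<le> m\<^sup>2" by (simp add: mult_left_le)
      moreover have "(y t)\<^sup>2 \<le> B\<^sup>2" using B(2)[OF o that] emdenD(1)[OF em, of t] by (intro power_mono) auto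
      ultimately have "(y t)\<^sup>2 * (m\<^sup>2 * exp (2 * m * t)) \<le> B\<^sup>2 * m\<^sup>2" by (intro mult_mono) auto
      then show ?thesis using well_min[OF emdenD(1)[OF em, of t]] zero_le_power2[of "z t"]
        unfolding energy_well D_def by linarith
    qed
    \<comment> \<open>Otherwise \<open>K\<close> losses of \<open>q\<close> would push the energy
      below \<open>- D\<close>.\<close>
    have "\<exists>k<K. energy y z (s + 2 * real k) - energy y z (s + 2 * real (Suc k)) < q"
    proof (rule ccontr)
      assume "\<not> ?thesis"
      then have "\<And>k. k < K \<Longrightarrow> q \<le> energy y z (s + 2 * real k) - energy y z (s + 2 * real (Suc k))"
        by (meson not_less)
      then have st: "energy y z (s + 2 * real (Suc k)) \<le> energy y z (s + 2 * real k) - q" if "k < K" for k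
        using that by (simp add: le_diff_eq add.commute)
      have "k \<le> K \<Longrightarrow> energy y z (s + 2 * real k) \<le> energy y z s - real k * q" for k
      proof (induction k)
        case (Suc k)
        then show ?case using st[of k] by (simp add: algebra_simps)
      qed simp
      from this[of K] show False using K e c low[of "s + 2 * real K"] sM M(1) by simp
    qed
    then obtain k where k: "k < K" "energy y z (s + 2 * real k) - energy y z (s + 2 * real (Suc k)) < q" by blast
    define a where "a = s + 2 * real k"
    have eab: "energy y z a - energy y z (a + 2) < q" using k(2) by (simp add: a_def algebra_simps)
    have "real k + 1 \<le> real K" using k(1) by linarith
    then have aK: "a + 2 \<le> s + 2 * real K" by (simp add: a_def)
    have lip: "\<bar>z x - z w\<bar> \<le> B * \<bar>x - w\<bar>" if "x \<le> 0" "w \<le> 0" for x w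
      using field_differentiable_bound[of "{..0}" z "\<lambda>t. rhs t (y t) (z t)" B x w]
        emdenD(3)[OF em] B(3)[OF o] that by (auto intro: has_field_derivative_at_within)
    have small: "\<bar>z t1\<bar> < \<zeta>" if t1: "a \<le> t1" "t1 \<le> a + 2" for t1
    proof (rule ccontr)
      assume big: "\<not> \<bar>z t1\<bar> < \<zeta>"
      \<comment> \<open>From \<open>t1\<close> the interval of length \<open>h\<close> extends to
        the right in the first half of the block and to the left in the second, so it never leaves
        the block.\<close>
      define x where "x = (if t1 \<le> a + 1 then t1 else t1 - h)"
      have x: "a \<le> x" "x + h \<le> a + 2" "x \<le> t1" "t1 \<le> x + h" using t1 h by (auto simp: x_def)
      have "\<zeta>\<^sup>2 / 4 \<le> (z w)\<^sup>2" if w: "x \<le> w" "w \<le> x + h" for w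
      proof -
        have "\<bar>z w - z t1\<bar> \<le> B * \<bar>w - t1\<bar>" using lip w x t1 aK sM M(1) by auto
        also have "\<dots> \<le> B * h" using w x B(1) by (intro mult_left_mono) auto
        finally have "\<zeta> / 2 \<le> \<bar>z w\<bar>" using big h(3) by linarith
        then have "(\<zeta> / 2)\<^sup>2 \<le> \<bar>z w\<bar>\<^sup>2" using z(1) by (intro power_mono) auto
        then show ?thesis by (simp add: power_divide)
      qed
      then have "energy y z (x + h) \<le> energy y z x - \<alpha> * (\<zeta>\<^sup>2 / 4) * (x + h - x)"
        using h by (intro energy_drop[OF em]) auto
      moreover have "energy y z (a + 2) \<le> energy y z (x + h)" "energy y z x \<le> energy y z a"
        using x by (auto intro!: energy_antimono[OF em])
      ultimately show False using eab by (simp add: q_def)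
    qed
    \<comment> \<open>The speed is small at both ends of the block, so the mean acceleration is
      small, and it is attained at some \<open>t\<close>.\<close>
    have "\<exists>t>a. t < a + 2 \<and> z (a + 2) - z a = (a + 2 - a) * rhs t (y t) (z t)"
      by (rule MVT2) (auto intro: emdenD(3)[OF em])
    then obtain t where t: "a < t" "t < a + 2" "z (a + 2) - z a = 2 * rhs t (y t) (z t)" by auto
    have tM: "t \<le> - M" using t aK sM by linarith
    have "\<bar>z (a + 2) - z a\<bar> < 2 * \<zeta>" using small[of a] small[of "a + 2"] by linarith
    then have r: "\<bar>rhs t (y t) (z t)\<bar> < \<zeta>" using t(3) by linarith
    have zt: "\<bar>z t\<bar> < \<zeta>" using small t by simp
    have y0: "0 < y t" using emdenD(1)[OF em] .
    have yB: "y t \<le> B" using B(2)[OF o] tM M(1) by simp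
    have "m\<^sup>2 * exp (2 * m * t) * y t \<le> m\<^sup>2 * exp (2 * m * t) * B" using yB by (intro mult_left_mono) auto
    also have "\<dots> < \<zeta>" using M(2)[OF tM] B(1) m_pos by (simp add: field_simps)
    finally have pert: "m\<^sup>2 * exp (2 * m * t) * y t < \<zeta>" .
    have pert0: "0 \<le> m\<^sup>2 * exp (2 * m * t) * y t" using y0 by simp
    have "\<bar>\<alpha> * z t\<bar> \<le> \<alpha> * \<zeta>" using zt alpha_pos by (simp add: abs_mult)
    then have "\<bar>y t powr p - y t\<bar> < \<zeta> * (2 + \<alpha>)"
      using r pert pert0 unfolding rhs_def distrib_left mult.commute[of \<zeta>] by linarith
    then have "y t \<notin> S" using \<mu>(2) z\<mu> by (meson le_less_trans not_less order.trans)
    moreover have "energy y z t \<le> - c" using energy_antimono[OF em, of s t] e t(1) by (simp add: a_def)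
    then have "c1 \<le> y t" using ylow[OF o] tM M(1) by simp
    ultimately have w: "well (y t) < well 1 + \<delta> / 2" using yB by (auto simp: S_def)
    have "(z t)\<^sup>2 \<le> \<zeta>\<^sup>2" using zt z(1) by (metis abs_le_square_iff abs_of_pos less_imp_le)
    then have "(z t)\<^sup>2 \<le> \<delta>" using z2 by simp
    moreover have "0 \<le> (y t)\<^sup>2 * (m\<^sup>2 * exp (2 * m * t))" by simp
    ultimately have "energy y z t \<le> well 1 + \<delta>" using w unfolding energy_well by linarith
    then show "energy y z (s + 2 * real K) \<le> well 1 + \<delta>"
      using energy_antimono[OF em, of t "s + 2 * real K"] t(2) aK by linarith
  qed (use M in auto)
qed

text \<open>\<open>L\<close> and \<open>M\<close> depend neither on the orbit nor on the starting
  time \<open>s\<close>; this is what allows \<open>s\<close> to recede to minus infinity as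
  \<gamma> grows.\<close>

lemma settling:
  assumes "0 < c" "0 < \<eta>"
  obtains L M where "0 \<le> L" "0 \<le> M"
    "\<And>y z s t. orbit y z \<Longrightarrow> energy y z s \<le> - c \<Longrightarrow> s + L \<le> t \<Longrightarrow> t \<le> - M \<Longrightarrow> \<bar>y t - 1\<bar> < \<eta> \<and> \<bar>z t\<bar> < \<eta>"
proof -
  obtain \<delta> M1 where t: "0 < \<delta>" "0 \<le> M1"
    "\<And>y z s t. orbit y z \<Longrightarrow> energy y z s \<le> well 1 + \<delta> \<Longrightarrow> s \<le> t \<Longrightarrow> t \<le> - M1 \<Longrightarrow> \<bar>y t - 1\<bar> < \<eta> \<and> \<bar>z t\<bar> < \<eta>"
    using trapping[OF assms(2)] by metis
  obtain L M2 where w: "0 \<le> L" "0 \<le> M2"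
    "\<And>y z s. orbit y z \<Longrightarrow> energy y z s \<le> - c \<Longrightarrow> s + L \<le> - M2 \<Longrightarrow> energy y z (s + L) \<le> well 1 + \<delta>"
    using orbit_reaches_well[OF assms(1) t(1)] by metis
  show ?thesis
  proof (rule that[of L "max M1 M2"])
    fix y z s t assume o: "orbit y z" and e: "energy y z s \<le> - c" and st: "s + L \<le> t" "t \<le> - max M1 M2"
    have "energy y z (s + L) \<le> well 1 + \<delta>" using w(3)[OF o e] st by auto
    then show "\<bar>y t - 1\<bar> < \<eta> \<and> \<bar>z t\<bar> < \<eta>" using t(3)[OF o _ st(1)] st(2) by auto
  qed (use w t in auto)
qed

section \<open>Stability of the equilibrium and comparison of two solutions\<close>

lemma powr_mean_value:
  assumes "\<bar>a - 1\<bar> < \<eta>" "\<bar>b - 1\<bar> < \<eta>" "\<eta> \<le> 1"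
  obtains \<xi> where "\<bar>\<xi> - 1\<bar> < \<eta>" "a powr p - b powr p = p * \<xi> powr (p - 1) * (a - b)"
proof -
  have *: "\<exists>\<xi>. \<bar>\<xi> - 1\<bar> < \<eta> \<and> b powr p - a powr p = p * \<xi> powr (p - 1) * (b - a)"
    if "a < b" "\<bar>a - 1\<bar> < \<eta>" "\<bar>b - 1\<bar> < \<eta>" for a b
  proof -
    have "\<exists>\<xi>>a. \<xi> < b \<and> b powr p - a powr p = (b - a) * (p * \<xi> powr (p - 1))"
      by (rule MVT2) (use that assms(3) in \<open>auto intro!: has_real_derivative_powr\<close>)
    then obtain \<xi> where "a < \<xi>" "\<xi> < b" "b powr p - a powr p = (b - a) * (p * \<xi> powr (p - 1))" by blast
    then show ?thesis using that by (intro exI[of _ \<xi>]) auto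
  qed
  consider "a < b" | "b < a" | "a = b" by linarith
  then show ?thesis
  proof cases
    case 1
    then obtain \<xi> where "\<bar>\<xi> - 1\<bar> < \<eta>" "b powr p - a powr p = p * \<xi> powr (p - 1) * (b - a)" using * assms by blast
    then show ?thesis using that[of \<xi>] by (simp add: algebra_simps)
  next
    case 2
    then show ?thesis using * assms that by blast
  next
    case 3
    then show ?thesis using that[of 1] assms by auto
  qed
qed

text \<open>The point is that \<open>C\<close> does not depend on the length of the interval from
  \<open>a\<close> to \<open>b\<close>, in contrast to a Gronwall bound. The difference of two
  solutions obeys the linearisation at 1, a damped oscillator of stiffness \<open>p - 1\<close>, up
  to an error that is small near 1 and far to the left.\<close>

lemma contraction_near_1:
  obtains \<eta> C M where "0 < \<eta>" "0 \<le> C" "0 \<le> M"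
    "\<And>y1 z1 y2 z2 a b. emden y1 z1 \<Longrightarrow> emden y2 z2 \<Longrightarrow> a \<le> b \<Longrightarrow> b \<le> - M \<Longrightarrow>
      (\<And>t. a \<le> t \<Longrightarrow> t \<le> b \<Longrightarrow> \<bar>y1 t - 1\<bar> < \<eta>) \<Longrightarrow> (\<And>t. a \<le> t \<Longrightarrow> t \<le> b \<Longrightarrow> \<bar>y2 t - 1\<bar> < \<eta>) \<Longrightarrow>
      (y1 b - y2 b)\<^sup>2 + (z1 b - z2 b)\<^sup>2 \<le> C * ((y1 a - y2 a)\<^sup>2 + (z1 a - z2 a)\<^sup>2)"
proof -
  \<comment> \<open>\<open>\<nu> \<le> \<alpha>\<close> serves the \<open>e\<close> part of the
    dissipation, \<open>\<nu> \<le> (p - 1) / 2\<close> keeps the perturbed stiffness at least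
    \<open>(p - 1) / 2\<close>, and the third bound serves the \<open>d\<close> part.\<close>
  define \<nu> where "\<nu> = min \<alpha> (min ((p - 1) / 2) (\<alpha> * (p - 1) / 2))"
  have \<nu>: "0 < \<nu>" "\<nu> \<le> \<alpha>" "\<nu> \<le> (p - 1) / 2" "\<nu> \<le> \<alpha> * (p - 1) / 2"
    unfolding \<nu>_def using alpha_pos p_gt_1 by (simp, simp, linarith, linarith)
  have "((\<lambda>\<xi>. p * \<xi> powr (p - 1)) \<longlongrightarrow> p * 1 powr (p - 1)) (at (1::real))"
    by (intro tendsto_intros) auto
  then have "\<forall>\<^sub>F \<xi> in at (1::real). dist (p * \<xi> powr (p - 1)) p < \<nu> / 2"
    using \<nu>(1) by (auto dest: tendstoD[of _ _ _ "\<nu> / 2"])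
  then obtain d where d: "0 < d" "\<And>\<xi>::real. \<xi> \<noteq> 1 \<Longrightarrow> dist \<xi> 1 < d \<Longrightarrow> dist (p * \<xi> powr (p - 1)) p < \<nu> / 2"
    unfolding eventually_at by blast
  define \<eta> where "\<eta> = min d 1"
  have \<eta>: "0 < \<eta>" "\<eta> \<le> 1" using d by (auto simp: \<eta>_def)
  have \<eta>d: "\<bar>p * \<xi> powr (p - 1) - p\<bar> < \<nu> / 2" if "\<bar>\<xi> - 1\<bar> < \<eta>" for \<xi>
    using d(2)[of \<xi>] that \<nu>(1) by (cases "\<xi> = 1") (auto simp: dist_real_def \<eta>_def)
  have "0 < \<nu> / 2 / m\<^sup>2" using \<nu>(1) m_pos by simp
  then obtain M where M: "0 \<le> M" "\<And>t. t \<le> - M \<Longrightarrow> exp (2 * m * t) < \<nu> / 2 / m\<^sup>2"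
    using exp_small_left by blast
  \<comment> \<open>\<open>C1\<close> and \<open>C2\<close> are the constants of equivalence between
    \<open>V\<close> below and \<open>d^2 + e^2\<close>.\<close>
  define C1 where "C1 = 2 / (p - 1) + 4"
  define C2 where "C2 = 3 / 4 + \<alpha>\<^sup>2 / 2 + (p - 1) / 2"
  have C: "0 < C1" "0 < C2" using p_gt_1 alpha_pos by (auto simp: C1_def C2_def intro!: add_pos_nonneg)
  show ?thesis
  proof (rule that[of \<eta> "C1 * C2" M])
    fix y1 z1 y2 z2 a b
    assume em: "emden y1 z1" "emden y2 z2" and ab: "a \<le> b" and bM: "b \<le> - M"
      and n1: "\<And>t. a \<le> t \<Longrightarrow> t \<le> b \<Longrightarrow> \<bar>y1 t - 1\<bar> < \<eta>" and n2: "\<And>t. a \<le> t \<Longrightarrow> t \<le> b \<Longrightarrow> \<bar>y2 t - 1\<bar> < \<eta>"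
    define d where "d t = y1 t - y2 t" for t
    define e where "e t = z1 t - z2 t" for t
    \<comment> \<open>the energy of the linearised equation plus a cross term that makes the dissipation definite in \<open>d\<close> as well\<close>
    define V where "V t = (e t)\<^sup>2 / 4 + (e t + \<alpha> * d t)\<^sup>2 / 4 + (p - 1) * (d t)\<^sup>2 / 2" for t
    have "V b \<le> V a"
    proof (rule DERIV_nonpos_imp_nonincreasing[OF ab])
      fix t assume t: "a \<le> t" "t \<le> b"
      obtain \<xi> where \<xi>: "\<bar>\<xi> - 1\<bar> < \<eta>" "y1 t powr p - y2 t powr p = p * \<xi> powr (p - 1) * d t"
        using powr_mean_value[OF n1[OF t] n2[OF t] \<eta>(2)] unfolding d_def by blast
      \<comment> \<open>\<open>r\<close> collects the deviation of the slope at \<open>\<xi>\<close>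
        from \<open>p\<close> and the nonautonomous term, each at most \<open>\<nu> / 2\<close> in
        size.\<close>
      define r where "r = p * \<xi> powr (p - 1) - p - m\<^sup>2 * exp (2 * m * t)"
      have mE: "m\<^sup>2 * exp (2 * m * t) < \<nu> / 2" using M(2)[of t] t bM m_pos by (simp add: field_simps)
      have mE0: "0 \<le> m\<^sup>2 * exp (2 * m * t)" by simp
      have r: "\<bar>r\<bar> \<le> \<nu>" using \<eta>d[OF \<xi>(1)] mE mE0 unfolding r_def by linarith
      have de: "(d has_real_derivative e t) (at t)"
        unfolding d_def e_def by (intro DERIV_diff emdenD(2) em)
      have ee: "(e has_real_derivative - \<alpha> * e t - (p - 1 + r) * d t) (at t)"
      proof -
        have "(e has_real_derivative rhs t (y1 t) (z1 t) - rhs t (y2 t) (z2 t)) (at t)"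
          unfolding e_def by (intro DERIV_diff emdenD(3) em)
        moreover have "rhs t (y1 t) (z1 t) - rhs t (y2 t) (z2 t)
          = - \<alpha> * e t + d t - (y1 t powr p - y2 t powr p) + m\<^sup>2 * exp (2 * m * t) * d t"
          unfolding rhs_def d_def e_def by (simp add: right_diff_distrib)
        moreover have "\<dots> = - \<alpha> * e t - (p - 1 + r) * d t" unfolding \<xi>(2) r_def by (simp add: algebra_simps)
        ultimately show ?thesis by (simp only:)
      qed
      have "(V has_real_derivative e t * (- \<alpha> * e t - (p - 1 + r) * d t) / 2
          + (e t + \<alpha> * d t) * ((- \<alpha> * e t - (p - 1 + r) * d t) + \<alpha> * e t) / 2 + (p - 1) * d t * e t) (at t)"
        unfolding V_def by (auto intro!: derivative_eq_intros de ee simp: power2_eq_square field_simps)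
      \<comment> \<open>The weights in \<open>V\<close> make the mixed terms in \<open>P\<close>
        cancel, so that only the error \<open>R * X * Y\<close> is of indefinite sign.\<close>
      moreover have "X * (- al * X - (P + R) * Y) / 2 + (X + al * Y) * ((- al * X - (P + R) * Y) + al * X) / 2 + P * Y * X
        = - (al / 2) * X\<^sup>2 - (al / 2) * (P + R) * Y\<^sup>2 - R * X * Y" for X Y al P R :: real
        by (simp add: field_simps power2_eq_square)
      ultimately have V': "(V has_real_derivative
        - (\<alpha> / 2) * (e t)\<^sup>2 - (\<alpha> / 2) * (p - 1 + r) * (d t)\<^sup>2 - r * e t * d t) (at t)" by simp
      have "\<bar>r * e t * d t\<bar> \<le> \<nu> * (\<bar>e t\<bar> * \<bar>d t\<bar>)"
        unfolding abs_mult mult.assoc using r by (intro mult_right_mono) auto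
      also have "\<dots> \<le> \<nu> * (((e t)\<^sup>2 + (d t)\<^sup>2) / 2)"
        using \<nu>(1) sum_squares_bound[of "\<bar>e t\<bar>" "\<bar>d t\<bar>"] by (intro mult_left_mono) auto
      also have "\<dots> = \<nu> / 2 * (e t)\<^sup>2 + \<nu> / 2 * (d t)\<^sup>2" by (simp add: field_simps)
      finally have 1: "\<bar>r * e t * d t\<bar> \<le> \<nu> / 2 * (e t)\<^sup>2 + \<nu> / 2 * (d t)\<^sup>2" .
      have 2: "\<nu> / 2 * (e t)\<^sup>2 \<le> \<alpha> / 2 * (e t)\<^sup>2" using \<nu>(2) by (intro mult_right_mono) auto
      have "(p - 1) / 2 \<le> p - 1 + r" using abs_le_D2[OF r] \<nu>(3) by (simp add: field_simps)
      then have "\<alpha> / 2 * ((p - 1) / 2) \<le> \<alpha> / 2 * (p - 1 + r)" using alpha_pos by (intro mult_left_mono) auto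
      then have "\<nu> / 2 \<le> \<alpha> / 2 * (p - 1 + r)" using \<nu>(4) by (simp add: field_simps)
      then have 3: "\<nu> / 2 * (d t)\<^sup>2 \<le> \<alpha> / 2 * (p - 1 + r) * (d t)\<^sup>2" by (rule mult_right_mono) simp
      have "- (\<alpha> / 2) * (e t)\<^sup>2 - (\<alpha> / 2) * (p - 1 + r) * (d t)\<^sup>2 - r * e t * d t \<le> 0"
        using 1 2 3 by linarith
      then show "\<exists>l. (V has_real_derivative l) (at t) \<and> l \<le> 0" using V' by blast
    qed
    moreover have "(d b)\<^sup>2 + (e b)\<^sup>2 \<le> C1 * V b"
    proof -
      have "(p - 1) * (d b)\<^sup>2 / 2 \<le> V b" "(e b)\<^sup>2 / 4 \<le> V b" using p_gt_1 by (auto simp: V_def)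
      then have "(d b)\<^sup>2 \<le> 2 / (p - 1) * V b" "(e b)\<^sup>2 \<le> 4 * V b" using p_gt_1 by (auto simp: field_simps)
      then show ?thesis unfolding C1_def distrib_right by linarith
    qed
    moreover have "V a \<le> C2 * ((d a)\<^sup>2 + (e a)\<^sup>2)"
    proof -
      have "(e a + \<alpha> * d a)\<^sup>2 \<le> 2 * (e a)\<^sup>2 + 2 * (\<alpha> * d a)\<^sup>2"
        using sum_squares_bound[of "e a" "\<alpha> * d a"] by (simp add: power2_sum)
      then have "V a \<le> 3 / 4 * (e a)\<^sup>2 + \<alpha>\<^sup>2 / 2 * (d a)\<^sup>2 + (p - 1) / 2 * (d a)\<^sup>2"
        by (simp add: V_def power_mult_distrib)
      also have "\<dots> \<le> C2 * (d a)\<^sup>2 + C2 * (e a)\<^sup>2"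
      proof -
        have "(\<alpha>\<^sup>2 / 2 + (p - 1) / 2) * (d a)\<^sup>2 \<le> C2 * (d a)\<^sup>2" by (rule mult_right_mono) (auto simp: C2_def)
        moreover have "3 / 4 * (e a)\<^sup>2 \<le> C2 * (e a)\<^sup>2" by (rule mult_right_mono) (use p_gt_1 in \<open>auto simp: C2_def\<close>)
        ultimately show ?thesis unfolding distrib_right by linarith
      qed
      finally show ?thesis by (simp add: distrib_left)
    qed
    ultimately have "(d b)\<^sup>2 + (e b)\<^sup>2 \<le> C1 * (C2 * ((d a)\<^sup>2 + (e a)\<^sup>2))"
      using mult_left_mono[of "V b" "C2 * ((d a)\<^sup>2 + (e a)\<^sup>2)" C1] C(1) by linarith
    then show "(y1 b - y2 b)\<^sup>2 + (z1 b - z2 b)\<^sup>2 \<le> C1 * C2 * ((y1 a - y2 a)\<^sup>2 + (z1 a - z2 a)\<^sup>2)"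
      by (simp add: d_def e_def mult.assoc)
  qed (use \<eta> C M in auto)
qed

text \<open>Transport across a fixed window, where the equilibrium is no longer nearby; the growth
  factor depends on the window alone.\<close>

lemma orbits_gronwall:
  obtains K where "1 \<le> K"
    "\<And>y1 z1 y2 z2 t. orbit y1 z1 \<Longrightarrow> orbit y2 z2 \<Longrightarrow> a \<le> t \<Longrightarrow> t \<le> b \<Longrightarrow>
      (y1 t - y2 t)\<^sup>2 + (z1 t - z2 t)\<^sup>2 \<le> K * ((y1 a - y2 a)\<^sup>2 + (z1 a - z2 a)\<^sup>2)"
proof -
  obtain B where B: "1 \<le> B" "\<And>y z t. orbit y z \<Longrightarrow> t \<le> b \<Longrightarrow> y t \<le> B"
    using orbit_bounded[of b] by metis
  define C where "C = 1 + p * B powr (p - 1) + m\<^sup>2 * exp (2 * m * b)"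
  have C: "0 \<le> C" using p_gt_1 by (auto simp: C_def intro!: add_nonneg_nonneg)
  define K where "K = exp ((1 + C) * \<bar>b - a\<bar>)"
  show ?thesis
  proof (rule that[of K])
    show "1 \<le> K" using C by (simp add: K_def)
    fix y1 z1 y2 z2 t
    assume o: "orbit y1 z1" "orbit y2 z2" and t: "a \<le> t" "t \<le> b"
    note em = o[THEN orbitD(1)]
    define q where "q s = (y1 s - y2 s) - (y1 s powr p - y2 s powr p) + m\<^sup>2 * exp (2 * m * s) * (y1 s - y2 s)" for s
    have "(y1 t - y2 t)\<^sup>2 + (z1 t - z2 t)\<^sup>2 \<le> ((y1 a - y2 a)\<^sup>2 + (z1 a - z2 a)\<^sup>2) * exp ((1 + C) * (t - a))"
    proof (rule gronwall_damped[where k = "\<lambda>_. \<alpha>" and q = q, OF t(1) C])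
      show "((\<lambda>s. y1 s - y2 s) has_real_derivative z1 s - z2 s) (at s)" for s
        by (intro DERIV_diff emdenD(2) em)
      show "((\<lambda>s. z1 s - z2 s) has_real_derivative - \<alpha> * (z1 s - z2 s) + q s) (at s)" for s
        by (rule DERIV_cong[OF DERIV_diff[OF emdenD(3)[OF em(1)] emdenD(3)[OF em(2)]]])
           (simp add: rhs_def q_def algebra_simps)
      show "\<bar>q s\<bar> \<le> C * \<bar>y1 s - y2 s\<bar>" if "s \<in> {a..t}" for s
      proof -
        have "\<bar>y1 s powr p - y2 s powr p\<bar> \<le> p * B powr (p - 1) * \<bar>y1 s - y2 s\<bar>"
          using that t B(2)[OF o(1), of s] B(2)[OF o(2), of s] emdenD(1)[OF em(1), of s] emdenD(1)[OF em(2), of s]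
          by (intro powr_diff_le p_gt_1) auto
        moreover have "\<bar>m\<^sup>2 * exp (2 * m * s) * (y1 s - y2 s)\<bar> \<le> m\<^sup>2 * exp (2 * m * b) * \<bar>y1 s - y2 s\<bar>"
          using that t m_pos by (auto simp: abs_mult intro!: mult_right_mono mult_left_mono)
        moreover have "\<bar>u - v + w\<bar> \<le> 1 * \<bar>u\<bar> + \<bar>v\<bar> + \<bar>w\<bar>" for u v w :: real by linarith
        ultimately show ?thesis unfolding q_def C_def distrib_right by (meson add_mono order.refl order.trans)
      qed
    qed (use alpha_pos in auto)
    also have "\<dots> \<le> ((y1 a - y2 a)\<^sup>2 + (z1 a - z2 a)\<^sup>2) * K"
      unfolding K_def using t C by (intro mult_left_mono) (auto intro!: mult_left_mono)
    finally show "(y1 t - y2 t)\<^sup>2 + (z1 t - z2 t)\<^sup>2 \<le> K * ((y1 a - y2 a)\<^sup>2 + (z1 a - z2 a)\<^sup>2)"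
      by (simp add: mult.commute)
  qed
qed

end

section \<open>The singular solution\<close>

lemma DERIV_uniform_limit:
  fixes f :: "nat \<Rightarrow> real \<Rightarrow> real"
  assumes f: "\<And>n t. (f n has_real_derivative f' n t) (at t)"
    and lim: "\<And>t. (\<lambda>n. f n t) \<longlonglongrightarrow> g t"
    and unif: "\<And>a b e. 0 < e \<Longrightarrow> \<forall>\<^sub>F n in sequentially. \<forall>t\<in>{a..b}. \<bar>f' n t - g' t\<bar> \<le> e"
  shows "(g has_real_derivative g' t) (at t)"
proof -
  define S where "S = {t - 1<..<t + 1}"
  have "\<exists>h. \<forall>x\<in>S. (\<lambda>n. f n x) \<longlonglongrightarrow> h x \<and> (h has_derivative (\<lambda>u. u * g' x)) (at x within S)"
  proof (rule has_derivative_sequence[where f' = "\<lambda>n x u. u * f' n x" and ?x0.0 = t and l = "g t"])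
    show "(f n has_derivative (\<lambda>u. u * f' n x)) (at x within S)" for n x
    proof (rule has_derivative_at_withinI)
      show "(f n has_derivative (\<lambda>u. u * f' n x)) (at x)"
        using f[of n x] unfolding has_field_derivative_def by (simp add: mult_commute_abs)
    qed
    show "\<forall>\<^sub>F n in sequentially. \<forall>x\<in>S. \<forall>u. norm (u * f' n x - u * g' x) \<le> e * norm u" if "0 < e" for e
      using unif[OF that, of "t - 1" "t + 1"]
    proof eventually_elim
      case (elim n)
      show ?case
      proof (intro ballI allI)
        fix x u assume "x \<in> S"
        then have "\<bar>f' n x - g' x\<bar> \<le> e" using elim by (auto simp: S_def)
        then have "\<bar>u\<bar> * \<bar>f' n x - g' x\<bar> \<le> \<bar>u\<bar> * e" by (intro mult_left_mono) auto
        then show "norm (u * f' n x - u * g' x) \<le> e * norm u"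
          by (simp add: abs_mult mult.commute flip: right_diff_distrib)
      qed
    qed
  qed (auto simp: S_def lim)
  then obtain h where h: "\<And>x. x \<in> S \<Longrightarrow> (\<lambda>n. f n x) \<longlonglongrightarrow> h x"
    "\<And>x. x \<in> S \<Longrightarrow> (h has_derivative (\<lambda>u. u * g' x)) (at x within S)" by blast
  have tS: "t \<in> S" "open S" by (auto simp: S_def)
  have "(h has_real_derivative g' t) (at t)"
    unfolding has_field_derivative_def using h(2)[OF tS(1)] unfolding at_within_open[OF tS]
    by (simp add: mult_commute_abs)
  then show ?thesis
    by (rule has_field_derivative_transform_within_open[OF _ tS(2,1)]) (use h(1) lim LIMSEQ_unique in blast)
qed

context supercritical begin

text \<open>Both orbits settle near \<open>(1, 0)\<close>, the contraction estimate carries their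
  tiny distance to \<open>t0\<close> at a cost independent of the elapsed time, and Gronwall carries
  it across the remaining window. As \<open>S\<close> is the same for all orbits, this yields the
  Cauchy property, convergence and uniqueness alike.\<close>

lemma orbits_close:
  assumes "0 < c" "0 < \<epsilon>"
  obtains S where "\<And>y1 z1 y2 z2 s t. orbit y1 z1 \<Longrightarrow> orbit y2 z2 \<Longrightarrow> energy y1 z1 s \<le> - c \<Longrightarrow>
    energy y2 z2 s \<le> - c \<Longrightarrow> s \<le> S \<Longrightarrow> a \<le> t \<Longrightarrow> t \<le> b \<Longrightarrow> \<bar>y1 t - y2 t\<bar> < \<epsilon> \<and> \<bar>z1 t - z2 t\<bar> < \<epsilon>"
proof -
  obtain \<eta> C M where \<eta>: "0 < \<eta>" and C: "0 \<le> C" and con: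
    "\<And>y1 z1 y2 z2 a b. emden y1 z1 \<Longrightarrow> emden y2 z2 \<Longrightarrow> a \<le> b \<Longrightarrow> b \<le> - M \<Longrightarrow>
      (\<And>t. a \<le> t \<Longrightarrow> t \<le> b \<Longrightarrow> \<bar>y1 t - 1\<bar> < \<eta>) \<Longrightarrow> (\<And>t. a \<le> t \<Longrightarrow> t \<le> b \<Longrightarrow> \<bar>y2 t - 1\<bar> < \<eta>) \<Longrightarrow>
      (y1 b - y2 b)\<^sup>2 + (z1 b - z2 b)\<^sup>2 \<le> C * ((y1 a - y2 a)\<^sup>2 + (z1 a - z2 a)\<^sup>2)"
    using contraction_near_1 by metis
  obtain L1 M1 where s1: "0 \<le> L1" "\<And>y z s t. orbit y z \<Longrightarrow> energy y z s \<le> - c \<Longrightarrow> s + L1 \<le> t \<Longrightarrow> t \<le> - M1 \<Longrightarrow> \<bar>y t - 1\<bar> < \<eta> \<and> \<bar>z t\<bar> < \<eta>"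
    using settling[OF assms(1) \<eta>] by metis
  define t0 where "t0 = min a (min (- M) (- M1))"
  have t0: "t0 \<le> a" "t0 \<le> - M" "t0 \<le> - M1" by (auto simp: t0_def)
  obtain K where K: "1 \<le> K" "\<And>y1 z1 y2 z2 t. orbit y1 z1 \<Longrightarrow> orbit y2 z2 \<Longrightarrow> t0 \<le> t \<Longrightarrow> t \<le> b \<Longrightarrow>
      (y1 t - y2 t)\<^sup>2 + (z1 t - z2 t)\<^sup>2 \<le> K * ((y1 t0 - y2 t0)\<^sup>2 + (z1 t0 - z2 t0)\<^sup>2)"
    using orbits_gronwall by metis
  \<comment> \<open>Distances of at most \<open>2 * \<eta>'\<close> in both coordinates sum to
    \<open>8 * \<eta>'\<^sup>2\<close>, which is amplified by \<open>C\<close> and \<open>K\<close>;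
    \<open>C + 1\<close> keeps the denominator positive and the resulting bound strict.\<close>
  define \<eta>' where "\<eta>' = \<epsilon> / sqrt (8 * K * (C + 1))"
  have KC: "0 < 8 * K * (C + 1)" using K(1) C by simp
  then have \<eta>': "0 < \<eta>'" using assms(2) by (simp add: \<eta>'_def)
  have \<eta>'2: "K * (C * (8 * \<eta>'\<^sup>2)) < \<epsilon>\<^sup>2"
  proof -
    have "\<eta>'\<^sup>2 = \<epsilon>\<^sup>2 / (8 * K * (C + 1))" using KC by (simp add: \<eta>'_def power_divide)
    then have "8 * K * (C + 1) * \<eta>'\<^sup>2 = \<epsilon>\<^sup>2" using KC by (metis less_irrefl nonzero_mult_div_cancel_left times_divide_eq_right)
    moreover have "8 * K * C * \<eta>'\<^sup>2 < 8 * K * (C + 1) * \<eta>'\<^sup>2" using K(1) \<eta>' by (simp add: algebra_simps)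
    ultimately show ?thesis by (simp add: algebra_simps)
  qed
  obtain L2 M2 where s2: "0 \<le> L2" "\<And>y z s t. orbit y z \<Longrightarrow> energy y z s \<le> - c \<Longrightarrow> s + L2 \<le> t \<Longrightarrow> t \<le> - M2 \<Longrightarrow> \<bar>y t - 1\<bar> < \<eta>' \<and> \<bar>z t\<bar> < \<eta>'"
    using settling[OF assms(1) \<eta>'] by metis
  show ?thesis
  proof (rule that[of "min t0 (- M2) - max L1 L2"])
    fix y1 z1 y2 z2 s t
    assume o: "orbit y1 z1" "orbit y2 z2" and e: "energy y1 z1 s \<le> - c" "energy y2 z2 s \<le> - c"
      and s: "s \<le> min t0 (- M2) - max L1 L2" and t: "a \<le> t" "t \<le> b"
    \<comment> \<open>From this time up to \<open>t0\<close> both orbits are within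
      \<open>\<eta>\<close> of the equilibrium, and at \<open>r\<close> itself they are within
      \<open>\<eta>'\<close>.\<close>
    define r where "r = s + max L1 L2"
    have r: "r \<le> t0" "r \<le> - M2" "s + L1 \<le> r" "s + L2 \<le> r" using s by (auto simp: r_def)
    have n1: "\<bar>y1 x - 1\<bar> < \<eta>" and n2: "\<bar>y2 x - 1\<bar> < \<eta>" if "r \<le> x" "x \<le> t0" for x
      using s1(2)[OF o(1) e(1), of x] s1(2)[OF o(2) e(2), of x] that r t0 by auto
    have "\<bar>y1 r - 1\<bar> < \<eta>' \<and> \<bar>z1 r\<bar> < \<eta>'" "\<bar>y2 r - 1\<bar> < \<eta>' \<and> \<bar>z2 r\<bar> < \<eta>'"
      using s2(2)[OF o(1) e(1) r(4) r(2)] s2(2)[OF o(2) e(2) r(4) r(2)] .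
    then have "\<bar>y1 r - y2 r\<bar> \<le> 2 * \<eta>'" "\<bar>z1 r - z2 r\<bar> \<le> 2 * \<eta>'" by linarith+
    then have "(y1 r - y2 r)\<^sup>2 \<le> (2 * \<eta>')\<^sup>2" "(z1 r - z2 r)\<^sup>2 \<le> (2 * \<eta>')\<^sup>2"
      using \<eta>' by (subst power2_le_iff_abs_le; simp)+
    then have d: "(y1 r - y2 r)\<^sup>2 + (z1 r - z2 r)\<^sup>2 \<le> 8 * \<eta>'\<^sup>2" by (simp add: power_mult_distrib)
    have "(y1 t0 - y2 t0)\<^sup>2 + (z1 t0 - z2 t0)\<^sup>2 \<le> C * ((y1 r - y2 r)\<^sup>2 + (z1 r - z2 r)\<^sup>2)"
      using n1 n2 by (intro con o[THEN orbitD(1)] r t0)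
    also have "\<dots> \<le> C * (8 * \<eta>'\<^sup>2)" using d C by (rule mult_left_mono)
    finally have "K * ((y1 t0 - y2 t0)\<^sup>2 + (z1 t0 - z2 t0)\<^sup>2) \<le> K * (C * (8 * \<eta>'\<^sup>2))"
      using K(1) by (intro mult_left_mono) auto
    then have fin: "(y1 t - y2 t)\<^sup>2 + (z1 t - z2 t)\<^sup>2 < \<epsilon>\<^sup>2"
      using K(2)[OF o, of t] t t0(1) \<eta>'2 by linarith
    have "\<bar>u\<bar> < \<epsilon>" if "u\<^sup>2 < \<epsilon>\<^sup>2" for u
      using that assms(2) power2_less_imp_less[of "\<bar>u\<bar>" \<epsilon>] by simp
    then show "\<bar>y1 t - y2 t\<bar> < \<epsilon> \<and> \<bar>z1 t - z2 t\<bar> < \<epsilon>"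
      using fin zero_le_power2[of "y1 t - y2 t"] zero_le_power2[of "z1 t - z2 t"]
      by (meson add_le_cancel_right le_add_same_cancel1 le_add_same_cancel2 le_less_trans)
  qed
qed

lemma rhs_lipschitz:
  obtains C where "0 < C" "\<And>t y1 y2 z1 z2. t \<le> b \<Longrightarrow> 0 \<le> y1 \<Longrightarrow> y1 \<le> B \<Longrightarrow> 0 \<le> y2 \<Longrightarrow> y2 \<le> B \<Longrightarrow>
    \<bar>rhs t y1 z1 - rhs t y2 z2\<bar> \<le> C * (\<bar>y1 - y2\<bar> + \<bar>z1 - z2\<bar>)"
proof -
  define C where "C = \<alpha> + (1 + p * B powr (p - 1) + m\<^sup>2 * exp (2 * m * b))"
  have nn: "0 \<le> p * B powr (p - 1)" "0 \<le> m\<^sup>2 * exp (2 * m * b)" using p_gt_1 by auto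
  show ?thesis
  proof (rule that[of C])
    show "0 < C" using nn alpha_pos unfolding C_def by linarith
    fix t y1 y2 z1 z2 :: real assume t: "t \<le> b" and y: "0 \<le> y1" "y1 \<le> B" "0 \<le> y2" "y2 \<le> B"
    have "\<bar>y1 powr p - y2 powr p\<bar> \<le> p * B powr (p - 1) * \<bar>y1 - y2\<bar>"
      using y by (intro powr_diff_le p_gt_1)
    moreover have "\<bar>m\<^sup>2 * exp (2 * m * t) * (y1 - y2)\<bar> \<le> m\<^sup>2 * exp (2 * m * b) * \<bar>y1 - y2\<bar>"
      using t m_pos by (auto simp: abs_mult intro!: mult_right_mono mult_left_mono)
    moreover have "\<bar>\<alpha> * (z1 - z2)\<bar> \<le> \<alpha> * \<bar>z1 - z2\<bar>" using alpha_pos by (simp add: abs_mult)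
    moreover have "rhs t y1 z1 - rhs t y2 z2
       = (y1 - y2) - (y1 powr p - y2 powr p) + m\<^sup>2 * exp (2 * m * t) * (y1 - y2) - \<alpha> * (z1 - z2)"
      by (simp add: rhs_def right_diff_distrib)
    moreover have "\<bar>u - v + w - x\<bar> \<le> x' + (1 * \<bar>u\<bar> + v' + w')"
      if "\<bar>v\<bar> \<le> v'" "\<bar>w\<bar> \<le> w'" "\<bar>x\<bar> \<le> x'" for u v w x v' w' x' :: real using that by linarith
    ultimately have "\<bar>rhs t y1 z1 - rhs t y2 z2\<bar> \<le> \<alpha> * \<bar>z1 - z2\<bar>
       + (1 * \<bar>y1 - y2\<bar> + p * B powr (p - 1) * \<bar>y1 - y2\<bar> + m\<^sup>2 * exp (2 * m * b) * \<bar>y1 - y2\<bar>)"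
      by (simp only:)
    also have "\<dots> = \<alpha> * \<bar>z1 - z2\<bar> + (C - \<alpha>) * \<bar>y1 - y2\<bar>" by (simp add: C_def algebra_simps)
    also have "\<dots> \<le> C * \<bar>z1 - z2\<bar> + C * \<bar>y1 - y2\<bar>"
      using nn alpha_pos by (intro add_mono mult_right_mono) (auto simp: C_def)
    finally show "\<bar>rhs t y1 z1 - rhs t y2 z2\<bar> \<le> C * (\<bar>y1 - y2\<bar> + \<bar>z1 - z2\<bar>)" by (simp add: algebra_simps)
  qed
qed

section \<open>Energy, uniqueness, critical points and existence of the singular solution\<close>

definition star :: "(real \<Rightarrow> real) \<Rightarrow> (real \<Rightarrow> real) \<Rightarrow> bool" where
  "star y z \<longleftrightarrow> emden y z \<and> (y \<longlongrightarrow> 1) at_bot"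

lemma well_1_neg: "well 1 < 0" using p_gt_1 by (simp add: well_def field_simps)

text \<open>Only \<open>y\<close> is known to converge at minus infinity. The mean value theorem on
  a unit interval arbitrarily far to the left supplies a time where \<open>z\<close> is small as
  well; there the energy is at most half of \<open>well 1\<close>, and afterwards it
  decreases.\<close>

lemma star_energy:
  assumes "star y z"
  shows "energy y z t \<le> well 1 / 2"
proof -
  define w where "w = - well 1"
  have w: "0 < w" using well_1_neg by (simp add: w_def)
  \<comment> \<open>With \<open>\<bar>z\<bar> \<le> 2 * e\<close> the kinetic part is at most
    \<open>w / 4\<close>; added to a well value below \<open>- 3 * w / 4\<close> this leaves
    \<open>- w / 2\<close>.\<close>
  define e where "e = sqrt (w / 8)"
  have e: "0 < e" "e\<^sup>2 = w / 8" using w by (auto simp: e_def)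
  have em: "emden y z" and lim: "(y \<longlongrightarrow> 1) at_bot" using assms by (auto simp: star_def)
  have "((\<lambda>s. well (y s)) \<longlongrightarrow> well 1) at_bot"
    using isCont_tendsto_compose[OF DERIV_isCont[OF well_deriv[of 1]] lim] by simp
  then have 1: "\<forall>\<^sub>F s in at_bot. well (y s) < well 1 * 3 / 4"
    using well_1_neg by (intro order_tendstoD(2)) auto
  have 2: "\<forall>\<^sub>F s in at_bot. \<bar>y s - 1\<bar> < e" using tendstoD[OF lim e(1)] by (simp add: dist_real_def)
  obtain K where K: "\<And>s. s \<le> K \<Longrightarrow> well (y s) < well 1 * 3 / 4 \<and> \<bar>y s - 1\<bar> < e"
    using eventually_conj[OF 1 2] by (auto simp: eventually_at_bot_linorder)
  define s where "s = min K t - 1"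
  have "\<exists>\<xi>>s. \<xi> < s + 1 \<and> y (s + 1) - y s = (s + 1 - s) * z \<xi>"
    by (rule MVT2) (auto intro: emdenD(2)[OF em])
  then obtain \<xi> where \<xi>: "s < \<xi>" "\<xi> < s + 1" "y (s + 1) - y s = z \<xi>" by auto
  have "s \<le> K" "s + 1 \<le> K" by (auto simp: s_def)
  then have "\<bar>z \<xi>\<bar> \<le> 2 * e" using K[of s] K[of "s + 1"] \<xi>(3) by linarith
  then have "(z \<xi>)\<^sup>2 \<le> (2 * e)\<^sup>2" using e(1) by (subst power2_le_iff_abs_le) auto
  then have "(z \<xi>)\<^sup>2 \<le> w / 2" using e(2) by (simp add: power_mult_distrib)
  moreover have "well (y \<xi>) < well 1 * 3 / 4" using K[of \<xi>] \<xi> by (auto simp: s_def)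
  moreover have "0 \<le> (y \<xi>)\<^sup>2 * (m\<^sup>2 * exp (2 * m * \<xi>))" by simp
  ultimately have "energy y z \<xi> \<le> well 1 / 2" unfolding energy_well w_def by linarith
  moreover have "\<xi> \<le> t" using \<xi> by (auto simp: s_def)
  ultimately show ?thesis using energy_antimono[OF em] order.trans by blast
qed

lemma star_orbit: "star y z \<Longrightarrow> orbit y z"
proof -
  assume "star y z"
  then have "energy y z t \<le> 0" for t using star_energy[of y z t] well_1_neg by linarith
  then show ?thesis using \<open>star y z\<close> by (simp add: orbit_def star_def)
qed

lemma converges_to_star:
  assumes st: "star y z" and c: "0 < c" and \<epsilon>: "0 < \<epsilon>"
    and o: "\<forall>\<^sub>F k in F. orbit (Y k) (Z k)" and e: "\<And>s. \<forall>\<^sub>F k in F. energy (Y k) (Z k) s \<le> - c"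
  shows "\<forall>\<^sub>F k in F. \<forall>t\<in>{a..b}. \<bar>Y k t - y t\<bar> < \<epsilon> \<and> \<bar>Z k t - z t\<bar> < \<epsilon>"
proof -
  define c' where "c' = min c (- well 1 / 2)"
  have c': "0 < c'" "c' \<le> c" "c' \<le> - well 1 / 2" using c well_1_neg by (auto simp: c'_def)
  obtain S where S: "\<And>y1 z1 y2 z2 s t. orbit y1 z1 \<Longrightarrow> orbit y2 z2 \<Longrightarrow> energy y1 z1 s \<le> - c' \<Longrightarrow>
    energy y2 z2 s \<le> - c' \<Longrightarrow> s \<le> S \<Longrightarrow> a \<le> t \<Longrightarrow> t \<le> b \<Longrightarrow> \<bar>y1 t - y2 t\<bar> < \<epsilon> \<and> \<bar>z1 t - z2 t\<bar> < \<epsilon>"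
    using orbits_close[OF c'(1) \<epsilon>] by metis
  show ?thesis using o e[of S]
  proof eventually_elim
    case (elim k)
    show ?case
    proof
      fix t assume "t \<in> {a..b}"
      then show "\<bar>Y k t - y t\<bar> < \<epsilon> \<and> \<bar>Z k t - z t\<bar> < \<epsilon>"
        using elim c' star_energy[OF st, of S] by (intro S[OF elim(1) star_orbit[OF st], of S]) auto
    qed
  qed
qed

text \<open>The constant family \<open>y1\<close> satisfies the hypotheses of
  \<open>converges_to_star\<close>, so it converges to \<open>y2\<close>.\<close>

lemma star_unique:
  assumes "star y1 z1" "star y2 z2"
  shows "y1 = y2"
proof
  fix t
  have "\<bar>y1 t - y2 t\<bar> < \<epsilon>" if "0 < \<epsilon>" for \<epsilon>
    using converges_to_star[where F = sequentially and Y = "\<lambda>_. y1" and Z = "\<lambda>_. z1" and a = t and b = t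
        and c = "- well 1 / 2", OF assms(2) _ that]
      star_orbit[OF assms(1)] star_energy[OF assms(1)] well_1_neg
    by auto
  from this[of "\<bar>y1 t - y2 t\<bar>"] show "y1 t = y2 t" by auto
qed

lemma ystar_eq:
  assumes "star y z"
  shows "ystar N p = y"
  unfolding ystar_def
proof (rule the_equality)
  have em: "emden y z" and lim: "(y \<longlongrightarrow> 1) at_bot" using assms by (auto simp: star_def)
  show "(\<forall>t. 0 < y t) \<and> (y \<longlongrightarrow> 1) at_bot \<and> (\<exists>y'. \<forall>t. (y has_real_derivative y' t) (at t) \<and>
    (y' has_real_derivative - \<alpha> * y' t + y t - y t powr p + m\<^sup>2 * exp (2 * m * t) * y t) (at t))"
    using em lim unfolding emden_def rhs_def by blast
next
  fix x assume x: "(\<forall>t. 0 < x t) \<and> (x \<longlongrightarrow> 1) at_bot \<and> (\<exists>y'. \<forall>t. (x has_real_derivative y' t) (at t) \<and>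
    (y' has_real_derivative - \<alpha> * y' t + x t - x t powr p + m\<^sup>2 * exp (2 * m * t) * x t) (at t))"
  then obtain z' where "star x z'" unfolding star_def emden_def rhs_def by blast
  then show "x = y" using star_unique assms by blast
qed

text \<open>At a double zero both \<open>u'\<close> and \<open>u''\<close> vanish, hence
  \<open>f(u) = 0\<close> and \<open>u = 1\<close> there, and uniqueness forces \<open>u = 1\<close>
  all the way to the left. In Emden variables that solution tends to 0 at minus infinity, whereas
  \<open>y\<close> tends to 1.\<close>

lemma star_simple_zero:
  assumes st: "star y z" and z: "z t = m * \<theta> * y t"
  shows "rhs t (y t) (z t) \<noteq> m * \<theta> * z t"
proof
  assume r: "rhs t (y t) (z t) = m * \<theta> * z t"
  have em: "emden y z" and lim: "(y \<longlongrightarrow> 1) at_bot" using st by (auto simp: star_def)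
  \<comment> \<open>the constant solution \<open>u = 1\<close> in Emden variables\<close>
  define x where "x s = exp (m * \<theta> * s) / A" for s
  have x0: "0 < x s" for s using A_pos by (simp add: x_def)
  have xp: "x s powr p = m\<^sup>2 * exp (2 * m * s) * x s" for s
  proof -
    have "x s powr p = exp (p * (m * \<theta> * s)) / A powr p"
      using A_pos by (simp add: x_def powr_divide powr_def[of "exp _"])
    also have "p * (m * \<theta> * s) = m * s * (\<theta> * p)" by simp
    also have "\<dots> = m * \<theta> * s + 2 * m * s" unfolding theta_p by (simp add: algebra_simps)
    also have "A powr p = A / m\<^sup>2" using A_powr_p m_pos by (simp add: field_simps)
    finally show ?thesis by (simp add: x_def exp_add)
  qed
  have dx: "(x has_real_derivative m * \<theta> * x s) (at s)" for s
    unfolding x_def using A_pos by (auto intro!: derivative_eq_intros)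
  have rx: "rhs s (x s) (m * \<theta> * x s) = m * \<theta> * (m * \<theta> * x s)" for s
  proof -
    have "rhs s (x s) (m * \<theta> * x s) = (1 - \<alpha> * (m * \<theta>)) * x s" unfolding rhs_def xp by (simp add: algebra_simps)
    also have "1 - \<alpha> * (m * \<theta>) = m\<^sup>2 * \<theta>\<^sup>2" using alpha_theta by simp
    finally show ?thesis by (simp add: power2_eq_square)
  qed
  \<comment> \<open>By \<open>alpha_theta\<close> the linear terms cancel; what is left is
    \<open>y powr p = m\<^sup>2 * exp (2 * m * t) * y\<close>, whose only positive solution is
    \<open>x t\<close>.\<close>
  have "y t = x t"
  proof -
    have y0: "0 < y t" using emdenD(1)[OF em] .
    have "(1 - \<alpha> * (m * \<theta>)) * y t - y t powr p + m\<^sup>2 * exp (2 * m * t) * y t = m\<^sup>2 * \<theta>\<^sup>2 * y t"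
      using r unfolding z rhs_def by (simp add: algebra_simps power2_eq_square)
    moreover have "1 - \<alpha> * (m * \<theta>) = m\<^sup>2 * \<theta>\<^sup>2" using alpha_theta by simp
    ultimately have "y t powr p = m\<^sup>2 * exp (2 * m * t) * y t" by simp
    then have "y t powr (p - 1) = x t powr (p - 1)" using xp[of t] y0 x0[of t] by (simp add: powr_diff)
    then show ?thesis
      using powr_less_mono2[of "p - 1" "y t" "x t"] powr_less_mono2[of "p - 1" "x t" "y t"] y0 x0[of t] p_gt_1
      by (cases "y t" "x t" rule: linorder_cases) auto
  qed
  have eq: "y s = x s" if "s \<le> t" for s
  proof -
    have contx: "continuous_on {s..t} x" and conty: "continuous_on {s..t} y"
      using dx emdenD(2)[OF em] by (meson DERIV_isCont continuous_at_imp_continuous_on)+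
    obtain B1 where B1: "\<And>r. r \<in> {s..t} \<Longrightarrow> x r \<le> B1"
      using continuous_attains_sup[OF _ _ contx] that by fastforce
    obtain B2 where B2: "\<And>r. r \<in> {s..t} \<Longrightarrow> y r \<le> B2"
      using continuous_attains_sup[OF _ _ conty] that by fastforce
    obtain C where C: "\<And>r y1 y2 z1 z2. r \<le> t \<Longrightarrow> 0 \<le> y1 \<Longrightarrow> y1 \<le> max B1 B2 \<Longrightarrow> 0 \<le> y2 \<Longrightarrow> y2 \<le> max B1 B2 \<Longrightarrow>
      \<bar>rhs r y1 z1 - rhs r y2 z2\<bar> \<le> C * (\<bar>y1 - y2\<bar> + \<bar>z1 - z2\<bar>)" using rhs_lipschitz by metis
    have "(y s - x s = 0) \<and> (z s - m * \<theta> * x s = 0)"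
    proof (rule backward_uniqueness[where q = "\<lambda>r. rhs r (y r) (z r) - rhs r (x r) (m * \<theta> * x r)", OF that])
      show "((\<lambda>r. y r - x r) has_real_derivative z r - m * \<theta> * x r) (at r)" for r
        by (intro DERIV_diff emdenD(2) em dx)
      show "((\<lambda>r. z r - m * \<theta> * x r) has_real_derivative rhs r (y r) (z r) - rhs r (x r) (m * \<theta> * x r)) (at r)" for r
        unfolding rx by (intro DERIV_diff emdenD(3) em DERIV_cmult dx)
      show "\<bar>rhs r (y r) (z r) - rhs r (x r) (m * \<theta> * x r)\<bar> \<le> C * (\<bar>y r - x r\<bar> + \<bar>z r - m * \<theta> * x r\<bar>)" if "r \<in> {s..t}" for r
        using that B1[OF that] B2[OF that] x0[of r] emdenD(1)[OF em, of r] by (intro C) auto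
    qed (use \<open>y t = x t\<close> z in auto)
    then show ?thesis by simp
  qed
  have "((\<lambda>s. exp (m * \<theta> * s) / A) \<longlongrightarrow> 0 / A) at_bot"
  proof (intro tendsto_divide tendsto_const)
    have "filterlim (\<lambda>s. (m * \<theta>) * s) at_bot at_bot"
      using m_pos theta_pos by (intro filterlim_tendsto_pos_mult_at_bot[OF tendsto_const]) (auto simp: filterlim_ident)
    then show "((\<lambda>s. exp (m * \<theta> * s)) \<longlongrightarrow> 0) at_bot" by (rule filterlim_compose[OF exp_at_bot])
  qed (use A_pos in auto)
  then have "(x \<longlongrightarrow> 0) at_bot" unfolding x_def by simp
  moreover have "\<forall>\<^sub>F s in at_bot. x s = y s" unfolding eventually_at_bot_linorder using eq by (intro exI[of _ t]) simp
  ultimately have "(y \<longlongrightarrow> 0) at_bot" by (simp add: tendsto_cong)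
  then show False using lim tendsto_unique[OF trivial_limit_at_bot_linorder] by force
qed

text \<open>The Cauchy property comes from \<open>orbits_close\<close>. Care is required for
  positivity of the limit and for its value at minus infinity, since at a given time the energy
  bound holds only from some index on.\<close>

lemma star_exists:
  assumes c: "0 < c" and o: "\<And>n. orbit (Y n) (Z n)"
    and e: "\<And>s. \<forall>\<^sub>F n in sequentially. energy (Y n) (Z n) s \<le> - c"
  obtains y z where "star y z"
proof -
  have cauchy: "\<exists>n0. \<forall>n\<ge>n0. \<forall>k\<ge>n0. \<forall>t\<in>{a..b}. \<bar>Y n t - Y k t\<bar> < \<epsilon> \<and> \<bar>Z n t - Z k t\<bar> < \<epsilon>"
    if e0: "0 < \<epsilon>" for a b \<epsilon>
  proof -
    obtain S where S: "\<And>y1 z1 y2 z2 s t. orbit y1 z1 \<Longrightarrow> orbit y2 z2 \<Longrightarrow> energy y1 z1 s \<le> - c \<Longrightarrow>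
      energy y2 z2 s \<le> - c \<Longrightarrow> s \<le> S \<Longrightarrow> a \<le> t \<Longrightarrow> t \<le> b \<Longrightarrow> \<bar>y1 t - y2 t\<bar> < \<epsilon> \<and> \<bar>z1 t - z2 t\<bar> < \<epsilon>"
      using orbits_close[OF c e0] by metis
    obtain n0 where "\<And>n. n0 \<le> n \<Longrightarrow> energy (Y n) (Z n) S \<le> - c" using e[of S] by (auto simp: eventually_sequentially)
    then have "\<bar>Y n t - Y k t\<bar> < \<epsilon> \<and> \<bar>Z n t - Z k t\<bar> < \<epsilon>" if "n0 \<le> n" "n0 \<le> k" "t \<in> {a..b}" for n k t
      using S[OF o o, of n S k t] that by auto
    then show ?thesis by blast
  qed
  define y where "y t = lim (\<lambda>n. Y n t)" for t
  define z where "z t = lim (\<lambda>n. Z n t)" for t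
  have "Cauchy (\<lambda>n. Y n t)" "Cauchy (\<lambda>n. Z n t)" for t
    unfolding Cauchy_def dist_real_def using cauchy[of _ t t] by (auto, meson)+
  then have ylim: "(\<lambda>n. Y n t) \<longlonglongrightarrow> y t" and zlim: "(\<lambda>n. Z n t) \<longlonglongrightarrow> z t" for t
    unfolding y_def z_def by (simp_all add: Cauchy_convergent_iff convergent_LIMSEQ_iff)
  have unif: "\<forall>\<^sub>F n in sequentially. \<forall>t\<in>{a..b}. \<bar>Y n t - y t\<bar> \<le> \<epsilon> \<and> \<bar>Z n t - z t\<bar> \<le> \<epsilon>" if e0: "0 < \<epsilon>" for a b \<epsilon>
  proof -
    obtain n0 where n0: "\<And>n k t. n \<ge> n0 \<Longrightarrow> k \<ge> n0 \<Longrightarrow> t \<in> {a..b} \<Longrightarrow> \<bar>Y n t - Y k t\<bar> < \<epsilon> \<and> \<bar>Z n t - Z k t\<bar> < \<epsilon>"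
      using cauchy[OF e0] by meson
    have "\<bar>Y n t - y t\<bar> \<le> \<epsilon>" "\<bar>Z n t - z t\<bar> \<le> \<epsilon>" if "n \<ge> n0" "t \<in> {a..b}" for n t
    proof -
      have "(\<lambda>k. \<bar>Y n t - Y k t\<bar>) \<longlonglongrightarrow> \<bar>Y n t - y t\<bar>" "(\<lambda>k. \<bar>Z n t - Z k t\<bar>) \<longlonglongrightarrow> \<bar>Z n t - z t\<bar>"
        by (intro tendsto_intros ylim zlim)+
      then show "\<bar>Y n t - y t\<bar> \<le> \<epsilon>" "\<bar>Z n t - z t\<bar> \<le> \<epsilon>"
        using n0[OF that(1) _ that(2)] by (meson LIMSEQ_le_const2 less_imp_le)+
    qed
    then show ?thesis unfolding eventually_sequentially by blast
  qed
  have em: "emden (Y n) (Z n)" for n using orbitD(1)[OF o] .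
  have ynn: "0 \<le> y t" for t
    using LIMSEQ_le_const[OF ylim] emdenD(1)[OF em] less_imp_le by blast
  \<comment> \<open>Strict positivity may be lost in a pointwise limit; the lower bound drawn from
    the energy survives it.\<close>
  have ypos: "0 < y t" for t
  proof (rule ccontr)
    assume "\<not> 0 < y t"
    then have "y t = 0" using ynn[of t] by simp
    then have "(\<lambda>n. (Y n t)\<^sup>2 * (1 + m\<^sup>2 * exp (2 * m * t))) \<longlonglongrightarrow> 0"
      using tendsto_mult[OF tendsto_power[OF ylim[of t], of 2] tendsto_const] by simp
    moreover have "\<forall>\<^sub>F n in sequentially. 2 * c \<le> (Y n t)\<^sup>2 * (1 + m\<^sup>2 * exp (2 * m * t))"
      using e[of t] by eventually_elim (rule energy_lower[OF em])
    ultimately have "2 * c \<le> 0" by (intro tendsto_lowerbound) auto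
    then show False using c by simp
  qed
  have dy: "(y has_real_derivative z t) (at t)" for t
    by (rule DERIV_uniform_limit[OF emdenD(2)[OF em] ylim]) (rule eventually_mono[OF unif], auto)
  have dz: "(z has_real_derivative rhs t (y t) (z t)) (at t)" for t
  proof (rule DERIV_uniform_limit[OF emdenD(3)[OF em] zlim])
    fix a b \<epsilon> :: real assume \<epsilon>: "0 < \<epsilon>"
    obtain B where B: "\<And>y z t. orbit y z \<Longrightarrow> t \<le> b \<Longrightarrow> y t \<le> B" using orbit_bounded[of b] by metis
    obtain C where C: "0 < C" "\<And>t y1 y2 z1 z2. t \<le> b \<Longrightarrow> 0 \<le> y1 \<Longrightarrow> y1 \<le> B \<Longrightarrow> 0 \<le> y2 \<Longrightarrow> y2 \<le> B \<Longrightarrow>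
      \<bar>rhs t y1 z1 - rhs t y2 z2\<bar> \<le> C * (\<bar>y1 - y2\<bar> + \<bar>z1 - z2\<bar>)" using rhs_lipschitz by metis
    have yB: "y t \<le> B" if "t \<le> b" for t using LIMSEQ_le_const2[OF ylim] B[OF o that] by blast
    show "\<forall>\<^sub>F n in sequentially. \<forall>t\<in>{a..b}. \<bar>rhs t (Y n t) (Z n t) - rhs t (y t) (z t)\<bar> \<le> \<epsilon>"
      using unif[of "\<epsilon> / (2 * C)" a b] \<epsilon> C(1)
    proof (simp, elim eventually_mono, intro ballI)
      fix n t assume *: "\<forall>t\<in>{a..b}. \<bar>Y n t - y t\<bar> \<le> \<epsilon> / (2 * C) \<and> \<bar>Z n t - z t\<bar> \<le> \<epsilon> / (2 * C)" and t: "t \<in> {a..b}"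
      have "\<bar>rhs t (Y n t) (Z n t) - rhs t (y t) (z t)\<bar> \<le> C * (\<bar>Y n t - y t\<bar> + \<bar>Z n t - z t\<bar>)"
        using t B[OF o, of t n] yB[of t] ynn[of t] emdenD(1)[OF em, of n t] by (intro C(2)) auto
      also have "\<dots> \<le> C * (\<epsilon> / (2 * C) + \<epsilon> / (2 * C))" using * t C(1) by (intro mult_left_mono add_mono) auto
      also have "\<dots> = \<epsilon>" using C(1) by simp
      finally show "\<bar>rhs t (Y n t) (Z n t) - rhs t (y t) (z t)\<bar> \<le> \<epsilon>" .
    qed
  qed
  have "(y \<longlongrightarrow> 1) at_bot"
  proof (rule tendstoI)
    fix \<epsilon> :: real assume "0 < \<epsilon>"
    then have e2: "0 < \<epsilon> / 2" by simp
    obtain L M where LM: "\<And>y z s t. orbit y z \<Longrightarrow> energy y z s \<le> - c \<Longrightarrow> s + L \<le> t \<Longrightarrow> t \<le> - M \<Longrightarrow> \<bar>y t - 1\<bar> < \<epsilon> / 2 \<and> \<bar>z t\<bar> < \<epsilon> / 2"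
      using settling[OF c e2] by metis
    \<comment> \<open>\<open>L\<close> and \<open>M\<close> are uniform: for fixed \<open>t\<close>
      all late members have energy at most \<open>- c\<close> at time \<open>t - L\<close> and are
      therefore settled at \<open>t\<close>.\<close>
    have "\<bar>y t - 1\<bar> \<le> \<epsilon> / 2" if "t \<le> - M" for t
    proof (rule tendsto_upperbound)
      show "(\<lambda>n. \<bar>Y n t - 1\<bar>) \<longlonglongrightarrow> \<bar>y t - 1\<bar>" by (intro tendsto_intros ylim)
      show "\<forall>\<^sub>F n in sequentially. \<bar>Y n t - 1\<bar> \<le> \<epsilon> / 2"
        using e[of "t - L"] by eventually_elim (use LM[OF o _ _ that] in force)
    qed simp
    then have "dist (y t) 1 < \<epsilon>" if "t \<le> - M" for t using that \<open>0 < \<epsilon>\<close> by (force simp: dist_real_def)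
    then show "\<forall>\<^sub>F t in at_bot. dist (y t) 1 < \<epsilon>" by (auto simp: eventually_at_bot_linorder)
  qed
  then show ?thesis using dy dz ypos by (intro that[of y z]) (auto simp: star_def emden_def)
qed

end

section \<open>Regular solutions\<close>

lemma integral_from_0_deriv:
  fixes q :: "real \<Rightarrow> real"
  assumes "continuous_on {0..} q" "0 \<le> s"
  shows "((\<lambda>x. integral {0..x} q) has_real_derivative q s) (at s within {0..})"
proof -
  have "continuous_on {0..s + 1} q" using assms(1) by (rule continuous_on_subset) auto
  then have "((\<lambda>x. integral {0..x} q) has_real_derivative q s) (at s within {0..s + 1})"
    using assms(2) by (intro integral_has_real_derivative) auto
  moreover have "at s within {0..s + 1} = at s within {0..}"
    using assms(2) by (intro at_within_nhd[of s "{..<s + 1}"]) auto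
  ultimately show ?thesis by simp
qed

lemma at_within_atLeast_0: "0 < s \<Longrightarrow> at s within {0..} = at (s::real)"
  by (intro at_within_interior) simp

lemma integral_abs_bound:
  fixes f g :: "real \<Rightarrow> real"
  assumes "continuous_on {0..} f" "0 \<le> r" "continuous_on {0..} g" "\<And>x. 0 \<le> x \<Longrightarrow> x \<le> r \<Longrightarrow> \<bar>f x\<bar> \<le> g x"
    "\<And>x. 0 \<le> x \<Longrightarrow> (P has_real_derivative g x) (at x)"
  shows "\<bar>integral {0..r} f\<bar> \<le> P r - P 0"
proof -
  have "f integrable_on {0..r}"
    using assms(1) by (intro integrable_continuous_interval) (rule continuous_on_subset, auto)
  moreover have P: "(g has_integral P r - P 0) {0..r}"
    using assms(2,5) by (intro fundamental_theorem_of_calculus)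
      (auto simp flip: has_real_derivative_iff_has_vector_derivative intro: has_field_derivative_at_within)
  ultimately have "norm (integral {0..r} f) \<le> integral {0..r} g"
    using assms(4) by (intro integral_norm_bound_integral) (auto intro: has_integral_integrable)
  then show ?thesis using P by (simp add: integral_unique)
qed

text \<open>The weight \<open>exp (\<beta> * s\<^sup>2)\<close> makes the Picard operator a contraction on all of \<open>[0, \<infinity>)\<close> at once.\<close>

lemma radial_picard:
  fixes h :: "real \<Rightarrow> real" and k :: nat
  assumes lip: "\<And>x y. \<bar>h x - h y\<bar> \<le> L * \<bar>x - y\<bar>" and bnd: "\<And>x. \<bar>h x\<bar> \<le> H"
  obtains u v where "u 0 = \<gamma>" "v 0 = 0" "continuous_on {0..} u" "continuous_on {0..} v"
    "(u has_real_derivative 0) (at 0 within {0..})"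
    "\<And>s. 0 < s \<Longrightarrow> (u has_real_derivative v s) (at s)"
    "\<And>s. 0 < s \<Longrightarrow> (v has_real_derivative - real k / s * v s - h (u s)) (at s)"
proof -
  have L: "0 \<le> L" using lip[of 1 0] abs_ge_zero[of "h 1 - h 0"] by simp
  have H: "0 \<le> H" using bnd[of 0] by linarith
  have conth: "continuous_on S (\<lambda>x. h (w x))" if "continuous_on S w" for S and w :: "real \<Rightarrow> real"
  proof -
    have "continuous_on UNIV h"
      unfolding continuous_on_iff dist_real_def
    proof (intro ballI allI impI)
      fix x e :: real assume e: "0 < e"
      have "\<bar>h y - h x\<bar> < e" if "\<bar>y - x\<bar> < e / (L + 1)" for y
      proof -
        have "\<bar>h y - h x\<bar> \<le> (L + 1) * \<bar>y - x\<bar>" using lip[of y x] by (simp add: algebra_simps)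
        also have "\<dots> < e" using that L by (simp add: pos_less_divide_eq mult.commute)
        finally show ?thesis .
      qed
      then show "\<exists>d>0. \<forall>y\<in>UNIV. \<bar>y - x\<bar> < d \<longrightarrow> \<bar>h y - h x\<bar> < e"
        using e L by (intro exI[of _ "e / (L + 1)"]) auto
    qed
    then show ?thesis using continuous_on_compose2[OF _ that] by blast
  qed
  \<comment> \<open>\<open>G\<close> is the flux \<open>- r ^ k * u'\<close>, \<open>- q\<close> the
    resulting derivative of \<open>u\<close>, and \<open>T\<close> the integral operator whose fixed
    point is the solution.\<close>
  define G where "G w r = integral {0..r} (\<lambda>\<tau>. \<tau> ^ k * h (w \<tau>))" for w and r :: real
  \<comment> \<open>The value 0 at \<open>r = 0\<close> is the continuous extension from the right,
    since \<open>q\<close> is at most \<open>H / (k + 1) * r\<close> in size.\<close>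
  define q where "q w r = (if r \<le> 0 then 0 else G w r / r ^ k)" for w and r :: real
  define T where "T w s = \<gamma> - integral {0..s} (q w)" for w and s :: real
  have cG: "continuous_on {0..} (\<lambda>\<tau>. \<tau> ^ k * h (w \<tau>))" if "continuous_on {0..} w" for w :: "real \<Rightarrow> real"
    using conth[OF that] by (intro continuous_intros)
  have dP: "((\<lambda>x. c * x ^ Suc k / real (Suc k)) has_real_derivative c * x ^ k) (at x)" for c x :: real
    by (rule DERIV_cong[OF DERIV_cdivide[OF DERIV_cmult[OF DERIV_pow]]]) auto
  have GH: "\<bar>G w r\<bar> \<le> H * r ^ Suc k / real (Suc k)" if "continuous_on {0..} w" "0 \<le> r" for w r
  proof -
    have "\<bar>G w r\<bar> \<le> H * r ^ Suc k / real (Suc k) - H * 0 ^ Suc k / real (Suc k)" unfolding G_def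
    proof (rule integral_abs_bound[OF cG[OF that(1)] that(2) _ _ dP])
      show "\<bar>x ^ k * h (w x)\<bar> \<le> H * x ^ k" if "0 \<le> x" for x
        using mult_right_mono[OF bnd[of "w x"], of "x ^ k"] that by (simp add: abs_mult mult.commute)
    qed (auto intro!: continuous_intros)
    then show ?thesis by simp
  qed
  have dG: "(G w has_real_derivative r ^ k * h (w r)) (at r)" if "continuous_on {0..} w" "0 < r" for w r
    using integral_from_0_deriv[OF cG[OF that(1)], of r] that(2)
    unfolding G_def at_within_atLeast_0[OF that(2)] by simp
  have qH: "\<bar>q w r\<bar> \<le> H / real (Suc k) * r" if "continuous_on {0..} w" "0 \<le> r" for w r
  proof (cases "r = 0")
    case False
    then have r: "0 < r" using that by simp
    have "\<bar>q w r\<bar> = \<bar>G w r\<bar> / r ^ k" using r by (simp add: q_def)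
    also have "\<dots> \<le> (H * r ^ Suc k / real (Suc k)) / r ^ k" using GH[OF that] r by (intro divide_right_mono) auto
    also have "\<dots> = H / real (Suc k) * r" using r by simp
    finally show ?thesis .
  qed (simp add: q_def)
  have dq: "(q w has_real_derivative h (w r) - real k / r * q w r) (at r)" if "continuous_on {0..} w" "0 < r" for w r
  proof -
    have "((\<lambda>r. G w r / r ^ k) has_real_derivative
        ((r ^ k * h (w r)) * r ^ k - G w r * (real k * r ^ (k - 1))) / (r ^ k * r ^ k)) (at r)"
      using that(2) by (auto intro!: derivative_eq_intros dG[OF that])
    moreover have "((r ^ k * h (w r)) * r ^ k - G w r * (real k * r ^ (k - 1))) / (r ^ k * r ^ k)
       = h (w r) - real k / r * q w r"
      using that(2) by (cases k) (auto simp: q_def field_simps)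
    ultimately have "((\<lambda>r. G w r / r ^ k) has_real_derivative h (w r) - real k / r * q w r) (at r)" by simp
    then show ?thesis
      by (rule has_field_derivative_transform_within_open[of _ _ _ "{0<..}"]) (use that(2) in \<open>auto simp: q_def\<close>)
  qed
  have cq: "continuous_on {0..} (q w)" if "continuous_on {0..} w" for w
  proof -
    have "continuous (at r within {0..}) (q w)" if "0 \<le> r" for r
    proof (cases "r = 0")
      case True
      have "((\<lambda>x. H / real (Suc k) * x) \<longlongrightarrow> H / real (Suc k) * 0) (at 0 within {0..})"
        by (intro tendsto_intros)
      then have lim: "((\<lambda>x. H / real (Suc k) * x) \<longlongrightarrow> 0) (at 0 within {0..})" by simp
      have "(q w \<longlongrightarrow> 0) (at 0 within {0..})"
      proof (rule Lim_null_comparison[OF _ lim])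
        show "\<forall>\<^sub>F x in at 0 within {0..}. norm (q w x) \<le> H / real (Suc k) * x"
          unfolding eventually_at_filter
          by (rule always_eventually) (use qH[OF \<open>continuous_on {0..} w\<close>] in auto)
      qed
      then show ?thesis using True by (simp add: continuous_within q_def)
    next
      case False
      then have "0 < r" using that by simp
      then show ?thesis
        by (rule continuous_at_imp_continuous_at_within[OF DERIV_isCont[OF dq[OF \<open>continuous_on {0..} w\<close>]]])
    qed
    then show ?thesis by (simp add: continuous_on_eq_continuous_within)
  qed
  have dT: "(T w has_real_derivative - q w s) (at s within {0..})" if "continuous_on {0..} w" "0 \<le> s" for w s
    unfolding T_def using integral_from_0_deriv[OF cq[OF that(1)] that(2)]
    by (auto intro!: derivative_eq_intros)
  have TH: "\<bar>T w s\<bar> \<le> \<bar>\<gamma>\<bar> + H * s\<^sup>2" if "continuous_on {0..} w" "0 \<le> s" for w s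
  proof -
    have "\<bar>integral {0..s} (q w)\<bar> \<le> H * s\<^sup>2 - H * 0\<^sup>2"
    proof (rule integral_abs_bound[where g = "\<lambda>x. 2 * H * x", OF cq[OF that(1)] that(2)])
      show "\<bar>q w x\<bar> \<le> 2 * H * x" if "0 \<le> x" for x
      proof -
        have "H / real (Suc k) \<le> H" using H by (simp add: divide_le_eq mult_le_cancel_left1)
        then have "H / real (Suc k) * x \<le> 2 * H * x" using that H by (intro mult_right_mono) auto
        then show ?thesis using qH[OF \<open>continuous_on {0..} w\<close> that] by linarith
      qed
    qed (auto intro!: continuous_intros derivative_eq_intros)
    then show ?thesis unfolding T_def by simp
  qed
  \<comment> \<open>A primitive of \<open>r * exp (\<beta> * r\<^sup>2)\<close> carries the factor
    \<open>1 / (2 * \<beta>)\<close>, so \<open>\<beta> \<ge> L\<close> yields the contraction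
    factor 1/2; \<open>\<beta> \<ge> 1\<close> gives
    \<open>r\<^sup>2 \<le> exp (\<beta> * r\<^sup>2)\<close>.\<close>
  define \<beta> where "\<beta> = L + 1"
  have \<beta>: "0 < \<beta>" "L \<le> \<beta>" using L by (auto simp: \<beta>_def)
  have diff: "\<bar>T w1 s - T w2 s\<bar> \<le> D / 2 * exp (\<beta> * s\<^sup>2)"
    if w: "continuous_on {0..} w1" "continuous_on {0..} w2" and D: "\<And>x. 0 \<le> x \<Longrightarrow> \<bar>w1 x - w2 x\<bar> \<le> D * exp (\<beta> * x\<^sup>2)"
      and s: "0 \<le> s" for w1 w2 D s
  proof -
    have D0: "0 \<le> D" using D[of 0] by simp
    have qd: "\<bar>q w1 r - q w2 r\<bar> \<le> D * \<beta> * r * exp (\<beta> * r\<^sup>2)" if r: "0 \<le> r" for r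
    proof (cases "r = 0")
      case False
      then have r0: "0 < r" using r by simp
      have int: "(\<lambda>\<tau>. \<tau> ^ k * h (w \<tau>)) integrable_on {0..r}" if "continuous_on {0..} w" for w
        using cG[OF that] by (intro integrable_continuous_interval) (rule continuous_on_subset, auto)
      have "G w1 r - G w2 r = integral {0..r} (\<lambda>\<tau>. \<tau> ^ k * h (w1 \<tau>) - \<tau> ^ k * h (w2 \<tau>))"
        unfolding G_def by (intro integral_diff[symmetric] int w)
      moreover have "\<bar>integral {0..r} (\<lambda>\<tau>. \<tau> ^ k * h (w1 \<tau>) - \<tau> ^ k * h (w2 \<tau>))\<bar>
        \<le> (L * D * exp (\<beta> * r\<^sup>2)) * r ^ Suc k / real (Suc k) - (L * D * exp (\<beta> * r\<^sup>2)) * 0 ^ Suc k / real (Suc k)"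
      proof (rule integral_abs_bound[OF _ r _ _ dP])
        fix x assume x: "0 \<le> x" "x \<le> r"
        have "\<bar>h (w1 x) - h (w2 x)\<bar> \<le> L * \<bar>w1 x - w2 x\<bar>" by (rule lip)
        also have "\<dots> \<le> L * (D * exp (\<beta> * x\<^sup>2))" using D[OF x(1)] L by (rule mult_left_mono)
        also have "\<dots> \<le> L * (D * exp (\<beta> * r\<^sup>2))" using L D0 \<beta> x by (intro mult_left_mono) (auto intro: power_mono)
        finally have "x ^ k * \<bar>h (w1 x) - h (w2 x)\<bar> \<le> x ^ k * (L * (D * exp (\<beta> * r\<^sup>2)))"
          using x by (intro mult_left_mono) auto
        then show "\<bar>x ^ k * h (w1 x) - x ^ k * h (w2 x)\<bar> \<le> L * D * exp (\<beta> * r\<^sup>2) * x ^ k"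
          using x by (simp add: abs_mult mult_ac flip: right_diff_distrib)
      qed (auto intro!: continuous_intros cG w)
      ultimately have "\<bar>G w1 r - G w2 r\<bar> \<le> L * D * exp (\<beta> * r\<^sup>2) * r ^ Suc k / real (Suc k)" by simp
      also have "\<dots> \<le> L * D * exp (\<beta> * r\<^sup>2) * r ^ Suc k / 1"
        using L D0 r by (intro divide_left_mono) auto
      also have "\<dots> \<le> D * \<beta> * exp (\<beta> * r\<^sup>2) * r ^ Suc k / 1"
        using \<beta> D0 r by (simp add: mult_ac mult_left_mono mult_right_mono)
      finally have "\<bar>G w1 r - G w2 r\<bar> / r ^ k \<le> (D * \<beta> * exp (\<beta> * r\<^sup>2) * r ^ Suc k / 1) / r ^ k"
        using r0 by (intro divide_right_mono) auto
      also have "\<dots> = D * \<beta> * r * exp (\<beta> * r\<^sup>2)" using r0 by simp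
      finally show ?thesis using r0 by (simp add: q_def flip: diff_divide_distrib)
    qed (simp add: q_def)
    have int: "q w integrable_on {0..s}" if "continuous_on {0..} w" for w
      using cq[OF that] by (intro integrable_continuous_interval) (rule continuous_on_subset, auto)
    have "T w1 s - T w2 s = - integral {0..s} (\<lambda>r. q w1 r - q w2 r)"
      unfolding T_def by (simp add: integral_diff[OF int[OF w(1)] int[OF w(2)]])
    moreover have "\<bar>integral {0..s} (\<lambda>r. q w1 r - q w2 r)\<bar> \<le> D / 2 * exp (\<beta> * s\<^sup>2) - D / 2 * exp (\<beta> * 0\<^sup>2)"
      by (rule integral_abs_bound[where g = "\<lambda>r. D * \<beta> * r * exp (\<beta> * r\<^sup>2)", OF _ s])
         (use qd in \<open>auto intro!: continuous_intros cq w derivative_eq_intros\<close>)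
    ultimately show ?thesis using D0 by simp
  qed
  \<comment> \<open>Conjugation by the weight turns \<open>T\<close> into an operator on bounded
    continuous functions on the whole line; \<open>max 0 s\<close> extends its values from the half
    line by the value at 0.\<close>
  define E where "E \<phi> s = exp (\<beta> * s\<^sup>2) * apply_bcontfun \<phi> s" for \<phi> :: "real \<Rightarrow>\<^sub>C real" and s
  define R where "R \<phi> s = exp (- \<beta> * (max 0 s)\<^sup>2) * T (E \<phi>) (max 0 s)" for \<phi> s
  have cE: "continuous_on S (E \<phi>)" for S \<phi>
    unfolding E_def using continuous_on_apply_bcontfun by (intro continuous_intros) auto
  have cT: "continuous_on {0..} (T w)" if "continuous_on {0..} w" for w
    using dT[OF that] by (meson DERIV_continuous_on atLeast_iff)
  have Rb: "R \<phi> \<in> bcontfun" for \<phi>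
  proof -
    have "continuous_on UNIV (\<lambda>s. T (E \<phi>) (max 0 s))"
      by (rule continuous_on_compose2[OF cT[OF cE]]) (auto intro!: continuous_intros)
    then have cR: "continuous_on UNIV (R \<phi>)" unfolding R_def by (intro continuous_intros)
    have "norm (R \<phi> s) \<le> \<bar>\<gamma>\<bar> + H" for s :: real
    proof -
    define r where "r = max 0 s"
    have r: "0 \<le> r" by (simp add: r_def)
    have "r\<^sup>2 \<le> exp (\<beta> * r\<^sup>2)"
    proof -
      have "r\<^sup>2 \<le> \<beta> * r\<^sup>2" using L by (simp add: \<beta>_def algebra_simps)
      also have "\<dots> \<le> exp (\<beta> * r\<^sup>2)" using exp_ge_add_one_self[of "\<beta> * r\<^sup>2"] by linarith
      finally show ?thesis .
    qed
    moreover have "1 \<le> exp (\<beta> * r\<^sup>2)" using \<beta> by simp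
    ultimately have "\<bar>\<gamma>\<bar> * 1 + H * r\<^sup>2 \<le> \<bar>\<gamma>\<bar> * exp (\<beta> * r\<^sup>2) + H * exp (\<beta> * r\<^sup>2)"
      using H by (intro add_mono mult_left_mono) auto
    then have "\<bar>T (E \<phi>) r\<bar> \<le> (\<bar>\<gamma>\<bar> + H) * exp (\<beta> * r\<^sup>2)" using TH[OF cE r, of \<phi>] by (simp add: algebra_simps)
    then have "exp (- \<beta> * r\<^sup>2) * \<bar>T (E \<phi>) r\<bar> \<le> exp (- \<beta> * r\<^sup>2) * ((\<bar>\<gamma>\<bar> + H) * exp (\<beta> * r\<^sup>2))"
      by (rule mult_left_mono) simp
    also have "\<dots> = \<bar>\<gamma>\<bar> + H" by (simp add: exp_minus)
    finally show ?thesis by (simp add: R_def r_def abs_mult)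
    qed
    then have "bounded (range (R \<phi>))" by (intro boundedI) auto
    with cR show ?thesis by (simp add: bcontfun_def)
  qed
  define \<Phi> where "\<Phi> \<phi> = Bcontfun (R \<phi>)" for \<phi>
  have ap: "apply_bcontfun (\<Phi> \<phi>) = R \<phi>" for \<phi> unfolding \<Phi>_def by (rule Bcontfun_inverse[OF Rb])
  have "dist (\<Phi> \<phi>) (\<Phi> \<psi>) \<le> 1 / 2 * dist \<phi> \<psi>" for \<phi> \<psi>
  proof (rule dist_bound)
    fix s :: real
    define r where "r = max 0 s"
    have r: "0 \<le> r" by (simp add: r_def)
    have "\<bar>E \<phi> x - E \<psi> x\<bar> \<le> dist \<phi> \<psi> * exp (\<beta> * x\<^sup>2)" for x
    proof -
      have "\<bar>E \<phi> x - E \<psi> x\<bar> = exp (\<beta> * x\<^sup>2) * dist (apply_bcontfun \<phi> x) (apply_bcontfun \<psi> x)"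
        by (simp add: E_def dist_real_def abs_mult flip: right_diff_distrib)
      also have "\<dots> \<le> exp (\<beta> * x\<^sup>2) * dist \<phi> \<psi>"
        by (intro mult_left_mono dist_bounded) simp
      finally show ?thesis by (simp add: mult.commute)
    qed
    then have "\<bar>T (E \<phi>) r - T (E \<psi>) r\<bar> \<le> dist \<phi> \<psi> / 2 * exp (\<beta> * r\<^sup>2)" by (intro diff cE r)
    then have "exp (- \<beta> * r\<^sup>2) * \<bar>T (E \<phi>) r - T (E \<psi>) r\<bar> \<le> exp (- \<beta> * r\<^sup>2) * (dist \<phi> \<psi> / 2 * exp (\<beta> * r\<^sup>2))"
      by (rule mult_left_mono) simp
    also have "\<dots> = 1 / 2 * dist \<phi> \<psi>" by (simp add: exp_minus)
    finally show "dist (apply_bcontfun (\<Phi> \<phi>) s) (apply_bcontfun (\<Phi> \<psi>) s) \<le> 1 / 2 * dist \<phi> \<psi>"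
      by (simp add: ap R_def r_def dist_real_def abs_mult flip: right_diff_distrib)
  qed
  then obtain \<phi> where fp: "\<Phi> \<phi> = \<phi>"
    using banach_fix_type[of "1/2" \<Phi>] by auto
  define u where "u = E \<phi>"
  have cu: "continuous_on {0..} u" unfolding u_def by (rule cE)
  have uT: "u s = T u s" if "0 \<le> s" for s
  proof -
    have "u s = exp (\<beta> * s\<^sup>2) * R \<phi> s" unfolding u_def E_def using fp ap by metis
    also have "\<dots> = T u s" using that by (simp add: R_def u_def exp_minus)
    finally show ?thesis .
  qed
  have du: "(u has_real_derivative - q u s) (at s within {0..})" if "0 \<le> s" for s
    by (rule has_field_derivative_transform_within[OF dT[OF cu that], of 1]) (use that uT in auto)
  show ?thesis
  proof (rule that[of u "\<lambda>s. - q u s"])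
    show "u 0 = \<gamma>" using uT[of 0] by (simp add: T_def)
    show "(u has_real_derivative 0) (at 0 within {0..})" using du[of 0] by (simp add: q_def)
    show "(u has_real_derivative - q u s) (at s)" if "0 < s" for s
      using du[of s] that by (simp add: at_within_atLeast_0)
    show "((\<lambda>s. - q u s) has_real_derivative - real k / s * - q u s - h (u s)) (at s)" if "0 < s" for s
      using DERIV_minus[OF dq[OF cu that]] by simp
    show "continuous_on {0..} (\<lambda>s. - q u s)" by (intro continuous_intros cq cu)
  qed (auto simp: q_def cu)
qed

context supercritical begin

section \<open>Global positive regular solutions\<close>

definition regular :: "real \<Rightarrow> (real \<Rightarrow> real) \<Rightarrow> (real \<Rightarrow> real) \<Rightarrow> bool" where
  "regular \<gamma> u v \<longleftrightarrow> u 0 = \<gamma> \<and> continuous_on {0..} u \<and> (u has_real_derivative 0) (at 0 within {0..}) \<and>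
     v 0 = 0 \<and> continuous_on {0..} v \<and>
     (\<forall>s>0. 0 < u s \<and> u s \<le> \<gamma> \<and> (u has_real_derivative v s) (at s) \<and>
        (v has_real_derivative - (real N - 1) / s * v s - fnl p (u s)) (at s))"

text \<open>Truncating the argument of \<open>f\<close> makes the Picard lemma applicable; the
  solution is then shown never to reach the truncation. The energy \<open>v^2 / 2 + well u\<close>
  prevents exit at the top, the Pohozaev functional exit at the bottom.\<close>

lemma regular_exists:
  assumes \<gamma>: "1 < \<gamma>"
  obtains u v where "regular \<gamma> u v"
proof -
  \<comment> \<open>Cutting off at \<open>\<gamma> + 1\<close> rather than at
    \<open>\<gamma>\<close> leaves room above the initial value, so that the first exit time is
    positive.\<close>
  define clip where "clip x = max 0 (min x (\<gamma> + 1))" for x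
  define h where "h x = fnl p (clip x)" for x
  have clip: "0 \<le> clip x" "clip x \<le> \<gamma> + 1" "\<bar>clip x - clip y\<bar> \<le> \<bar>x - y\<bar>" for x y
    using \<gamma> by (auto simp: clip_def)
  have lip: "\<bar>h x - h y\<bar> \<le> (1 + p * (\<gamma> + 1) powr (p - 1)) * \<bar>x - y\<bar>" for x y
  proof -
    have "\<bar>clip x powr p - clip y powr p\<bar> \<le> p * (\<gamma> + 1) powr (p - 1) * \<bar>clip x - clip y\<bar>"
      by (intro powr_diff_le p_gt_1 clip)
    also have "\<dots> \<le> p * (\<gamma> + 1) powr (p - 1) * \<bar>x - y\<bar>" using p_gt_1 by (intro mult_left_mono clip) auto
    finally have "\<bar>clip x powr p - clip y powr p\<bar> \<le> p * (\<gamma> + 1) powr (p - 1) * \<bar>x - y\<bar>" .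
    moreover have "\<bar>clip x - clip y\<bar> \<le> \<bar>x - y\<bar>" by (rule clip)
    moreover have "h x - h y = (clip x powr p - clip y powr p) - (clip x - clip y)" by (simp add: h_def fnl_def)
    ultimately have "\<bar>h x - h y\<bar> \<le> \<bar>clip x powr p - clip y powr p\<bar> + \<bar>clip x - clip y\<bar>"
      by (simp only: abs_triangle_ineq4)
    also have "\<dots> \<le> p * (\<gamma> + 1) powr (p - 1) * \<bar>x - y\<bar> + \<bar>x - y\<bar>" by (intro add_mono) fact+
    finally show ?thesis by (simp add: algebra_simps)
  qed
  have bnd: "\<bar>h x\<bar> \<le> (\<gamma> + 1) + (\<gamma> + 1) powr p" for x
  proof -
    have "clip x powr p \<le> (\<gamma> + 1) powr p" using p_gt_1 clip by (intro powr_mono2) auto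
    then show ?thesis using clip(1,2)[of x] powr_ge_zero[of "clip x" p] unfolding h_def fnl_def by linarith
  qed
  obtain u v where uv: "u 0 = \<gamma>" "v 0 = 0" "continuous_on {0..} u" "continuous_on {0..} v"
    "(u has_real_derivative 0) (at 0 within {0..})"
    and du: "\<And>s. 0 < s \<Longrightarrow> (u has_real_derivative v s) (at s)"
    and dv: "\<And>s. 0 < s \<Longrightarrow> (v has_real_derivative - real (N - 1) / s * v s - h (u s)) (at s)"
    using radial_picard[OF lip bnd] by metis
  have good: "h x = x powr p - x" if "0 \<le> x" "x \<le> \<gamma> + 1" for x
    using that by (simp add: h_def clip_def fnl_def)
  define k where "k = N - 3"
  have N: "N = k + 3" using N3 by (simp add: k_def)
  \<comment> \<open>With this \<open>a\<close> the terms in \<open>u powr (p + 1)\<close> cancel in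
    the derivative of \<open>P\<close>, and \<open>a < (N - 2) / 2\<close> restates
    supercriticality.\<close>
  define a where "a = real N / (p + 1)"
  have a: "0 < a" "a < (real N - 2) / 2"
  proof -
    show "0 < a" using N3 p_gt_1 by (simp add: a_def)
    have "real N + 2 < p * (real N - 2)" using pS N3 by (simp add: pos_divide_less_eq)
    then show "a < (real N - 2) / 2" using p_gt_1 by (simp add: a_def field_simps)
  qed
  define E where "E s = (v s)\<^sup>2 / 2 + well (u s)" for s
  \<comment> \<open>Pohozaev functional: it decreases strictly because \<open>p\<close> is supercritical, but would be nonnegative at a zero of \<open>u\<close>\<close>
  define P where "P s = s ^ N * E s + a * s ^ (N - 1) * u s * v s" for s
  have sub: "continuous_on {0..t} u" "continuous_on {0..t} v" for t
    using uv(3,4) by (auto intro: continuous_on_subset)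
  have cE: "continuous_on {0..t} E" and cP: "continuous_on {0..t} P" if "\<And>s. 0 \<le> s \<Longrightarrow> s \<le> t \<Longrightarrow> 0 \<le> u s" for t
  proof -
    show cE: "continuous_on {0..t} E"
      unfolding E_def well_def using p_gt_1 that
      by (intro continuous_intros sub continuous_on_powr') auto
    show "continuous_on {0..t} P" unfolding P_def by (intro continuous_intros sub cE)
  qed
  have dE: "(E has_real_derivative - (real N - 1) / s * (v s)\<^sup>2) (at s)" if "0 < s" "0 < u s" "u s \<le> \<gamma> + 1" for s
  proof -
    have "(E has_real_derivative v s * (- real (N - 1) / s * v s - h (u s)) + (u s powr p - u s) * v s) (at s)"
      unfolding E_def by (auto intro!: derivative_eq_intros dv DERIV_chain2[OF well_deriv] du that)
    moreover have "real (N - 1) = real N - 1" using N3 by simp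
    ultimately show ?thesis using good that by (simp add: power2_eq_square algebra_simps)
  qed
  have dP: "\<exists>l. (P has_real_derivative l) (at s) \<and> l < 0" if "0 < s" "0 < u s" "u s \<le> \<gamma> + 1" for s
  proof -
    have up: "u s powr (p + 1) = u s * u s powr p" using that by (simp add: powr_add)
    have hh: "h (u s) = u s powr p - u s" using good that by simp
    define V where "V = v s" define U where "U = u s" define W where "W = u s powr p"
    have "(P has_real_derivative (real N * s ^ (N - 1)) * E s + s ^ N * (- (real N - 1) / s * V\<^sup>2)
       + (a * (real (N - 1) * s ^ (N - 2)) * U * V + a * s ^ (N - 1) * (V * V + U * (- real (N - 1) / s * V - (W - U))))) (at s)"
      unfolding P_def V_def U_def W_def hh[symmetric]
      by (rule DERIV_cong, (rule derivative_intros dE dv du that)+) (simp add: algebra_simps numeral_2_eq_2)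
    moreover have "(real N * s ^ (N - 1)) * E s + s ^ N * (- (real N - 1) / s * V\<^sup>2)
       + (a * (real (N - 1) * s ^ (N - 2)) * U * V + a * s ^ (N - 1) * (V * V + U * (- real (N - 1) / s * V - (W - U))))
      = s ^ (N - 1) * ((a - (real N - 2) / 2) * V\<^sup>2 - (real N / 2 - a) * U\<^sup>2)"
    proof -
      have E: "E s = V\<^sup>2 / 2 - U\<^sup>2 / 2 + U * W / (p + 1)" by (simp add: E_def well_def V_def U_def W_def up)
      have aN: "real N * (U * W / (p + 1)) = a * U * W" by (simp add: a_def)
      have p1: "s ^ N = s * s ^ (N - 1)" "s ^ (N - 1) = s * s ^ (N - 2)" by (simp_all add: N numeral_3_eq_3)
      have "s ^ N * (- (real N - 1) / s * V\<^sup>2) = - (real N - 1) * s ^ (N - 1) * V\<^sup>2" using \<open>0 < s\<close> p1(1) by simp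
      moreover have "a * s ^ (N - 1) * (U * (- real (N - 1) / s * V)) = - (a * (real (N - 1) * s ^ (N - 2)) * U * V)"
        unfolding p1(2) using \<open>0 < s\<close> by (simp add: field_simps)
      moreover have "(real N * s ^ (N - 1)) * E s = s ^ (N - 1) * (real N * V\<^sup>2 / 2 - real N * U\<^sup>2 / 2 + a * U * W)"
        unfolding E aN[symmetric] by (simp add: algebra_simps)
      moreover have "A1 + B1 + (C1 + a * T1 * (V * V + U * (r - (W - U)))) = T1 * ((a - (X - 2) / 2) * V\<^sup>2 - (X / 2 - a) * U\<^sup>2)"
        if "B1 = - (X - 1) * T1 * V\<^sup>2" "a * T1 * (U * r) = - C1" "A1 = T1 * (X * V\<^sup>2 / 2 - X * U\<^sup>2 / 2 + a * U * W)"
        for A1 B1 C1 a T1 V U W X r :: real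
      proof -
        have "a * T1 * (V * V + U * (r - (W - U))) = a * T1 * V * V + a * T1 * (U * r) - a * T1 * U * (W - U)"
          by (simp add: algebra_simps)
        then show ?thesis unfolding that by (simp add: field_simps power2_eq_square)
      qed
      ultimately show ?thesis by blast
    qed
    moreover have "s ^ (N - 1) * ((a - (real N - 2) / 2) * V\<^sup>2 - (real N / 2 - a) * U\<^sup>2) < 0"
    proof -
      have "(a - (real N - 2) / 2) * V\<^sup>2 \<le> 0" using a by (intro mult_nonpos_nonneg) auto
      moreover have "0 < (real N / 2 - a) * U\<^sup>2" using a that by (intro mult_pos_pos) (auto simp: U_def)
      ultimately show ?thesis using \<open>0 < s\<close> by (intro mult_pos_neg) auto
    qed
    ultimately show ?thesis by metis
  qed
  \<comment> \<open>\<open>E 0 = well \<gamma>\<close> because \<open>v 0 = 0\<close>, and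
    \<open>E\<close> decreases. As the well increases beyond 1, this caps \<open>u\<close> at
    \<open>\<gamma>\<close>.\<close>
  have well_le: "well (u t) \<le> well \<gamma>" if "0 \<le> t" "\<And>s. 0 \<le> s \<Longrightarrow> s \<le> t \<Longrightarrow> 0 \<le> u s"
    "\<And>s. 0 < s \<Longrightarrow> s < t \<Longrightarrow> 0 < u s \<and> u s \<le> \<gamma> + 1" for t
  proof -
    have "E t \<le> E 0"
    proof (cases "t = 0")
      case False
      then have "0 < t" using that by simp
      show ?thesis
      proof (rule DERIV_nonpos_imp_decreasing_open[OF that(1)])
        fix s assume s: "0 < s" "s < t"
        have "- (real N - 1) / s * (v s)\<^sup>2 \<le> 0" using s N3 by (intro mult_nonpos_nonneg) (auto simp: divide_nonpos_pos)
        then show "\<exists>l. (E has_real_derivative l) (at s) \<and> l \<le> 0" using dE[of s] that(3)[OF s] s by blast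
      qed (rule cE[OF that(2)])
    qed simp
    then have "(v t)\<^sup>2 / 2 + well (u t) \<le> well \<gamma>" by (simp add: E_def uv(1,2))
    then show ?thesis using zero_le_power2[of "v t"] by linarith
  qed
  have in_range: "0 < u s \<and> u s < \<gamma> + 1" if "0 \<le> s" for s
  proof (rule ccontr)
    assume neg: "\<not> ?thesis"
    define Bad where "Bad = {s \<in> {0..}. u s \<le> 0} \<union> {s \<in> {0..}. \<gamma> + 1 \<le> u s}"
    have "closed Bad" unfolding Bad_def
      using continuous_closed_preimage[OF uv(3), of "{..0}"] continuous_closed_preimage[OF uv(3), of "{\<gamma> + 1..}"]
      by (intro closed_Un) (auto simp: vimage_def Int_def)
    moreover have "Bad \<noteq> {}" using neg that by (force simp: Bad_def)
    moreover have "bdd_below Bad" by (rule bdd_belowI[of _ 0]) (auto simp: Bad_def)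
    ultimately have SB: "Inf Bad \<in> Bad" by (intro closed_contains_Inf)
    define S where "S = Inf Bad"
    have SB': "0 \<le> S" "u S \<le> 0 \<or> \<gamma> + 1 \<le> u S" using SB unfolding S_def[symmetric] by (auto simp: Bad_def)
    have "S \<noteq> 0" using SB'(2) \<gamma> uv(1) by auto
    then have S0: "0 < S" using SB'(1) by simp
    have before: "0 < u x \<and> u x < \<gamma> + 1" if "0 \<le> x" "x < S" for x
    proof -
      have "x \<notin> Bad" using that cInf_lower[OF _ \<open>bdd_below Bad\<close>, of x] unfolding S_def by force
      then show ?thesis using that by (auto simp: Bad_def)
    qed
    have uS: "0 \<le> u S"
    proof (rule tendsto_lowerbound)
      have "continuous (at S) u" using DERIV_isCont[OF du[OF S0]] .
      then show "(u \<longlongrightarrow> u S) (at_left S)" by (simp add: continuous_at filterlim_at_split)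
      show "\<forall>\<^sub>F x in at_left S. 0 \<le> u x"
        using eventually_at_left_real[OF S0] by eventually_elim (use before in \<open>auto intro: less_imp_le\<close>)
    qed simp
    have nonneg: "0 \<le> u x" if "0 \<le> x" "x \<le> S" for x using before[of x] uS that by (cases "x = S") auto
    show False
    proof (cases "u S \<le> 0")
      case False
      then have "\<gamma> + 1 \<le> u S" using SB' by simp
      then have "well \<gamma> < well (u S)" using \<gamma> by (intro well_strict_increasing) auto
      moreover have "well (u S) \<le> well \<gamma>" using S0 nonneg before by (intro well_le) (auto intro: less_imp_le)
      ultimately show False by simp
    next
      case True
      then have "u S = 0" using uS by simp
      have "P S < P 0"
      proof (rule DERIV_neg_imp_decreasing_open[OF S0])
        show "\<exists>l. (P has_real_derivative l) (at x) \<and> l < 0" if "0 < x" "x < S" for x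
          using dP[of x] before[of x] that by auto
      qed (rule cP[OF nonneg])
      moreover have "P 0 = 0" using N3 uv(2) by (simp add: P_def)
      \<comment> \<open>At a zero of \<open>u\<close> only the kinetic part of \<open>P\<close> is
        left.\<close>
      moreover have "0 \<le> P S" using S0 \<open>u S = 0\<close> p_gt_1 by (simp add: P_def E_def well_def)
      ultimately show False by simp
    qed
  qed
  have "u s \<le> \<gamma>" if "0 \<le> s" for s
  proof (rule ccontr)
    assume "\<not> u s \<le> \<gamma>"
    then have "well \<gamma> < well (u s)" using \<gamma> by (intro well_strict_increasing) auto
    moreover have "well (u s) \<le> well \<gamma>" using that in_range by (intro well_le) (auto intro: less_imp_le)
    ultimately show False by simp
  qed
  moreover have "(v has_real_derivative - (real N - 1) / s * v s - fnl p (u s)) (at s)" if "0 < s" for s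
  proof -
    have "h (u s) = fnl p (u s)" using good in_range[of s] that by (simp add: fnl_def)
    moreover have "real (N - 1) = real N - 1" using N3 by simp
    ultimately show ?thesis using dv[OF that] by simp
  qed
  ultimately have "regular \<gamma> u v" unfolding regular_def using uv du in_range by simp
  then show ?thesis by (rule that)
qed

section \<open>Uniqueness at the singular point and the meaning of \<open>lambda_n\<close>\<close>

lemma regular_radial_sol:
  assumes r: "regular \<gamma> u v" and "0 < T" "0 < \<gamma>"
  shows "radial_sol N p \<gamma> u T"
  unfolding radial_sol_def
proof (intro conjI ballI exI[of _ v])
  show "0 < u s" if "s \<in> {0..<T}" for s
  proof (cases "s = 0")
    case True
    then show ?thesis using r \<open>0 < \<gamma>\<close> unfolding regular_def by simp
  next
    case False
    then have "0 < s" using that by simp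
    then show ?thesis using r unfolding regular_def by blast
  qed
  show "continuous_on {0..<T} u"
  proof (rule continuous_on_subset)
    show "continuous_on {0..} u" using r unfolding regular_def by blast
  qed auto
  show "(u has_real_derivative 0) (at 0 within {0..<T})"
  proof (rule has_field_derivative_subset)
    show "(u has_real_derivative 0) (at 0 within {0..})" using r unfolding regular_def by blast
  qed auto
  show "u 0 = \<gamma>" using r unfolding regular_def by blast
  show "(u has_real_derivative v s) (at s)"
    "(v has_real_derivative - (real N - 1) / s * v s - fnl p (u s)) (at s)" if "s \<in> {0<..<T}" for s
    using r that unfolding regular_def greaterThanLessThan_iff by blast+
qed (rule \<open>0 < T\<close>)

text \<open>\<open>radial_sol\<close> gives a one-sided derivative of \<open>u\<close> at 0 but says
  nothing about \<open>v\<close> near 0. Still, the flux \<open>s ^ (N - 1) * v s\<close> is small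
  at points arbitrarily close to 0, and its derivative is at most \<open>H * s ^ (N - 1)\<close> in
  size; integration gives the bound.\<close>

lemma radial_derivative_bound:
  assumes cont: "continuous_on {0..<T} u" and pos: "\<And>s. 0 \<le> s \<Longrightarrow> s < T \<Longrightarrow> 0 < u s"
    and d0: "(u has_real_derivative 0) (at 0 within {0..<T})"
    and du: "\<And>s. 0 < s \<Longrightarrow> s < T \<Longrightarrow> (u has_real_derivative v s) (at s)"
    and dv: "\<And>s. 0 < s \<Longrightarrow> s < T \<Longrightarrow> (v has_real_derivative - (real N - 1) / s * v s - fnl p (u s)) (at s)"
    and S: "0 < S" "S < T"
  obtains H where "0 \<le> H" "\<And>s. 0 < s \<Longrightarrow> s \<le> S \<Longrightarrow> \<bar>v s\<bar> \<le> H * s"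
proof -
  have cS: "continuous_on {0..S} u" using S by (intro continuous_on_subset[OF cont]) auto
  have posS: "0 < u s" if "s \<in> {0..S}" for s using pos[of s] that S by auto
  have "continuous_on {0..S} (\<lambda>s. \<bar>fnl p (u s)\<bar>)"
    unfolding fnl_def using posS p_gt_1
    by (intro continuous_intros cS continuous_on_powr') (auto intro: less_imp_le)
  then obtain s0 where s0: "\<And>s. s \<in> {0..S} \<Longrightarrow> \<bar>fnl p (u s)\<bar> \<le> \<bar>fnl p (u s0)\<bar>"
    using continuous_attains_sup[of "{0..S}" "\<lambda>s. \<bar>fnl p (u s)\<bar>"] S(1) by (metis atLeastAtMost_iff compact_Icc empty_iff less_imp_le order.refl)
  define H where "H = \<bar>fnl p (u s0)\<bar>"
  have H: "0 \<le> H" "\<And>s. 0 \<le> s \<Longrightarrow> s \<le> S \<Longrightarrow> \<bar>fnl p (u s)\<bar> \<le> H" using s0 by (auto simp: H_def)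
  define g where "g s = s ^ (N - 1) * v s" for s
  have dg: "(g has_real_derivative - (s ^ (N - 1)) * fnl p (u s)) (at s)" if "0 < s" "s \<le> S" for s
    unfolding g_def using dv[of s] that S by (intro flux_deriv) (auto simp only: N_minus_1)
  have dpow: "((\<lambda>s. c * s ^ N / real N) has_real_derivative c * s ^ (N - 1)) (at s)" for c s :: real
    by (rule DERIV_cong[OF DERIV_cdivide[OF DERIV_cmult[OF DERIV_pow]]]) (use N3 in auto)
  have near: "\<bar>g s\<bar> \<le> \<bar>g r\<bar> + H * s ^ N / real N" if r: "0 < r" "r \<le> s" "s \<le> S" for r s
  proof -
    have b: "\<bar>x ^ (N - 1) * fnl p (u x)\<bar> \<le> H * x ^ (N - 1)" if "r \<le> x" "x \<le> s" for x
      using mult_left_mono[OF H(2)[of x], of "x ^ (N - 1)"] that r by (simp add: abs_mult mult.commute)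
    have "g r + H * r ^ N / real N \<le> g s + H * s ^ N / real N"
    proof (rule DERIV_nonneg_imp_nondecreasing[OF r(2)])
      fix x assume x: "r \<le> x" "x \<le> s"
      show "\<exists>y. ((\<lambda>s. g s + H * s ^ N / real N) has_real_derivative y) (at x) \<and> 0 \<le> y"
        using DERIV_add[OF dg[of x] dpow[of H x]] b[OF x] x r
        by (intro exI[of _ "- (x ^ (N - 1)) * fnl p (u x) + H * x ^ (N - 1)"]) (auto simp: abs_le_iff)
    qed
    moreover have "g s - H * s ^ N / real N \<le> g r - H * r ^ N / real N"
    proof (rule DERIV_nonpos_imp_nonincreasing[OF r(2)])
      fix x assume x: "r \<le> x" "x \<le> s"
      show "\<exists>y. ((\<lambda>s. g s - H * s ^ N / real N) has_real_derivative y) (at x) \<and> y \<le> 0"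
        using DERIV_diff[OF dg[of x] dpow[of H x]] b[OF x] x r
        by (intro exI[of _ "- (x ^ (N - 1)) * fnl p (u x) - H * x ^ (N - 1)"]) (auto simp: abs_le_iff)
    qed
    moreover have "0 \<le> H * r ^ N / real N" using H(1) r by simp
    ultimately show ?thesis by linarith
  qed
  \<comment> \<open>Small difference quotients at 0 yield, by the mean value theorem, points
    \<open>z\<close> near 0 with \<open>\<bar>v z\<bar> < 1\<close>; the factor
    \<open>z ^ (N - 1)\<close> makes the flux small there.\<close>
  have small: "\<exists>r. 0 < r \<and> r < \<delta> \<and> \<bar>g r\<bar> \<le> \<delta>" if \<delta>: "0 < \<delta>" "\<delta> \<le> 1" "\<delta> \<le> S" for \<delta>
  proof -
    have "((\<lambda>x. (u x - u 0) / (x - 0)) \<longlongrightarrow> 0) (at 0 within {0..<T})"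
      using d0 by (simp add: has_field_derivative_iff)
    then have "\<forall>\<^sub>F x in at 0 within {0..<T}. \<bar>(u x - u 0) / (x - 0)\<bar> < 1"
      using tendstoD[of _ 0 _ 1] by (force simp: dist_real_def)
    then obtain d where d: "0 < d" "\<And>x. x \<in> {0..<T} \<Longrightarrow> x \<noteq> 0 \<Longrightarrow> dist x 0 < d \<Longrightarrow> \<bar>(u x - u 0) / (x - 0)\<bar> < 1"
      unfolding eventually_at by blast
    define x where "x = min d \<delta> / 2"
    have x: "0 < x" "x < d" "x < \<delta>" using d(1) \<delta>(1) by (auto simp: x_def)
    have cx: "continuous_on {0..x} u" using x \<delta> by (intro continuous_on_subset[OF cS]) auto
    have "\<exists>l z. 0 < z \<and> z < x \<and> DERIV u z :> l \<and> u x - u 0 = (x - 0) * l"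
      by (rule MVT[OF x(1) cx]) (use du x \<delta> S in \<open>force simp: real_differentiable_def\<close>)
    then obtain l z where z: "0 < z" "z < x" "DERIV u z :> l" "u x - u 0 = x * l" by auto
    have "l = v z" using DERIV_unique[OF z(3) du[of z]] z x \<delta> S by simp
    then have "\<bar>v z\<bar> < 1" using d(2)[of x] x \<delta> S z(4) by (auto simp: abs_mult)
    moreover have "\<bar>z ^ (N - 1)\<bar> \<le> z"
    proof -
      have "z ^ (N - 1) \<le> z ^ 1" using z x \<delta> N3 by (intro power_decreasing) auto
      then show ?thesis using z by simp
    qed
    ultimately have "\<bar>g z\<bar> \<le> z * 1" unfolding g_def abs_mult using z(1) by (intro mult_mono) auto
    then show ?thesis using z x by (intro exI[of _ z]) auto
  qed
  show ?thesis
  proof (rule that[OF H(1)])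
    fix s assume s: "0 < s" "s \<le> S"
    have "\<bar>g s\<bar> \<le> H * s ^ N / real N + e" if e: "0 < e" for e
    proof -
      have "0 < min e (min 1 s)" "min e (min 1 s) \<le> 1" "min e (min 1 s) \<le> S" using e s by auto
      from small[OF this] obtain r where "0 < r" "r < min e (min 1 s)" "\<bar>g r\<bar> \<le> min e (min 1 s)" by blast
      then show ?thesis using near[of r s] s by auto
    qed
    then have "\<bar>g s\<bar> \<le> H * s ^ N / real N" by (rule field_le_epsilon)
    also have "\<dots> \<le> H * s ^ N / 1" using H(1) s N3 by (intro divide_left_mono) auto
    finally have "s ^ (N - 1) * \<bar>v s\<bar> \<le> s ^ (N - 1) * (H * s)"
      using s(1) by (simp add: g_def abs_mult power_N mult_ac)
    then show "\<bar>v s\<bar> \<le> H * s" using s(1) by (simp only: mult_le_cancel_left_pos zero_less_power)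
  qed
qed

text \<open>The coefficient \<open>(N - 1) / s\<close> blows up at 0, but as damping it does not
  enter the Gronwall constant. So the estimate is started at \<open>r > 0\<close> and
  \<open>r\<close> is sent to 0, where the initial distance vanishes by
  \<open>radial_derivative_bound\<close>.\<close>

lemma radial_sol_unique:
  assumes u1: "radial_sol N p \<gamma> u1 T1" and u2: "radial_sol N p \<gamma> u2 T2" and S: "0 \<le> S" "S < T1" "S < T2"
  shows "u1 S = u2 S"
proof (cases "S = 0")
  case True
  then show ?thesis using u1 u2 by (simp add: radial_sol_def)
next
  case False
  then have S0: "0 < S" using S by simp
  obtain v1 where v1: "\<And>s. 0 < s \<Longrightarrow> s < T1 \<Longrightarrow> (u1 has_real_derivative v1 s) (at s)"
    "\<And>s. 0 < s \<Longrightarrow> s < T1 \<Longrightarrow> (v1 has_real_derivative - (real N - 1) / s * v1 s - fnl p (u1 s)) (at s)"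
    using u1 unfolding radial_sol_def by (metis greaterThanLessThan_iff)
  obtain v2 where v2: "\<And>s. 0 < s \<Longrightarrow> s < T2 \<Longrightarrow> (u2 has_real_derivative v2 s) (at s)"
    "\<And>s. 0 < s \<Longrightarrow> s < T2 \<Longrightarrow> (v2 has_real_derivative - (real N - 1) / s * v2 s - fnl p (u2 s)) (at s)"
    using u2 unfolding radial_sol_def by (metis greaterThanLessThan_iff)
  have c: "continuous_on {0..<T1} u1" "continuous_on {0..<T2} u2"
    and pos: "\<And>s. 0 \<le> s \<Longrightarrow> s < T1 \<Longrightarrow> 0 < u1 s" "\<And>s. 0 \<le> s \<Longrightarrow> s < T2 \<Longrightarrow> 0 < u2 s"
    and d0: "(u1 has_real_derivative 0) (at 0 within {0..<T1})" "(u2 has_real_derivative 0) (at 0 within {0..<T2})"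
    and i0: "u1 0 = u2 0"
    using u1 u2 by (auto simp: radial_sol_def)
  obtain H1 where H1: "0 \<le> H1" "\<And>s. 0 < s \<Longrightarrow> s \<le> S \<Longrightarrow> \<bar>v1 s\<bar> \<le> H1 * s"
    using radial_derivative_bound[OF c(1) pos(1) d0(1) v1 S0 S(2)] by blast
  obtain H2 where H2: "0 \<le> H2" "\<And>s. 0 < s \<Longrightarrow> s \<le> S \<Longrightarrow> \<bar>v2 s\<bar> \<le> H2 * s"
    using radial_derivative_bound[OF c(2) pos(2) d0(2) v2 S0 S(3)] by blast
  have cS: "continuous_on {0..S} u1" "continuous_on {0..S} u2" using S c by (auto intro: continuous_on_subset)
  obtain B1 where B1: "\<And>s. s \<in> {0..S} \<Longrightarrow> u1 s \<le> B1"
    using continuous_attains_sup[OF _ _ cS(1)] S(1) by fastforce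
  obtain B2 where B2: "\<And>s. s \<in> {0..S} \<Longrightarrow> u2 s \<le> B2"
    using continuous_attains_sup[OF _ _ cS(2)] S(1) by fastforce
  define B where "B = max B1 B2"
  define C where "C = 1 + p * B powr (p - 1)"
  have C: "0 \<le> C" using p_gt_1 by (simp add: C_def)
  define W where "W r = (u1 r - u2 r)\<^sup>2 + (v1 r - v2 r)\<^sup>2" for r
  have W: "W S \<le> W r * exp ((1 + C) * S)" if r: "0 < r" "r \<le> S" for r
  proof -
    have "W S \<le> W r * exp ((1 + C) * (S - r))" unfolding W_def
    proof (rule gronwall_damped[where k = "\<lambda>s. (real N - 1) / s" and q = "\<lambda>s. - (fnl p (u1 s) - fnl p (u2 s))", OF r(2) C])
      fix s assume s: "s \<in> {r..S}"
      show "((\<lambda>s. u1 s - u2 s) has_real_derivative v1 s - v2 s) (at s)"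
        using s r S by (intro DERIV_diff v1 v2) auto
      show "((\<lambda>s. v1 s - v2 s) has_real_derivative - ((real N - 1) / s) * (v1 s - v2 s) + - (fnl p (u1 s) - fnl p (u2 s))) (at s)"
        using s r S by (intro DERIV_cong[OF DERIV_diff[OF v1(2) v2(2)]]) (auto simp: algebra_simps diff_divide_distrib)
      show "0 \<le> (real N - 1) / s" using s r N3 by simp
      have "0 \<le> u1 s" "u1 s \<le> B" "0 \<le> u2 s" "u2 s \<le> B"
        using B1[of s] B2[of s] pos(1)[of s] pos(2)[of s] s r S by (auto simp: B_def)
      then have "\<bar>u1 s powr p - u2 s powr p\<bar> \<le> p * B powr (p - 1) * \<bar>u1 s - u2 s\<bar>" by (intro powr_diff_le p_gt_1)
      moreover have "- (fnl p (u1 s) - fnl p (u2 s)) = (u1 s - u2 s) - (u1 s powr p - u2 s powr p)" by (simp add: fnl_def)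
      ultimately have "\<bar>- (fnl p (u1 s) - fnl p (u2 s))\<bar> \<le> \<bar>u1 s - u2 s\<bar> + p * B powr (p - 1) * \<bar>u1 s - u2 s\<bar>"
        by (metis abs_triangle_ineq4 add_left_mono order.trans)
      then show "\<bar>- (fnl p (u1 s) - fnl p (u2 s))\<bar> \<le> C * \<bar>u1 s - u2 s\<bar>" by (simp add: C_def algebra_simps)
    qed
    also have "\<dots> \<le> W r * exp ((1 + C) * S)"
      using C r by (intro mult_left_mono) (auto simp: W_def intro!: mult_left_mono)
    finally show ?thesis .
  qed
  have "((\<lambda>r. (u1 r - u2 r)\<^sup>2 + ((H1 + H2) * r)\<^sup>2) \<longlongrightarrow> (u1 0 - u2 0)\<^sup>2 + ((H1 + H2) * 0)\<^sup>2) (at_right 0)"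
  proof -
    have "(u1 \<longlongrightarrow> u1 0) (at 0 within {0..S})" "(u2 \<longlongrightarrow> u2 0) (at 0 within {0..S})"
      using cS S0 by (auto simp: continuous_on_def)
    then have "(u1 \<longlongrightarrow> u1 0) (at_right 0)" "(u2 \<longlongrightarrow> u2 0) (at_right 0)"
      using S0 by (simp_all add: at_within_Icc_at_right)
    then show ?thesis by (intro tendsto_intros)
  qed
  then have "((\<lambda>r. ((u1 r - u2 r)\<^sup>2 + ((H1 + H2) * r)\<^sup>2) * exp ((1 + C) * S)) \<longlongrightarrow> 0 * exp ((1 + C) * S)) (at_right 0)"
    unfolding i0 by (intro tendsto_mult tendsto_const) simp
  moreover have "\<forall>\<^sub>F r in at_right 0. W S \<le> ((u1 r - u2 r)\<^sup>2 + ((H1 + H2) * r)\<^sup>2) * exp ((1 + C) * S)"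
    using eventually_at_right_real[OF S0]
  proof eventually_elim
    case (elim r)
    then have r: "0 < r" "r \<le> S" by auto
    have "\<bar>v1 r - v2 r\<bar> \<le> \<bar>v1 r\<bar> + \<bar>v2 r\<bar>" by (rule abs_triangle_ineq4)
    also have "\<dots> \<le> (H1 + H2) * r" using H1(2)[OF r] H2(2)[OF r] by (simp add: algebra_simps)
    finally have "(v1 r - v2 r)\<^sup>2 \<le> ((H1 + H2) * r)\<^sup>2"
      using power_mono[of "\<bar>v1 r - v2 r\<bar>" "(H1 + H2) * r" 2] by simp
    then have "W r * exp ((1 + C) * S) \<le> ((u1 r - u2 r)\<^sup>2 + ((H1 + H2) * r)\<^sup>2) * exp ((1 + C) * S)"
      by (intro mult_right_mono) (auto simp: W_def)
    then show ?case using W[OF r] by linarith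
  qed
  ultimately have "W S \<le> 0 * exp ((1 + C) * S)"
    by (intro tendsto_lowerbound[of _ _ "at_right (0::real)"]) auto
  then show ?thesis by (simp add: W_def sum_power2_le_zero_iff)
qed

end

text \<open>The larger of two candidates would have below it the smaller one together with its
  \<open>n - 1\<close> predecessors.\<close>

lemma nth_pos_crit_unique:
  assumes "nth_pos_crit u n s" "nth_pos_crit u n s'" "1 \<le> n"
  shows "s = s'"
proof -
  have "\<not> a < b" if a: "nth_pos_crit u n a" and b: "nth_pos_crit u n b" for a b
  proof
    assume "a < b"
    define A where "A = {t. 0 < t \<and> t < a \<and> crit u t}"
    have fin: "finite {t. 0 < t \<and> t < b \<and> crit u t}" using b by (simp add: nth_pos_crit_def)
    have "insert a A \<subseteq> {t. 0 < t \<and> t < b \<and> crit u t}"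
      using a \<open>a < b\<close> by (auto simp: A_def nth_pos_crit_def)
    from card_mono[OF fin this] have "card (insert a A) \<le> n - 1" using b by (simp add: nth_pos_crit_def)
    moreover have "finite A" "card A = n - 1" "a \<notin> A" using a by (auto simp: nth_pos_crit_def A_def)
    ultimately show False by simp
  qed
  from this[of s s'] this[of s' s] show ?thesis using assms by simp
qed

lemma nth_pos_crit_cong:
  assumes eq: "\<And>t. 0 < t \<Longrightarrow> t < T \<Longrightarrow> u t = w t" and "s < T" and "nth_pos_crit u n s"
  shows "nth_pos_crit w n s"
proof -
  have imp: "crit w t" if "crit u t" "0 < t" "t < T" "\<And>t. 0 < t \<Longrightarrow> t < T \<Longrightarrow> u t = w t" for t u w
    using that unfolding crit_def
    by (intro has_field_derivative_transform_within_open[of u 0 t "{0<..<T}" w]) auto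
  have "crit u t \<longleftrightarrow> crit w t" if "0 < t" "t < T" for t
    using imp[of u t w] imp[of w t u] eq that by auto
  then have "{t. 0 < t \<and> t < s \<and> crit u t} = {t. 0 < t \<and> t < s \<and> crit w t}" using assms(2) by auto
  then show ?thesis using assms imp[of u s w] unfolding nth_pos_crit_def by auto
qed

text \<open>The description ranges over all solutions on all intervals \<open>{0..<T}\<close>;
  uniqueness at the singular point reduces it to the one global solution.\<close>

lemma (in supercritical) lambda_n_eq:
  assumes r: "regular \<gamma> u v" and \<gamma>: "0 < \<gamma>" and n: "1 \<le> n" and s: "nth_pos_crit u n s"
  shows "lambda_n N p n \<gamma> = s\<^sup>2"
proof -
  have s0: "0 < s" using s by (simp add: nth_pos_crit_def)
  have "(THE s. \<exists>u T. radial_sol N p \<gamma> u T \<and> s < T \<and> nth_pos_crit u n s) = s"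
  proof (rule the_equality)
    show "\<exists>u T. radial_sol N p \<gamma> u T \<and> s < T \<and> nth_pos_crit u n s"
      using regular_radial_sol[OF r _ \<gamma>, of "s + 1"] s s0 by (intro exI[of _ u] exI[of _ "s + 1"]) auto
    fix s' assume "\<exists>u T. radial_sol N p \<gamma> u T \<and> s' < T \<and> nth_pos_crit u n s'"
    then obtain w T where w: "radial_sol N p \<gamma> w T" "s' < T" "nth_pos_crit w n s'" by blast
    have T: "0 < T" using w(1) by (simp add: radial_sol_def)
    have "nth_pos_crit u n s'"
      using radial_sol_unique[OF w(1) regular_radial_sol[OF r T \<gamma>]] w
      by (intro nth_pos_crit_cong[of T w u]) auto
    then show "s' = s" using nth_pos_crit_unique s n by blast
  qed
  then show ?thesis by (simp add: lambda_n_def)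
qed

section \<open>Regular solutions in Emden variables\<close>

context supercritical begin

definition emden_y :: "(real \<Rightarrow> real) \<Rightarrow> real \<Rightarrow> real" where
  "emden_y u t = exp (m * \<theta> * t) * u (exp (m * t)) / A"

definition emden_z :: "(real \<Rightarrow> real) \<Rightarrow> (real \<Rightarrow> real) \<Rightarrow> real \<Rightarrow> real" where
  "emden_z u v t = m * exp (m * \<theta> * t) * (\<theta> * u (exp (m * t)) + exp (m * t) * v (exp (m * t))) / A"

lemma regularD:
  assumes "regular \<gamma> u v" "0 < s"
  shows "0 < u s" "u s \<le> \<gamma>" "(u has_real_derivative v s) (at s)"
    "(v has_real_derivative - (real N - 1) / s * v s - fnl p (u s)) (at s)"
  using assms unfolding regular_def by blast+

lemma emden_y_powr:
  assumes "0 < u (exp (m * t))"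
  shows "emden_y u t powr p = m\<^sup>2 * exp (2 * m * t) * (exp (m * \<theta> * t) * u (exp (m * t)) powr p / A)"
proof -
  have "exp (m * \<theta> * t) powr p = exp (p * (m * \<theta> * t))" by (simp add: powr_def)
  also have "p * (m * \<theta> * t) = m * t * (\<theta> * p)" by simp
  also have "\<dots> = m * \<theta> * t + 2 * m * t" unfolding theta_p by (simp add: algebra_simps)
  finally have e: "exp (m * \<theta> * t) powr p = exp (m * \<theta> * t) * exp (2 * m * t)" by (simp add: exp_add)
  have "A powr p = A / m\<^sup>2" using A_powr_p m_pos by (simp add: field_simps)
  then show ?thesis using assms A_pos unfolding emden_y_def by (simp add: powr_divide powr_mult e)
qed

lemma regular_emden:
  assumes r: "regular \<gamma> u v"
  shows "emden (emden_y u) (emden_z u v)"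
  unfolding emden_def
proof (intro allI conjI)
  fix t
  define s where "s = exp (m * t)"
  define e where "e = exp (m * \<theta> * t)"
  have s: "0 < s" by (simp add: s_def)
  have u: "0 < u s" using regularD(1)[OF r s] .
  show "0 < emden_y u t" using u A_pos by (simp add: emden_y_def s_def)
  have ds: "((\<lambda>t. exp (m * t)) has_real_derivative m * s) (at t)"
    unfolding s_def by (auto intro!: derivative_eq_intros)
  have de: "((\<lambda>t. exp (m * \<theta> * t)) has_real_derivative m * \<theta> * e) (at t)"
    unfolding e_def by (auto intro!: derivative_eq_intros)
  have du: "((\<lambda>t. u (exp (m * t))) has_real_derivative v s * (m * s)) (at t)"
    using DERIV_chain2[OF regularD(3)[OF r s, unfolded s_def] ds] by (simp add: s_def)
  have dv: "((\<lambda>t. v (exp (m * t))) has_real_derivative (- (real N - 1) / s * v s - fnl p (u s)) * (m * s)) (at t)"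
    using DERIV_chain2[OF regularD(4)[OF r s, unfolded s_def] ds] by (simp add: s_def)
  have "(emden_y u has_real_derivative (m * \<theta> * e * u s + v s * (m * s) * e) / A) (at t)"
    unfolding emden_y_def using DERIV_cdivide[OF DERIV_mult[OF de du], of A] by (simp add: s_def e_def)
  then show "(emden_y u has_real_derivative emden_z u v t) (at t)"
    by (simp add: emden_z_def s_def e_def algebra_simps)
  have "(emden_z u v has_real_derivative
    (m * (m * \<theta> * e) * (\<theta> * u s + s * v s)
      + (\<theta> * (v s * (m * s)) + (m * s * v s + (- (real N - 1) / s * v s - fnl p (u s)) * (m * s) * s)) * (m * e)) / A) (at t)"
    unfolding emden_z_def
    using DERIV_cdivide[OF DERIV_mult[OF DERIV_cmult[OF de, of m] DERIV_add[OF DERIV_cmult[OF du, of \<theta>] DERIV_mult[OF ds dv]]], of A]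
    by (simp add: s_def e_def)
  moreover have "(m * (m * \<theta> * e) * (\<theta> * u s + s * v s)
      + (\<theta> * (v s * (m * s)) + (m * s * v s + (- (real N - 1) / s * v s - fnl p (u s)) * (m * s) * s)) * (m * e)) / A
      = rhs t (emden_y u t) (emden_z u v t)"
  proof -
    have exp2: "exp (2 * m * t) = s\<^sup>2" by (simp add: s_def mult.assoc exp_double)
    have yp: "emden_y u t powr p = m\<^sup>2 * s\<^sup>2 * (e * u s powr p / A)"
      using emden_y_powr[of u t] u by (simp add: s_def[symmetric] e_def[symmetric] exp2)
    have y: "emden_y u t = e * u s / A" by (simp add: emden_y_def s_def e_def)
    have z: "emden_z u v t = m * e * (\<theta> * u s + s * v s) / A" by (simp add: emden_z_def s_def e_def)
    have one: "m\<^sup>2 * (\<theta> * (real N - 2 - \<theta>)) = 1" using m_sq by (simp add: \<kappa>_def)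
    \<comment> \<open>The chain rule puts the coefficient \<open>m\<^sup>2 * \<kappa>\<close> in
      front of \<open>y\<close>; the hypothesis \<open>one\<close> turns it into 1.\<close>
    have *: "(M * (M * T * e) * (T * U + s * V)
      + (T * (V * (M * s)) + (M * s * V + (- (n - 1) / s * V - (- U + W)) * (M * s) * s)) * (M * e))
      = - (M * (n - 2 - 2 * T)) * (M * e * (T * U + s * V)) + e * U - M\<^sup>2 * s\<^sup>2 * (e * W) + M\<^sup>2 * s\<^sup>2 * (e * U)"
      if one: "M\<^sup>2 * (T * (n - 2 - T)) = 1" for M T U V W n :: real
    proof -
      have "(- (n - 1) / s * V - (- U + W)) * (M * s) * s = M * (- (n - 1) * V * s + (U - W) * s\<^sup>2)"
        using s by (simp add: field_simps power2_eq_square)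
      then have "(M * (M * T * e) * (T * U + s * V)
        + (T * (V * (M * s)) + (M * s * V + (- (n - 1) / s * V - (- U + W)) * (M * s) * s)) * (M * e))
        = - (M * (n - 2 - 2 * T)) * (M * e * (T * U + s * V)) + e * U * (M\<^sup>2 * (T * (n - 2 - T))) - M\<^sup>2 * s\<^sup>2 * (e * W) + M\<^sup>2 * s\<^sup>2 * (e * U)"
        by (simp only:) (simp add: algebra_simps power2_eq_square)
      then show ?thesis unfolding one by simp
    qed
    show ?thesis
      unfolding *[OF one] fnl_def rhs_def y z yp[unfolded y] alphaconst_def
      by (simp add: exp2 diff_divide_distrib add_divide_distrib)
  qed
  ultimately show "(emden_z u v has_real_derivative rhs t (emden_y u t) (emden_z u v t)) (at t)" by simp
qed

lemma exp_mult_at_bot: "0 < c \<Longrightarrow> ((\<lambda>t. exp (c * t)) \<longlongrightarrow> 0) at_bot" for c :: real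
  by (rule filterlim_compose[OF exp_at_bot])
     (intro filterlim_tendsto_pos_mult_at_bot[OF tendsto_const] filterlim_ident)

text \<open>At minus infinity \<open>u\<close> and \<open>v\<close> stay bounded, and the factor
  \<open>exp (m * \<theta> * t)\<close> sends \<open>y\<close> and \<open>z\<close> to 0. The energy
  therefore starts at 0 and decreases.\<close>

lemma regular_orbit:
  assumes r: "regular \<gamma> u v"
  shows "orbit (emden_y u) (emden_z u v)"
proof -
  let ?y = "emden_y u" and ?z = "emden_z u v"
  have em: "emden ?y ?z" by (rule regular_emden[OF r])
  have e0: "((\<lambda>t. exp (m * t)) \<longlongrightarrow> 0) at_bot" using exp_mult_at_bot m_pos by blast
  then have fl: "filterlim (\<lambda>t. exp (m * t)) (at 0 within {0..}) at_bot"
    by (auto simp: filterlim_at)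
  have "(u \<longlongrightarrow> u 0) (at 0 within {0..})" "(v \<longlongrightarrow> v 0) (at 0 within {0..})"
  proof -
    have "continuous_on {0..} u" "continuous_on {0..} v" using r unfolding regular_def by blast+
    then show "(u \<longlongrightarrow> u 0) (at 0 within {0..})" "(v \<longlongrightarrow> v 0) (at 0 within {0..})"
      unfolding continuous_on_def by simp_all
  qed
  then have uv: "((\<lambda>t. u (exp (m * t))) \<longlongrightarrow> u 0) at_bot" "((\<lambda>t. v (exp (m * t))) \<longlongrightarrow> v 0) at_bot"
    using filterlim_compose[OF _ fl] by blast+
  have e1: "((\<lambda>t. exp (m * \<theta> * t)) \<longlongrightarrow> 0) at_bot" using exp_mult_at_bot m_pos theta_pos by simp
  have y0: "(?y \<longlongrightarrow> 0) at_bot"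
    using tendsto_divide[OF tendsto_mult[OF e1 uv(1)] tendsto_const, of A] A_pos
    unfolding emden_y_def by simp
  have z0: "(?z \<longlongrightarrow> 0) at_bot"
    using tendsto_divide[OF tendsto_mult[OF tendsto_mult[OF tendsto_const[of m] e1]
        tendsto_add[OF tendsto_mult[OF tendsto_const[of \<theta>] uv(1)] tendsto_mult[OF e0 uv(2)]]] tendsto_const, of A] A_pos
    unfolding emden_z_def by simp
  have "((\<lambda>t. (?z t)\<^sup>2 / 2 + ?y t powr (p + 1) / (p + 1)) \<longlongrightarrow> 0\<^sup>2 / 2 + 0 powr (p + 1) / (p + 1)) at_bot"
    using p_gt_1 emdenD(1)[OF em]
    by (intro tendsto_intros y0 z0 tendsto_powr') (auto intro!: always_eventually less_imp_le)
  then have lim: "((\<lambda>t. (?z t)\<^sup>2 / 2 + ?y t powr (p + 1) / (p + 1)) \<longlongrightarrow> 0) at_bot" by simp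
  have "energy ?y ?z t \<le> 0" for t
  proof (rule tendsto_lowerbound[OF lim])
    show "\<forall>\<^sub>F s in at_bot. energy ?y ?z t \<le> (?z s)\<^sup>2 / 2 + ?y s powr (p + 1) / (p + 1)"
      using eventually_le_at_bot[of t]
    proof eventually_elim
      case (elim s)
      have "0 \<le> (?y s)\<^sup>2 * (1 + m\<^sup>2 * exp (2 * m * s))" by simp
      then show ?case using energy_antimono[OF em elim] unfolding energy_def[of _ _ s] by linarith
    qed
  qed simp
  then show ?thesis using em by (simp add: orbit_def)
qed

section \<open>Behaviour near the origin, uniformly in the initial value\<close>

lemma regular_lower:
  assumes r: "regular \<gamma> u v" and s: "0 < s"
  shows "- (\<gamma> powr p * s / real N) \<le> v s" "\<gamma> - \<gamma> powr p * s\<^sup>2 / (2 * real N) \<le> u s"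
proof -
  define g where "g s = s ^ (N - 1) * v s" for s
  have N0: "0 < real N" using N3 by simp
  have c: "continuous_on {0..x} u" "continuous_on {0..x} v" for x
  proof -
    have "continuous_on {0..} u" "continuous_on {0..} v" using r unfolding regular_def by blast+
    then show "continuous_on {0..x} u" "continuous_on {0..x} v" by (auto intro: continuous_on_subset)
  qed
  \<comment> \<open>\<open>u \<le> \<gamma>\<close> gives \<open>f(u) \<le> \<gamma> powr p\<close>,
    which is integrated in divergence form; a second integration bounds \<open>u\<close>.\<close>
  have vlow: "- (\<gamma> powr p * s / real N) \<le> v s" if s: "0 < s" for s
  proof -
    have "g 0 + \<gamma> powr p * 0 ^ N / real N \<le> g s + \<gamma> powr p * s ^ N / real N"
    proof (rule DERIV_nonneg_imp_increasing_open[where f = "\<lambda>s. g s + \<gamma> powr p * s ^ N / real N"])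
      show "continuous_on {0..s} (\<lambda>s. g s + \<gamma> powr p * s ^ N / real N)"
        unfolding g_def using N0 by (intro continuous_intros c) auto
      fix x assume x: "0 < x" "x < s"
      have "(g has_real_derivative - (x ^ (N - 1)) * fnl p (u x)) (at x)"
        unfolding g_def by (rule flux_deriv[OF x(1)]) (unfold N_minus_1, rule regularD(4)[OF r x(1)])
      moreover have "((\<lambda>s. \<gamma> powr p * s ^ N / real N) has_real_derivative \<gamma> powr p * x ^ (N - 1)) (at x)"
        by (rule DERIV_cong[OF DERIV_cdivide[OF DERIV_cmult[OF DERIV_pow]]]) (use N0 in auto)
      ultimately have "((\<lambda>s. g s + \<gamma> powr p * s ^ N / real N) has_real_derivative - (x ^ (N - 1)) * fnl p (u x) + \<gamma> powr p * x ^ (N - 1)) (at x)"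
        by (intro DERIV_add) auto
      moreover have "0 \<le> - (x ^ (N - 1)) * fnl p (u x) + \<gamma> powr p * x ^ (N - 1)"
      proof -
        have "u x powr p \<le> \<gamma> powr p" using regularD(1,2)[OF r x(1)] p_gt_1 by (intro powr_mono2) auto
        then have "fnl p (u x) \<le> \<gamma> powr p" using regularD(1)[OF r x(1)] by (simp add: fnl_def)
        then have "x ^ (N - 1) * fnl p (u x) \<le> x ^ (N - 1) * \<gamma> powr p" using x by (intro mult_left_mono) auto
        then show ?thesis by (simp add: mult.commute)
      qed
      ultimately show "\<exists>y. ((\<lambda>s. g s + \<gamma> powr p * s ^ N / real N) has_real_derivative y) (at x) \<and> 0 \<le> y" by blast
    qed (use s in simp)
    moreover have "g 0 + \<gamma> powr p * 0 ^ N / real N = 0" using N3 by (simp add: g_def power_0_left)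
    moreover note power_N[of s]
    ultimately have "0 \<le> s ^ (N - 1) * (v s + \<gamma> powr p * s / real N)"
      by (simp add: g_def algebra_simps)
    moreover have "0 < s ^ (N - 1)" using s by simp
    ultimately have "0 \<le> v s + \<gamma> powr p * s / real N" by (simp add: zero_le_mult_iff)
    then show ?thesis by simp
  qed
  show "- (\<gamma> powr p * s / real N) \<le> v s" by (rule vlow[OF s])
  have "u 0 + \<gamma> powr p * 0\<^sup>2 / (2 * real N) \<le> u s + \<gamma> powr p * s\<^sup>2 / (2 * real N)"
  proof (rule DERIV_nonneg_imp_increasing_open[where f = "\<lambda>s. u s + \<gamma> powr p * s\<^sup>2 / (2 * real N)"])
    show "continuous_on {0..s} (\<lambda>s. u s + \<gamma> powr p * s\<^sup>2 / (2 * real N))"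
      using N0 by (intro continuous_intros c) auto
    fix x assume x: "0 < x" "x < s"
    have "((\<lambda>s. \<gamma> powr p * s\<^sup>2 / (2 * real N)) has_real_derivative \<gamma> powr p * x / real N) (at x)"
      using N0 by (auto intro!: derivative_eq_intros simp: field_simps)
    then have "((\<lambda>s. u s + \<gamma> powr p * s\<^sup>2 / (2 * real N)) has_real_derivative v x + \<gamma> powr p * x / real N) (at x)"
      by (intro DERIV_add regularD(3)[OF r x(1)])
    then show "\<exists>y. ((\<lambda>s. u s + \<gamma> powr p * s\<^sup>2 / (2 * real N)) has_real_derivative y) (at x) \<and> 0 \<le> y"
      using vlow[OF x(1)] by (intro exI[of _ "v x + \<gamma> powr p * x / real N"]) auto
  qed (use s in simp)
  then show "\<gamma> - \<gamma> powr p * s\<^sup>2 / (2 * real N) \<le> u s" using r by (simp add: regular_def)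
qed

text \<open>On the scale marked by \<open>\<tau> \<gamma>\<close> the solution still has size
  \<gamma>, and \<open>y\<close> is of order 1 because \<open>\<theta> * (p - 1) = 2\<close>. During
  the last unit of time before \<open>\<tau> \<gamma>\<close> the speed is therefore at least a
  constant \<open>\<zeta>\<close>, and the damping costs \<open>\<alpha> * \<zeta>\<^sup>2\<close>
  whatever \<gamma> is.\<close>

lemma regular_energy_seed:
  obtains c \<tau> where "0 < c" "filterlim \<tau> at_bot at_top"
    "\<And>\<gamma> u v t. regular \<gamma> u v \<Longrightarrow> 0 < \<gamma> \<Longrightarrow> \<tau> \<gamma> \<le> t \<Longrightarrow> energy (emden_y u) (emden_z u v) t \<le> - c"
    "\<And>\<gamma> u v t. regular \<gamma> u v \<Longrightarrow> 0 < \<gamma> \<Longrightarrow> t \<le> \<tau> \<gamma> \<Longrightarrow> \<gamma> / 2 \<le> u (exp (m * t))"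
proof -
  \<comment> \<open>Bounding \<open>\<gamma> powr (p - 1) * s\<^sup>2\<close> by \<open>R\<close>
    bounds \<open>G\<close> below by \<open>\<gamma> * \<theta> / (\<theta> + 2)\<close>, which is
    exactly what \<open>\<theta> * (\<gamma> - G / 2) - G \<ge> \<gamma> * \<theta> / 2\<close> asks
    for.\<close>
  define R where "R = real N * \<theta> / (\<theta> + 2)"
  have R: "0 < R" using N3 theta_pos by (simp add: R_def)
  \<comment> \<open>The time at which \<open>\<gamma> powr (p - 1) * s\<^sup>2\<close> reaches
    \<open>R\<close>, with \<open>s = exp (m * t)\<close>.\<close>
  define \<tau> where "\<tau> \<gamma> = (ln R - (p - 1) * ln \<gamma>) / (2 * m)" for \<gamma>
  \<comment> \<open>The value of \<open>\<gamma> * exp (m * \<theta> * t)\<close> at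
    \<open>t = \<tau> \<gamma> - 1\<close>, from which \<gamma> has dropped out.\<close>
  define w where "w = exp (\<theta> / 2 * ln R - m * \<theta>)"
  define \<zeta> where "\<zeta> = m * \<theta> * w / (2 * A)"
  have \<zeta>: "0 < \<zeta>" using m_pos theta_pos A_pos by (simp add: \<zeta>_def w_def)
  have key: "\<gamma> / 2 \<le> u (exp (m * t))" "\<gamma> * \<theta> / 2 \<le> \<theta> * u (exp (m * t)) + exp (m * t) * v (exp (m * t))"
    if r: "regular \<gamma> u v" and \<gamma>: "0 < \<gamma>" and t: "t \<le> \<tau> \<gamma>" for \<gamma> u v t
  proof -
    define s where "s = exp (m * t)"
    have s: "0 < s" by (simp add: s_def)
    have N0: "0 < real N" using N3 by simp
    have "2 * m * t \<le> ln R - (p - 1) * ln \<gamma>" using t m_pos by (simp add: \<tau>_def field_simps)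
    then have "exp (2 * m * t) \<le> exp (ln R - (p - 1) * ln \<gamma>)" by (simp only: exp_le_cancel_iff)
    also have "\<dots> = R / \<gamma> powr (p - 1)" using R \<gamma> by (simp add: exp_diff powr_def)
    also have "exp (2 * m * t) = s\<^sup>2" by (simp add: s_def mult.assoc exp_double)
    finally have "s\<^sup>2 * \<gamma> powr (p - 1) \<le> R" using \<gamma> by (simp add: pos_le_divide_eq)
    then have "\<gamma> * (s\<^sup>2 * \<gamma> powr (p - 1)) \<le> \<gamma> * R" using \<gamma> by (intro mult_left_mono) auto
    then have g: "\<gamma> powr p * s\<^sup>2 \<le> \<gamma> * R" using \<gamma> by (simp add: powr_diff field_simps)
    have R2: "R / real N = \<theta> / (\<theta> + 2)" using N0 by (simp add: R_def)
    have g2: "\<gamma> powr p * s\<^sup>2 / real N \<le> \<gamma> * (\<theta> / (\<theta> + 2))"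
      using divide_right_mono[OF g, of "real N"] N0 R2 by (simp add: times_divide_eq_right[symmetric] del: times_divide_eq_right)
    define G where "G = \<gamma> powr p * s\<^sup>2 / real N"
    have u: "\<gamma> - G / 2 \<le> u s" using regular_lower(2)[OF r s] by (simp add: G_def)
    have "s * (- (\<gamma> powr p * s / real N)) \<le> s * v s" using regular_lower(1)[OF r s] s by (intro mult_left_mono) auto
    then have v: "- G \<le> s * v s" by (simp add: G_def power2_eq_square mult_ac)
    have "\<theta> / (\<theta> + 2) \<le> 1" using theta_pos by simp
    then have "G \<le> \<gamma>" using g2 mult_left_mono[of "\<theta> / (\<theta> + 2)" 1 \<gamma>] \<gamma> unfolding G_def by linarith
    then show "\<gamma> / 2 \<le> u (exp (m * t))" using u by (simp add: s_def)
    have "\<theta> * (\<gamma> - G / 2) \<le> \<theta> * u s" using u theta_pos by (intro mult_left_mono) auto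
    moreover have "(\<theta> + 2) * G \<le> \<gamma> * \<theta>" using g2 theta_pos unfolding G_def by (simp add: field_simps)
    moreover have "\<theta> * (\<gamma> - G / 2) - G = \<gamma> * \<theta> - (\<theta> + 2) * G / 2" by (simp add: field_simps)
    ultimately show "\<gamma> * \<theta> / 2 \<le> \<theta> * u (exp (m * t)) + exp (m * t) * v (exp (m * t))"
      using v unfolding s_def[symmetric] by linarith
  qed
  show ?thesis
  proof (rule that[of "\<alpha> * \<zeta>\<^sup>2" \<tau>])
    show "0 < \<alpha> * \<zeta>\<^sup>2" using alpha_pos \<zeta> by simp
    have "filterlim (\<lambda>\<gamma>. (p - 1) / (2 * m) * ln \<gamma>) at_top at_top"
      using p_gt_1 m_pos by (intro filterlim_tendsto_pos_mult_at_top[OF tendsto_const] ln_at_top) auto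
    then have "filterlim (\<lambda>\<gamma>. - (ln R / (2 * m)) + (p - 1) / (2 * m) * ln \<gamma>) at_top at_top"
      by (rule filterlim_tendsto_add_at_top[OF tendsto_const])
    moreover have "- \<tau> \<gamma> = - (ln R / (2 * m)) + (p - 1) / (2 * m) * ln \<gamma>" for \<gamma>
      using m_pos by (simp add: \<tau>_def field_simps)
    ultimately show "filterlim \<tau> at_bot at_top" unfolding filterlim_uminus_at_bot by (simp only:)
  next
    fix \<gamma> u v t assume r: "regular \<gamma> u v" and \<gamma>: "0 < \<gamma>" and t: "\<tau> \<gamma> \<le> t"
    note o = regular_orbit[OF r]
    have "\<zeta>\<^sup>2 \<le> (emden_z u v x)\<^sup>2" if x: "\<tau> \<gamma> - 1 \<le> x" "x \<le> \<tau> \<gamma>" for x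
    proof -
      have "m * \<theta> * (\<tau> \<gamma> - 1) \<le> m * \<theta> * x" using x m_pos theta_pos by (intro mult_left_mono) auto
      moreover have "m * \<theta> * (\<tau> \<gamma> - 1) = \<theta> / 2 * ln R - ln \<gamma> - m * \<theta>"
      proof -
        have "\<theta> * (p - 1) = 2" using theta_p by (simp add: algebra_simps)
        then have "\<theta> * (p - 1) / 2 * ln \<gamma> = ln \<gamma>" by simp
        moreover have "m * \<theta> * \<tau> \<gamma> = \<theta> / 2 * ln R - \<theta> * (p - 1) / 2 * ln \<gamma>"
          using m_pos by (simp add: \<tau>_def field_simps)
        ultimately show ?thesis by (simp add: algebra_simps)
      qed
      ultimately have "\<theta> / 2 * ln R - m * \<theta> \<le> m * \<theta> * x + ln \<gamma>" by linarith
      then have "w \<le> exp (m * \<theta> * x + ln \<gamma>)" unfolding w_def by (simp only: exp_le_cancel_iff)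
      then have "w \<le> exp (m * \<theta> * x) * \<gamma>" using \<gamma> by (simp add: exp_add)
      then have "w * (\<theta> / 2) \<le> exp (m * \<theta> * x) * \<gamma> * (\<theta> / 2)" using theta_pos by (intro mult_right_mono) auto
      also have "\<dots> = exp (m * \<theta> * x) * (\<gamma> * \<theta> / 2)" by simp
      also have "\<dots> \<le> exp (m * \<theta> * x) * (\<theta> * u (exp (m * x)) + exp (m * x) * v (exp (m * x)))"
        using key(2)[OF r \<gamma> x(2)] by (intro mult_left_mono) auto
      finally have "m / A * (w * (\<theta> / 2)) \<le> m / A * (exp (m * \<theta> * x) * (\<theta> * u (exp (m * x)) + exp (m * x) * v (exp (m * x))))"
        using m_pos A_pos by (intro mult_left_mono) auto
      then have "\<zeta> \<le> emden_z u v x" by (simp add: \<zeta>_def emden_z_def mult_ac)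
      then show ?thesis using \<zeta> by (intro power_mono) auto
    qed
    then have "energy (emden_y u) (emden_z u v) (\<tau> \<gamma>) \<le> energy (emden_y u) (emden_z u v) (\<tau> \<gamma> - 1) - \<alpha> * \<zeta>\<^sup>2 * (\<tau> \<gamma> - (\<tau> \<gamma> - 1))"
      by (intro energy_drop[OF orbitD(1)[OF o]]) auto
    also have "\<dots> \<le> - (\<alpha> * \<zeta>\<^sup>2)" using orbitD(2)[OF o, of "\<tau> \<gamma> - 1"] by simp
    finally show "energy (emden_y u) (emden_z u v) t \<le> - (\<alpha> * \<zeta>\<^sup>2)"
      using energy_antimono[OF orbitD(1)[OF o] t] by linarith
  qed (rule key(1))
qed

text \<open>If \<open>u > 1\<close> up to \<open>s\<close>, the flux decreases strictly from 0, so
  \<open>v s < 0\<close>. Up to \<open>\<tau> \<gamma>\<close> one has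
  \<open>u \<ge> \<gamma> / 2\<close>; afterwards the energy gives \<open>y \<ge> c1\<close>, and
  the factor \<open>s powr (- \<theta>)\<close> is large for \<open>t \<le> - M\<close>. This works
  with one \<open>M\<close> for all large \<gamma>.\<close>

lemma regular_decreasing_early:
  obtains M \<gamma>0 where "0 < \<gamma>0"
    "\<And>\<gamma> u v t. regular \<gamma> u v \<Longrightarrow> \<gamma>0 \<le> \<gamma> \<Longrightarrow> t \<le> - M \<Longrightarrow> emden_z u v t < m * \<theta> * emden_y u t"
proof -
  obtain c \<tau> where c: "0 < c"
    and en: "\<And>\<gamma> u v t. regular \<gamma> u v \<Longrightarrow> 0 < \<gamma> \<Longrightarrow> \<tau> \<gamma> \<le> t \<Longrightarrow> energy (emden_y u) (emden_z u v) t \<le> - c"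
    and big: "\<And>\<gamma> u v t. regular \<gamma> u v \<Longrightarrow> 0 < \<gamma> \<Longrightarrow> t \<le> \<tau> \<gamma> \<Longrightarrow> \<gamma> / 2 \<le> u (exp (m * t))"
    using regular_energy_seed by metis
  define c1 where "c1 = sqrt (2 * c / (1 + m\<^sup>2))"
  have m1: "0 < 1 + m\<^sup>2" by (simp add: add_pos_nonneg)
  have c1: "0 < c1" using c m1 by (simp add: c1_def)
  \<comment> \<open>Makes \<open>A * c1 * exp (m * \<theta> * M)\<close> exceed 1; this is the lower
    bound for \<open>u\<close> where \<open>y \<ge> c1\<close>.\<close>
  define M where "M = max 0 (ln (1 / (A * c1)) / (m * \<theta>)) + 1"
  have M: "0 \<le> M" "1 < A * c1 * exp (m * \<theta> * M)"
  proof -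
    have "ln (1 / (A * c1)) / (m * \<theta>) < M" by (simp add: M_def)
    then have "ln (1 / (A * c1)) < m * \<theta> * M" using m_pos theta_pos by (simp add: pos_divide_less_eq mult.commute)
    then have "exp (ln (1 / (A * c1))) < exp (m * \<theta> * M)" by (simp only: exp_less_cancel_iff)
    then show "1 < A * c1 * exp (m * \<theta> * M)" using A_pos c1 by (simp add: field_simps)
  qed (simp add: M_def)
  show ?thesis
  proof (rule that[of 3 M])
    fix \<gamma> u v t assume r: "regular \<gamma> u v" and \<gamma>: "3 \<le> \<gamma>" and t: "t \<le> - M"
    have em: "emden (emden_y u) (emden_z u v)" by (rule regular_emden[OF r])
    have ubig: "1 < u (exp (m * x))" if x: "x \<le> - M" for x
    proof (cases "x \<le> \<tau> \<gamma>")
      case True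
      then show ?thesis using big[OF r _ True] \<gamma> by simp
    next
      case False
      have "energy (emden_y u) (emden_z u v) x \<le> - c" using en[OF r, of x] \<gamma> False by simp
      then have y: "c1 \<le> emden_y u x" unfolding c1_def using orbit_away_from_0[OF em] x M(1) by simp
      have "A * c1 * exp (m * \<theta> * M) \<le> A * c1 * exp (- (m * \<theta> * x))"
      proof -
        have "m * \<theta> * x \<le> m * \<theta> * - M" using x m_pos theta_pos by (intro mult_left_mono) auto
        then have "exp (m * \<theta> * M) \<le> exp (- (m * \<theta> * x))" by simp
        then show ?thesis using A_pos c1 by (intro mult_left_mono) auto
      qed
      also have "\<dots> \<le> A * emden_y u x * exp (- (m * \<theta> * x))"
        using y A_pos by (intro mult_right_mono mult_left_mono) auto
      also have "\<dots> = u (exp (m * x))" using A_pos by (simp add: emden_y_def exp_minus)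
      finally show ?thesis using M(2) by simp
    qed
    define s where "s = exp (m * t)"
    have s: "0 < s" by (simp add: s_def)
    have ubig': "1 < u x" if "0 < x" "x \<le> s" for x
    proof -
      have "ln x \<le> ln s" using that by simp
      also have "ln s = m * t" by (simp add: s_def)
      also have "m * t \<le> m * - M" using t m_pos by (intro mult_left_mono) auto
      finally have "ln x / m \<le> - M" using m_pos by (simp add: pos_divide_le_eq mult.commute)
      then show ?thesis using ubig[of "ln x / m"] that m_pos by simp
    qed
    define g where "g s = s ^ (N - 1) * v s" for s
    have "g s < g 0"
    proof (rule DERIV_neg_imp_decreasing_open[OF s])
      show "continuous_on {0..s} g"
      proof -
        have "continuous_on {0..} v" using r unfolding regular_def by blast
        then have "continuous_on {0..s} v" by (rule continuous_on_subset) auto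
        then show ?thesis unfolding g_def by (intro continuous_intros)
      qed
      fix x assume x: "0 < x" "x < s"
      have "(g has_real_derivative - (x ^ (N - 1)) * fnl p (u x)) (at x)"
        unfolding g_def by (rule flux_deriv[OF x(1)]) (unfold N_minus_1, rule regularD(4)[OF r x(1)])
      moreover have "0 < fnl p (u x)" using powr_p_greater[OF ubig'[of x]] x by (simp add: fnl_def)
      ultimately show "\<exists>y. (g has_real_derivative y) (at x) \<and> y < 0"
        using x(1) by (intro exI[of _ "- (x ^ (N - 1)) * fnl p (u x)"]) auto
    qed
    then have "v s < 0" using s N3 by (simp add: g_def mult_less_0_iff power_0_left)
    then have "m * exp (m * \<theta> * t) / A * (s * v s) < 0" using s m_pos A_pos by (intro mult_pos_neg) auto
    moreover have "emden_z u v t = m * \<theta> * emden_y u t + m * exp (m * \<theta> * t) / A * (s * v s)"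
      by (simp add: emden_z_def emden_y_def s_def algebra_simps add_divide_distrib)
    ultimately show "emden_z u v t < m * \<theta> * emden_y u t" by simp
  qed simp
qed

end

section \<open>Oscillation\<close>

text \<open>A forcing of at least \<open>c\<close> makes the flux fall like
  \<open>- c * s ^ (k + 1) / (k + 1)\<close>, so \<open>v\<close> drops below -1 and
  \<open>w\<close> below any level. It serves to exclude limits of \<open>u\<close> at which
  \<open>f\<close> does not vanish.\<close>

lemma driven_down:
  fixes w v F :: "real \<Rightarrow> real" and k :: nat
  assumes c: "0 < c" and S: "1 \<le> S"
    and dw: "\<And>s. S \<le> s \<Longrightarrow> (w has_real_derivative v s) (at s)"
    and dv: "\<And>s. S \<le> s \<Longrightarrow> (v has_real_derivative - real k / s * v s - F s) (at s)"
    and F: "\<And>s. S \<le> s \<Longrightarrow> c \<le> F s"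
  shows "\<exists>s\<ge>S. w s < b"
proof -
  define h where "h s = s ^ k * v s + c * s ^ Suc k / real (Suc k)" for s
  have h: "h s \<le> h S" if "S \<le> s" for s
  proof (rule DERIV_nonpos_imp_nonincreasing[OF that])
    fix x assume x: "S \<le> x" "x \<le> s"
    have x0: "0 < x" using x S by linarith
    have "((\<lambda>s. s ^ k * v s) has_real_derivative - (x ^ k) * F x) (at x)"
      by (rule flux_deriv[OF x0 dv[OF x(1)]])
    moreover have "((\<lambda>s. c * s ^ Suc k / real (Suc k)) has_real_derivative c * x ^ k) (at x)"
      by (rule DERIV_cong[OF DERIV_cdivide[OF DERIV_cmult[OF DERIV_pow]]]) auto
    ultimately have "(h has_real_derivative - (x ^ k) * F x + c * x ^ k) (at x)"
      unfolding h_def by (intro DERIV_add) auto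
    moreover have "- (x ^ k) * F x + c * x ^ k \<le> 0"
      using mult_left_mono[OF F[OF x(1)], of "x ^ k"] x0 by (simp add: mult.commute)
    ultimately show "\<exists>y. (h has_real_derivative y) (at x) \<and> y \<le> 0" by blast
  qed
  define S3 where "S3 = max S ((\<bar>h S\<bar> + 1) * real (Suc k) / c)"
  have vneg: "v s \<le> -1" if s: "S3 \<le> s" for s
  proof -
    have s1: "S \<le> s" "1 \<le> s" using s S by (auto simp: S3_def)
    have "(\<bar>h S\<bar> + 1) * real (Suc k) / c \<le> s" using s by (simp add: S3_def)
    then have big: "\<bar>h S\<bar> + 1 \<le> c * s / real (Suc k)" using c by (simp add: field_simps)
    have pk: "1 \<le> s ^ k" using s1 by simp
    have "s ^ k * v s + s ^ k * (c * s / real (Suc k)) \<le> h S" using h[OF s1(1)] by (simp add: h_def mult_ac)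
    also have "\<dots> \<le> s ^ k * \<bar>h S\<bar>" using pk abs_ge_self[of "h S"] mult_right_mono[OF pk, of "\<bar>h S\<bar>"] by simp
    finally have "s ^ k * (v s + c * s / real (Suc k)) \<le> s ^ k * \<bar>h S\<bar>" by (simp add: distrib_left)
    then have "v s + c * s / real (Suc k) \<le> \<bar>h S\<bar>" using pk by (simp only: mult_le_cancel_left_pos)
    then show ?thesis using big by linarith
  qed
  have S3: "S \<le> S3" by (simp add: S3_def)
  define t where "t = S3 + \<bar>w S3\<bar> + \<bar>b\<bar> + 1"
  have t: "S3 \<le> t" by (simp add: t_def)
  have "w t + t \<le> w S3 + S3"
  proof (rule DERIV_nonpos_imp_nonincreasing[OF t])
    fix x assume x: "S3 \<le> x" "x \<le> t"
    have "((\<lambda>t. w t + t) has_real_derivative v x + 1) (at x)"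
      using x S3 by (intro DERIV_add dw DERIV_ident) simp
    then show "\<exists>y. ((\<lambda>t. w t + t) has_real_derivative y) (at x) \<and> y \<le> 0"
      using vneg[OF x(1)] by (intro exI[of _ "v x + 1"]) simp
  qed
  then have "w t < b" unfolding t_def by linarith
  then show ?thesis using t S3 by (intro exI[of _ t]) simp
qed

context supercritical begin

text \<open>\<open>f\<close> has slope \<open>p - 1\<close> at 1; keeping half of it gives a uniform
  restoring force near 1.\<close>

lemma slope_near_1:
  obtains \<eta> where "0 < \<eta>" "\<And>x. \<bar>x - 1\<bar> < \<eta> \<Longrightarrow> \<exists>q\<ge>(p - 1) / 2. fnl p x = q * (x - 1)"
proof -
  have "((\<lambda>\<xi>. p * \<xi> powr (p - 1)) \<longlongrightarrow> p * 1 powr (p - 1)) (at (1::real))"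
    by (intro tendsto_intros) auto
  then have "\<forall>\<^sub>F \<xi> in at (1::real). (p + 1) / 2 < p * \<xi> powr (p - 1)"
    using p_gt_1 by (intro order_tendstoD(1)) auto
  then obtain d where d: "0 < d" "\<And>\<xi>::real. \<xi> \<noteq> 1 \<Longrightarrow> dist \<xi> 1 < d \<Longrightarrow> (p + 1) / 2 < p * \<xi> powr (p - 1)"
    unfolding eventually_at by blast
  show ?thesis
  proof (rule that[of "min d 1"])
    fix x assume x: "\<bar>x - 1\<bar> < min d 1"
    obtain \<xi> where \<xi>: "\<bar>\<xi> - 1\<bar> < min d 1" "x powr p - 1 powr p = p * \<xi> powr (p - 1) * (x - 1)"
      using powr_mean_value[OF x, of 1] d(1) by auto
    have "(p + 1) / 2 \<le> p * \<xi> powr (p - 1)" using d(2)[of \<xi>] \<xi>(1) p_gt_1 by (cases "\<xi> = 1") (auto simp: dist_real_def less_imp_le)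
    then show "\<exists>q\<ge>(p - 1) / 2. fnl p x = q * (x - 1)"
      using \<xi>(2) by (intro exI[of _ "p * \<xi> powr (p - 1) - 1"]) (auto simp: fnl_def algebra_simps field_simps)
  qed (use d in auto)
qed

text \<open>Without zeros of \<open>v\<close> beyond \<open>S\<close>, \<open>u\<close> would be
  eventually monotone. \<open>driven_down\<close> excludes unboundedness and every limit other than
  the zeros 0 and 1 of \<open>f\<close>; near 1 a rescaling of \<open>u - 1\<close> oscillates; a
  limit 0 would be approached exponentially fast, against the polynomial lower bound
  \<open>slow\<close>.\<close>

lemma radial_oscillation:
  assumes pos: "\<And>s. 0 < s \<Longrightarrow> 0 < u s"
    and du: "\<And>s. 0 < s \<Longrightarrow> (u has_real_derivative v s) (at s)"
    and dv: "\<And>s. 0 < s \<Longrightarrow> (v has_real_derivative - (real N - 1) / s * v s - fnl p (u s)) (at s)"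
    and slow: "0 < d" "\<And>s. 1 \<le> s \<Longrightarrow> d \<le> s powr (2 * \<theta>) * (1 + m\<^sup>2 * s\<^sup>2) * (u s)\<^sup>2"
  shows "\<exists>s>S. v s = 0"
proof (rule ccontr)
  assume "\<not> ?thesis"
  then have nz: "v s \<noteq> 0" if "S < s" for s using that by blast
  define S1 where "S1 = max 1 (S + 1)"
  have S1: "1 \<le> S1" "S < S1" "0 < S1" by (auto simp: S1_def)
  have N1: "real (N - 1) = real N - 1" using N3 by simp
  have dv': "(v has_real_derivative - real (N - 1) / s * v s - fnl p (u s)) (at s)" if "0 < s" for s
    unfolding N1 by (rule dv[OF that])
  have dmv: "((\<lambda>s. - v s) has_real_derivative - real (N - 1) / s * - v s - - fnl p (u s)) (at s)" if "0 < s" for s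
    by (rule DERIV_cong[OF DERIV_minus[OF dv'[OF that]]]) simp
  have sign: "(\<forall>s\<in>{S1..b}. 0 < v s) \<or> (\<forall>s\<in>{S1..b}. v s < 0)" for b
  proof (rule nonzero_deriv_const_sign)
    show "continuous_on {S1..b} v"
      using S1 by (intro continuous_at_imp_continuous_on ballI DERIV_isCont[OF dv]) auto
  qed (use nz S1 in auto)
  have f_pos: "fnl p a \<le> fnl p x" if "1 \<le> a" "a \<le> x" for a x
  proof -
    have "a * (a powr (p - 1) - 1) \<le> x * (x powr (p - 1) - 1)"
      using that p_gt_1 by (intro mult_mono) (auto intro: powr_mono2 ge_one_powr_ge_zero)
    then show ?thesis using that by (simp add: fnl_def powr_diff algebra_simps)
  qed
  have f_neg: "fnl p x \<le> - (l * (1 - b powr (p - 1)))" if "0 < l" "l \<le> x" "x \<le> b" "b < 1" for l x b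
  proof -
    have "x powr (p - 1) \<le> b powr (p - 1)" using that p_gt_1 by (intro powr_mono2) auto
    moreover have "b powr (p - 1) < 1" using that p_gt_1 powr_less_mono2[of "p - 1" b 1] by simp
    ultimately have "l * (1 - b powr (p - 1)) \<le> x * (1 - x powr (p - 1))"
      using that by (intro mult_mono) auto
    then show ?thesis using that by (simp add: fnl_def powr_diff algebra_simps)
  qed
  have not_low: False if ul: "0 < l" "b < 1" and S2: "S1 \<le> S2" "\<And>s. S2 \<le> s \<Longrightarrow> l \<le> u s \<and> u s \<le> b" for l b S2
  proof -
    have "b powr (p - 1) < 1" using powr_less_mono2[of "p - 1" b 1] ul p_gt_1 S2(2)[of S2] by simp
    then have c: "0 < l * (1 - b powr (p - 1))" using ul by simp
    have "\<exists>s\<ge>S2. - u s < - 2"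
    proof (rule driven_down[OF c])
      show "1 \<le> S2" using S1 S2 by simp
      fix s assume s: "S2 \<le> s"
      then have s0: "0 < s" using S1 S2 by linarith
      show "((\<lambda>s. - u s) has_real_derivative - v s) (at s)" by (intro DERIV_minus du s0)
      show "((\<lambda>s. - v s) has_real_derivative - real (N - 1) / s * - v s - - fnl p (u s)) (at s)" by (rule dmv[OF s0])
      show "l * (1 - b powr (p - 1)) \<le> - fnl p (u s)" using f_neg[of l "u s" b] S2(2)[OF s] ul by simp
    qed
    then show False using S2(2) ul by force
  qed
  have not_high: False if a: "1 < a" and S2: "S1 \<le> S2" "\<And>s. S2 \<le> s \<Longrightarrow> a \<le> u s" for a S2
  proof -
    have c: "0 < fnl p a" using powr_p_greater[OF a] by (simp add: fnl_def)
    have "\<exists>s\<ge>S2. u s < 0"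
    proof (rule driven_down[OF c])
      show "1 \<le> S2" using S1 S2 by simp
      fix s assume s: "S2 \<le> s"
      then have s0: "0 < s" using S1 S2 by linarith
      show "(u has_real_derivative v s) (at s)" by (rule du[OF s0])
      show "(v has_real_derivative - real (N - 1) / s * v s - fnl p (u s)) (at s)" by (rule dv'[OF s0])
      show "fnl p a \<le> fnl p (u s)" using f_pos[of a "u s"] S2(2)[OF s] a by simp
    qed
    then obtain s where s: "S2 \<le> s" "u s < 0" by blast
    then have "0 < s" using S1 S2(1) by linarith
    then show False using pos[of s] s(2) by simp
  qed
  \<comment> \<open>\<open>\<sigma>\<close> treats approach to 1 from above and from below at
    once.\<close>
  have not_1: False if \<sigma>: "\<sigma> = 1 \<or> \<sigma> = -1" and S2: "S1 \<le> S2" "\<And>s. S2 \<le> s \<Longrightarrow> 0 < \<sigma> * (u s - 1)"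
    and lim: "\<And>\<eta>. 0 < \<eta> \<Longrightarrow> \<exists>S3\<ge>S2. \<forall>s\<ge>S3. \<bar>u s - 1\<bar> < \<eta>" for \<sigma> S2 :: real
  proof -
    obtain \<eta> where \<eta>: "0 < \<eta>" "\<And>x. \<bar>x - 1\<bar> < \<eta> \<Longrightarrow> \<exists>q\<ge>(p - 1) / 2. fnl p x = q * (x - 1)"
      using slope_near_1 by blast
    obtain S3 where S3: "S2 \<le> S3" "\<And>s. S3 \<le> s \<Longrightarrow> \<bar>u s - 1\<bar> < \<eta>" using lim[OF \<eta>(1)] by blast
    \<comment> \<open>This power removes the first order term: \<open>s powr k * (u - 1)\<close>
      satisfies an equation without damping, at the price of the potential
      \<open>k * (k - 1) / s\<^sup>2\<close>.\<close>
    define k where "k = (real N - 1) / 2"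
    have k: "1 \<le> k" using N3 by (simp add: k_def)
    \<comment> \<open>From here on that potential is at most \<open>(p - 1) / 4\<close>, half of the
      slope guaranteed by \<open>slope_near_1\<close>.\<close>
    define S4 where "S4 = max S3 (2 * k / sqrt (p - 1))"
    have S4: "S3 \<le> S4" "S1 \<le> S4" "0 < S4" "2 * k / sqrt (p - 1) \<le> S4" using S3 S2 S1 by (auto simp: S4_def)
    show False
    proof (rule no_positive_oscillator[of "(p - 1) / 4" S4 "\<lambda>s. \<sigma> * (s powr k * (u s - 1))"
          "\<lambda>s. \<sigma> * (s powr k * v s + k * s powr (k - 1) * (u s - 1))"
          "\<lambda>s. \<sigma> * (s powr k * (k * (k - 1) / s\<^sup>2 * (u s - 1) - fnl p (u s)))"])
      show "0 < (p - 1) / 4" using p_gt_1 by simp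
      fix s assume s: "S4 \<le> s"
      have s0: "0 < s" using s S4 by linarith
      have dp: "((\<lambda>s. s powr r) has_real_derivative r * s powr (r - 1)) (at s)" for r
        by (rule has_real_derivative_powr[OF s0])
      have duw: "((\<lambda>s. u s - 1) has_real_derivative v s) (at s)" using DERIV_diff[OF du[OF s0] DERIV_const[of 1]] by simp
      show "((\<lambda>s. \<sigma> * (s powr k * (u s - 1))) has_real_derivative \<sigma> * (s powr k * v s + k * s powr (k - 1) * (u s - 1))) (at s)"
        by (rule DERIV_cong[OF DERIV_cmult[OF DERIV_mult[OF dp duw]]]) (simp add: algebra_simps)
      show "((\<lambda>s. \<sigma> * (s powr k * v s + k * s powr (k - 1) * (u s - 1))) has_real_derivative
          \<sigma> * (s powr k * (k * (k - 1) / s\<^sup>2 * (u s - 1) - fnl p (u s)))) (at s)"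
      proof (rule DERIV_cong[OF DERIV_cmult[OF DERIV_add[OF DERIV_mult[OF dp dv[OF s0]] DERIV_mult[OF DERIV_cmult[OF dp] duw]]]])
        have p1: "s powr (k - 1) = s powr k / s" "s powr (k - 1 - 1) = s powr k / s\<^sup>2"
          using s0 by (simp_all add: powr_diff power2_eq_square)
        have N2k: "real N - 1 = 2 * k" by (simp add: k_def)
        show "\<sigma> * (k * s powr (k - 1) * v s + (- (real N - 1) / s * v s - fnl p (u s)) * s powr k +
           (k * ((k - 1) * s powr (k - 1 - 1)) * (u s - 1) + v s * (k * s powr (k - 1))))
           = \<sigma> * (s powr k * (k * (k - 1) / s\<^sup>2 * (u s - 1) - fnl p (u s)))"
          unfolding p1 N2k using s0 by (simp add: field_simps power2_eq_square)
      qed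
      have w0: "0 < \<sigma> * (u s - 1)" using S2(2)[of s] s S4 S3 by simp
      have w1: "0 < s powr k * (\<sigma> * (u s - 1))" by (rule mult_pos_pos[OF _ w0]) (use s0 in simp)
      then show "0 < \<sigma> * (s powr k * (u s - 1))" by (simp only: mult.left_commute)
      obtain q where q: "(p - 1) / 2 \<le> q" "fnl p (u s) = q * (u s - 1)" using \<eta>(2)[OF S3(2)[of s]] s S4 by auto
      have "2 * k / sqrt (p - 1) \<le> s" using s S4 by linarith
      then have "2 * k \<le> s * sqrt (p - 1)" using p_gt_1 by (simp add: pos_divide_le_eq)
      then have "(2 * k)\<^sup>2 \<le> (s * sqrt (p - 1))\<^sup>2" using k by (intro power_mono) auto
      then have "4 * k\<^sup>2 \<le> s\<^sup>2 * (p - 1)" using p_gt_1 by (simp add: power_mult_distrib)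
      moreover have "k * (k - 1) \<le> k\<^sup>2" using k by (simp add: power2_eq_square)
      ultimately have "k * (k - 1) / s\<^sup>2 \<le> (p - 1) / 4" using s0 by (simp add: field_simps)
      then have "k * (k - 1) / s\<^sup>2 - q \<le> - ((p - 1) / 4)" using q(1) by (simp add: field_simps)
      then have "(k * (k - 1) / s\<^sup>2 - q) * (s powr k * (\<sigma> * (u s - 1))) \<le> - ((p - 1) / 4) * (s powr k * (\<sigma> * (u s - 1)))"
        by (rule mult_right_mono[OF _ less_imp_le[OF w1]])
      note final = this
      show "\<sigma> * (s powr k * (k * (k - 1) / s\<^sup>2 * (u s - 1) - fnl p (u s))) \<le> - ((p - 1) / 4) * (\<sigma> * (s powr k * (u s - 1)))"
      proof -
        have e: "\<sigma> * (P * (X * W - q * W)) = (X - q) * (P * (\<sigma> * W))" for P X W :: real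
          by (simp add: algebra_simps)
        show ?thesis using final unfolding q(2) e by (simp only: mult.left_commute[of \<sigma> "s powr k"])
      qed
    qed
  qed
  have not_0: False if dec: "\<And>s. S1 \<le> s \<Longrightarrow> v s < 0" and S2: "S1 \<le> S2" "\<And>s. S2 \<le> s \<Longrightarrow> u s \<le> 1"
    and lim: "\<And>l. 0 < l \<Longrightarrow> \<exists>S3\<ge>S2. \<forall>s\<ge>S3. u s < l" for S2
  proof -
    define E where "E s = (v s)\<^sup>2 / 2 + well (u s)" for s
    have E_dec: "E t \<le> E s" if "S1 \<le> s" "s \<le> t" for s t
    proof (rule DERIV_nonpos_imp_nonincreasing[OF that(2)])
      fix x assume x: "s \<le> x" "x \<le> t"
      have x0: "0 < x" using x that S1 by linarith
      have "(E has_real_derivative v x * (- (real N - 1) / x * v x - fnl p (u x)) + (u x powr p - u x) * v x) (at x)"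
        unfolding E_def by (auto intro!: derivative_eq_intros dv DERIV_chain2[OF well_deriv] du x0 pos)
      moreover have "v x * (- (real N - 1) / x * v x - fnl p (u x)) + (u x powr p - u x) * v x = - ((real N - 1) / x * (v x)\<^sup>2)"
        using x0 by (simp add: fnl_def field_simps power2_eq_square)
      moreover have "0 \<le> (real N - 1) / x * (v x)\<^sup>2" using x0 N3 by simp
      ultimately show "\<exists>y. (E has_real_derivative y) (at x) \<and> y \<le> 0" by (metis neg_le_0_iff_le)
    qed
    \<comment> \<open>A negative value of the decreasing \<open>E\<close> would keep
      \<open>u\<close> away from 0 forever.\<close>
    have E0: "0 \<le> E s" if "S2 \<le> s" for s
    proof (rule ccontr)
      assume "\<not> 0 \<le> E s"
      then have neg: "E s < 0" by simp
      have "0 < sqrt (- 2 * E s)" using neg by simp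
      then obtain S3 where S3: "S2 \<le> S3" "\<And>t. S3 \<le> t \<Longrightarrow> u t < sqrt (- 2 * E s)"
        using lim by blast
      define t where "t = max s S3"
      have "E t \<le> E s" using that S2 by (intro E_dec) (auto simp: t_def)
      moreover have "- (u t)\<^sup>2 / 2 \<le> well (u t)" using p_gt_1 by (simp add: well_def)
      ultimately have "- 2 * E s \<le> (u t)\<^sup>2" using zero_le_power2[of "v t"] unfolding E_def[of t] by linarith
      moreover have "(u t)\<^sup>2 < - 2 * E s"
      proof -
        have "u t < sqrt (- 2 * E s)" using S3(2)[of t] by (simp add: t_def)
        then have "(u t)\<^sup>2 < (sqrt (- 2 * E s))\<^sup>2"
          using pos[of t] S1 S2(1) that by (intro power_strict_mono) (auto simp: t_def less_imp_le)
        then show ?thesis using neg by simp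
      qed
      ultimately show False by simp
    qed
    \<comment> \<open>\<open>E \<ge> 0\<close> and \<open>u \<le> 1\<close> give
      \<open>v^2 \<ge> (1 - 2 / (p + 1)) * u^2\<close>, hence exponential decay at rate
      \<open>\<beta>\<close>.\<close>
    define \<beta> where "\<beta> = sqrt (1 - 2 / (p + 1))"
    have b0: "0 < 1 - 2 / (p + 1)" using p_gt_1 by (simp add: field_simps)
    have \<beta>: "0 < \<beta>" "\<beta>\<^sup>2 = 1 - 2 / (p + 1)" using b0 by (simp_all add: \<beta>_def)
    have v_le: "v s \<le> - \<beta> * u s" if s: "S2 \<le> s" for s
    proof -
      have u: "0 < u s" using pos[of s] s S2(1) S1 by simp
      have "u s powr (p + 1) = (u s)\<^sup>2 * u s powr (p - 1)" using u by (simp add: powr_add powr_diff power2_eq_square)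
      also have "\<dots> \<le> (u s)\<^sup>2 * 1" using u S2(2)[OF s] p_gt_1 by (intro mult_left_mono powr_le1) auto
      finally have "u s powr (p + 1) / (p + 1) \<le> (u s)\<^sup>2 / (p + 1)" using p_gt_1 by (intro divide_right_mono) auto
      then have "0 \<le> (v s)\<^sup>2 / 2 - (u s)\<^sup>2 / 2 + (u s)\<^sup>2 / (p + 1)"
        using E0[OF s] unfolding E_def well_def by linarith
      moreover have "V / 2 - U / 2 + U / q = (V - (1 - 2 / q) * U) / 2" for U V q :: real
        by (simp add: algebra_simps diff_divide_distrib add_divide_distrib)
      ultimately have "0 \<le> ((v s)\<^sup>2 - \<beta>\<^sup>2 * (u s)\<^sup>2) / 2" unfolding \<beta>(2) by (simp only:)
      then have "\<beta>\<^sup>2 * (u s)\<^sup>2 \<le> (v s)\<^sup>2" by simp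
      then have "(\<beta> * u s)\<^sup>2 \<le> (- v s)\<^sup>2" unfolding power_mult_distrib power2_minus .
      moreover have "0 \<le> - v s" using dec[of s] s S2(1) by simp
      ultimately have "\<beta> * u s \<le> - v s" by (rule power2_le_imp_le)
      then show ?thesis by simp
    qed
    define K where "K = u S2 * exp (\<beta> * S2)"
    have "u s * exp (\<beta> * s) \<le> u S2 * exp (\<beta> * S2)" if s: "S2 \<le> s" for s
    proof (rule DERIV_nonpos_imp_nonincreasing[OF s])
      fix x assume x: "S2 \<le> x" "x \<le> s"
      have x0: "0 < x" using x S2(1) S1 by linarith
      have "((\<lambda>s. u s * exp (\<beta> * s)) has_real_derivative (v x + \<beta> * u x) * exp (\<beta> * x)) (at x)"
        by (auto intro!: derivative_eq_intros du x0 simp: algebra_simps)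
      moreover have "(v x + \<beta> * u x) * exp (\<beta> * x) \<le> 0" using v_le[OF x(1)] by (intro mult_nonpos_nonneg) auto
      ultimately show "\<exists>y. ((\<lambda>s. u s * exp (\<beta> * s)) has_real_derivative y) (at x) \<and> y \<le> 0" by blast
    qed
    then have uK: "u s \<le> K / exp (\<beta> * s)" if "S2 \<le> s" for s using that by (simp add: K_def pos_le_divide_eq)
    \<comment> \<open>An integer exponent that dominates the growth
      \<open>s powr (2 * \<theta>) * s\<^sup>2\<close> in \<open>slow\<close>.\<close>
    define n where "n = nat \<lceil>2 * \<theta>\<rceil> + 2"
    have bound: "d \<le> (1 + m\<^sup>2) * K\<^sup>2 / (2 * \<beta>) ^ n * ((2 * \<beta> * s) ^ n / exp (2 * \<beta> * s))" if s: "S2 \<le> s" for s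
    proof -
      have s1: "1 \<le> s" using s S2(1) S1(1) by linarith
      have u0: "0 < u s" using pos s1 by simp
      have "(u s)\<^sup>2 \<le> (K / exp (\<beta> * s))\<^sup>2" using uK[OF s] u0 by (intro power_mono) auto
      also have "\<dots> = K\<^sup>2 / exp (2 * \<beta> * s)" by (simp add: power_divide mult.assoc exp_double)
      finally have u2: "(u s)\<^sup>2 \<le> K\<^sup>2 / exp (2 * \<beta> * s)" .
      have "2 * \<theta> \<le> real (nat \<lceil>2 * \<theta>\<rceil>)" using theta_pos by linarith
      then have "s powr (2 * \<theta>) \<le> s powr real (nat \<lceil>2 * \<theta>\<rceil>)" using s1 by (intro powr_mono) auto
      also have "\<dots> = s ^ nat \<lceil>2 * \<theta>\<rceil>" using s1 by (simp add: powr_realpow)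
      finally have a: "s powr (2 * \<theta>) \<le> s ^ nat \<lceil>2 * \<theta>\<rceil>" .
      have b: "1 + m\<^sup>2 * s\<^sup>2 \<le> (1 + m\<^sup>2) * s\<^sup>2" using s1 by (simp add: distrib_right)
      have "s powr (2 * \<theta>) * (1 + m\<^sup>2 * s\<^sup>2) \<le> s ^ nat \<lceil>2 * \<theta>\<rceil> * ((1 + m\<^sup>2) * s\<^sup>2)"
        using a b s1 by (intro mult_mono) (auto simp: add_nonneg_nonneg)
      also have "\<dots> = (1 + m\<^sup>2) * s ^ n" by (simp only: n_def power_add mult_ac)
      finally have ab: "s powr (2 * \<theta>) * (1 + m\<^sup>2 * s\<^sup>2) \<le> (1 + m\<^sup>2) * s ^ n" .
      have "s powr (2 * \<theta>) * (1 + m\<^sup>2 * s\<^sup>2) * (u s)\<^sup>2 \<le> (1 + m\<^sup>2) * s ^ n * (K\<^sup>2 / exp (2 * \<beta> * s))"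
        by (rule mult_mono[OF ab u2]) (use s1 in \<open>auto simp: add_nonneg_nonneg\<close>)
      also have "\<dots> = (1 + m\<^sup>2) * K\<^sup>2 / (2 * \<beta>) ^ n * ((2 * \<beta> * s) ^ n / exp (2 * \<beta> * s))"
        using \<beta>(1) by (simp add: power_mult_distrib)
      finally show ?thesis using slow(2)[OF s1] by linarith
    qed
    have "filterlim (\<lambda>s. (2 * \<beta>) * s) at_top at_top"
      using \<beta>(1) by (intro filterlim_tendsto_pos_mult_at_top[OF tendsto_const] filterlim_ident) auto
    then have "((\<lambda>s. (2 * \<beta> * s) ^ n / exp (2 * \<beta> * s)) \<longlongrightarrow> 0) at_top"
      using filterlim_compose[OF tendsto_power_div_exp_0] by blast
    then have "((\<lambda>s. (1 + m\<^sup>2) * K\<^sup>2 / (2 * \<beta>) ^ n * ((2 * \<beta> * s) ^ n / exp (2 * \<beta> * s))) \<longlongrightarrow> (1 + m\<^sup>2) * K\<^sup>2 / (2 * \<beta>) ^ n * 0) at_top"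
      by (intro tendsto_mult tendsto_const)
    then have "d \<le> (1 + m\<^sup>2) * K\<^sup>2 / (2 * \<beta>) ^ n * 0"
      by (rule tendsto_lowerbound[OF _ eventually_mono[OF eventually_ge_at_top[of S2] bound] trivial_limit_at_top_linorder])
    then show False using slow(1) by simp
  qed
  consider (inc) "\<And>s. S1 \<le> s \<Longrightarrow> 0 < v s" | (dec) "\<And>s. S1 \<le> s \<Longrightarrow> v s < 0"
  proof (cases "0 < v S1")
    case True
    then have "0 < v s" if "S1 \<le> s" for s using sign[of s] that by force
    then show ?thesis using that(1) by blast
  next
    case False
    then have "v s < 0" if "S1 \<le> s" for s using sign[of s] that by force
    then show ?thesis using that(2) by blast
  qed
  then show False
  proof cases
    \<comment> \<open>An increasing \<open>u\<close> stays below 1 and could only tend to 1.\<close>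
    case inc
    have mono: "u s < u t" if "S1 \<le> s" "s < t" for s t
    proof (rule DERIV_pos_imp_increasing[OF that(2)])
      fix x assume "s \<le> x" "x \<le> t"
      then show "\<exists>y. (u has_real_derivative y) (at x) \<and> 0 < y" using du[of x] inc[of x] that S1 by force
    qed
    have le1: "u s < 1" if "S1 \<le> s" for s
    proof (rule ccontr)
      assume "\<not> u s < 1"
      then have "1 < u (s + 1)" using mono[OF that, of "s + 1"] by simp
      then show False
      proof (rule not_high)
        show "S1 \<le> s + 1" using that by simp
        show "u (s + 1) \<le> u t" if "s + 1 \<le> t" for t
          using mono[of "s + 1" t] that \<open>S1 \<le> s\<close> by (cases "t = s + 1") auto
      qed
    qed
    show False
    proof (rule not_1[of "-1" S1])
      fix \<eta> :: real assume \<eta>: "0 < \<eta>"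
      have "\<exists>s\<ge>S1. 1 - \<eta> < u s"
      proof (rule ccontr)
        assume "\<not> ?thesis"
        then have b: "u s \<le> 1 - \<eta>" if "S1 \<le> s" for s using that by force
        show False
        proof (rule not_low[of "u S1" "1 - \<eta>" S1])
          show "u S1 \<le> u s \<and> u s \<le> 1 - \<eta>" if "S1 \<le> s" for s
            using b[OF that] mono[of S1 s] that by (cases "s = S1") auto
        qed (use pos S1 \<eta> in auto)
      qed
      then obtain s where s: "S1 \<le> s" "1 - \<eta> < u s" by blast
      have "\<bar>u t - 1\<bar> < \<eta>" if "s \<le> t" for t
        using mono[of s t] le1[of t] s that by (cases "t = s") auto
      then show "\<exists>S3\<ge>S1. \<forall>s\<ge>S3. \<bar>u s - 1\<bar> < \<eta>" using s by blast
    qed (use le1 in auto)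
  next
    \<comment> \<open>A decreasing \<open>u\<close> could only tend to 0 once it is below 1, and
      otherwise only to 1 from above.\<close>
    case dec
    have mono: "u t < u s" if "S1 \<le> s" "s < t" for s t
    proof (rule DERIV_neg_imp_decreasing[OF that(2)])
      fix x assume "s \<le> x" "x \<le> t"
      then show "\<exists>y. (u has_real_derivative y) (at x) \<and> y < 0" using du[of x] dec[of x] that S1 by force
    qed
    have mono': "u t \<le> u s" if "S1 \<le> s" "s \<le> t" for s t using mono[of s t] that by (cases "s = t") auto
    show False
    proof (cases "\<exists>s2\<ge>S1. u s2 < 1")
      case True
      then obtain s2 where s2: "S1 \<le> s2" "u s2 < 1" by blast
      show False
      proof (rule not_0[OF dec s2(1)])
        show "u s \<le> 1" if "s2 \<le> s" for s using mono'[OF s2(1) that] s2 by simp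
        fix l :: real assume l: "0 < l"
        have "\<exists>s\<ge>s2. u s < l"
        proof (rule ccontr)
          assume "\<not> ?thesis"
          then have b: "l \<le> u s" if "s2 \<le> s" for s using that by force
          show False
          proof (rule not_low[OF l s2(2) s2(1)])
            show "l \<le> u s \<and> u s \<le> u s2" if "s2 \<le> s" for s using b[OF that] mono'[OF s2(1) that] by simp
          qed
        qed
        then obtain s where s: "s2 \<le> s" "u s < l" by blast
        have "u t < l" if "s \<le> t" for t using mono'[of s t] s s2(1) that by simp
        then show "\<exists>S3\<ge>s2. \<forall>s\<ge>S3. u s < l" using s by blast
      qed
    next
      case False
      then have ge1: "1 \<le> u s" if "S1 \<le> s" for s using that by force
      have gt1: "1 < u s" if "S1 \<le> s" for s using ge1[of "s + 1"] mono[OF that, of "s + 1"] that by simp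
      show False
      proof (rule not_1[of 1 S1])
        fix \<eta> :: real assume \<eta>: "0 < \<eta>"
        have "\<exists>s\<ge>S1. u s < 1 + \<eta>"
        proof (rule ccontr)
          assume "\<not> ?thesis"
          then have b: "1 + \<eta> \<le> u s" if "S1 \<le> s" for s using that by force
          show False by (rule not_high[of "1 + \<eta>" S1]) (use \<eta> b in auto)
        qed
        then obtain s where s: "S1 \<le> s" "u s < 1 + \<eta>" by blast
        have "\<bar>u t - 1\<bar> < \<eta>" if "s \<le> t" for t
          using mono'[of s t] gt1[of t] s that by auto
        then show "\<exists>S3\<ge>S1. \<forall>s\<ge>S3. \<bar>u s - 1\<bar> < \<eta>" using s by blast
      qed (use gt1 in auto)
    qed
  qed
qed

end

section \<open>Convergence of the critical points\<close>

text \<open>Finitely many zeros to the left of any point give a first zero, and each zero an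
  immediate successor.\<close>

lemma exists_nth_zero:
  fixes g :: "real \<Rightarrow> real"
  assumes fin: "\<And>t. finite {\<tau>. \<tau> \<le> t \<and> g \<tau> = 0}" and inf: "\<And>T. \<exists>t>T. g t = 0"
  shows "\<exists>t. g t = 0 \<and> card {\<tau>. \<tau> < t \<and> g \<tau> = 0} = k"
proof (induction k)
  case 0
  obtain t1 where t1: "g t1 = 0" using inf by blast
  define Z where "Z = {\<tau>. \<tau> \<le> t1 \<and> g \<tau> = 0}"
  have Z: "finite Z" "Z \<noteq> {}" using fin t1 by (auto simp: Z_def)
  have e: "{\<tau>. \<tau> < Min Z \<and> g \<tau> = 0} = {}"
  proof -
    have "\<not> \<tau> < Min Z" if "g \<tau> = 0" for \<tau>
    proof (cases "\<tau> \<le> t1")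
      case True
      then have "\<tau> \<in> Z" using that by (simp add: Z_def)
      then show ?thesis using Min_le[OF Z(1)] by force
    next
      case False
      then show ?thesis using Min_in[OF Z] by (auto simp: Z_def)
    qed
    then show ?thesis by blast
  qed
  have "g (Min Z) = 0" using Min_in[OF Z] by (simp add: Z_def)
  then show ?case by (intro exI[of _ "Min Z"] conjI) (simp_all only: e card.empty)
next
  case (Suc k)
  then obtain t where t: "g t = 0" "card {\<tau>. \<tau> < t \<and> g \<tau> = 0} = k" by blast
  obtain t2 where t2: "t < t2" "g t2 = 0" using inf by blast
  define Z where "Z = {\<tau>. t < \<tau> \<and> \<tau> \<le> t2 \<and> g \<tau> = 0}"
  have "finite Z" by (rule finite_subset[OF _ fin[of t2]]) (auto simp: Z_def)
  then have Z: "finite Z" "Z \<noteq> {}" using t2 by (auto simp: Z_def)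
  have MZ: "t < Min Z" "g (Min Z) = 0" "Min Z \<le> t2" using Min_in[OF Z] by (auto simp: Z_def)
  have "{\<tau>. \<tau> < Min Z \<and> g \<tau> = 0} = insert t {\<tau>. \<tau> < t \<and> g \<tau> = 0}"
  proof -
    have "\<tau> \<le> t" if "\<tau> < Min Z" "g \<tau> = 0" for \<tau>
    proof (rule ccontr)
      assume "\<not> \<tau> \<le> t"
      then have "\<tau> \<in> Z" using that MZ by (simp add: Z_def)
      then show False using Min_le[OF Z(1)] that(1) by force
    qed
    then show ?thesis using MZ t by force
  qed
  moreover have "finite {\<tau>. \<tau> < t \<and> g \<tau> = 0}" by (rule finite_subset[OF _ fin[of t]]) auto
  ultimately show ?case using MZ t by (intro exI[of _ "Min Z"]) simp
qed

lemma nth_pos_crit_exp: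
  assumes du: "\<And>s. 0 < s \<Longrightarrow> (u has_real_derivative v s) (at s)"
    and g: "\<And>t. g t = 0 \<longleftrightarrow> v (exp (m * t)) = 0" and m: "0 < (m :: real)"
    and t: "g t = 0" "finite {\<tau>. \<tau> < t \<and> g \<tau> = 0}" "card {\<tau>. \<tau> < t \<and> g \<tau> = 0} = n - 1"
  shows "nth_pos_crit u n (exp (m * t))"
proof -
  have crit: "crit u s \<longleftrightarrow> v s = 0" if "0 < s" for s
    using du[OF that] DERIV_unique unfolding crit_def by metis
  have "{s. 0 < s \<and> s < exp (m * t) \<and> crit u s} = (\<lambda>\<tau>. exp (m * \<tau>)) ` {\<tau>. \<tau> < t \<and> g \<tau> = 0}" (is "?L = ?R")
  proof
    show "?R \<subseteq> ?L" using g crit m by auto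
    show "?L \<subseteq> ?R"
    proof
      fix s assume s: "s \<in> ?L"
      then have e: "exp (m * (ln s / m)) = s" using m by simp
      have "m * (ln s / m) < m * t" using s e by (metis exp_less_cancel_iff mem_Collect_eq)
      then have "ln s / m < t" using m by (simp only: mult_less_cancel_left_pos)
      moreover have "0 < s" "crit u s" using s by auto
      then have "g (ln s / m) = 0" unfolding g e using crit[of s] by simp
      ultimately show "s \<in> ?R" using e by (intro image_eqI[of _ _ "ln s / m"]) auto
    qed
  qed
  moreover have "inj_on (\<lambda>\<tau>. exp (m * \<tau>)) {\<tau>. \<tau> < t \<and> g \<tau> = 0}" using m by (auto intro!: inj_onI)
  ultimately show ?thesis unfolding nth_pos_crit_def using t crit[of "exp (m * t)"] g[of t]
    by (simp add: card_image)
qed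

context supercritical begin

section \<open>Back to the radial variable: critical points as zeros in Emden time\<close>

definition rad_u :: "(real \<Rightarrow> real) \<Rightarrow> real \<Rightarrow> real" where
  "rad_u y s = A * s powr (- \<theta>) * y (ln s / m)"

definition rad_v :: "(real \<Rightarrow> real) \<Rightarrow> (real \<Rightarrow> real) \<Rightarrow> real \<Rightarrow> real" where
  "rad_v y z s = A * s powr (- \<theta> - 1) * (z (ln s / m) / m - \<theta> * y (ln s / m))"

lemma emden_radial:
  assumes em: "emden y z" and s: "0 < s"
  shows "0 < rad_u y s" "(rad_u y has_real_derivative rad_v y z s) (at s)"
    "(rad_v y z has_real_derivative - (real N - 1) / s * rad_v y z s - fnl p (rad_u y s)) (at s)"
proof -
  define t where "t = ln s / m"
  define P where "P = s powr (- \<theta> - 2)"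
  have y: "0 < y t" using emdenD(1)[OF em] .
  show "0 < rad_u y s" using A_pos y s by (simp add: rad_u_def t_def)
  \<comment> \<open>All powers of \<open>s\<close> that occur are expressed through
    \<open>P\<close>; by \<open>theta_p\<close> this covers \<open>rad_u y s powr p\<close> as
    well.\<close>
  have P1: "s powr (- \<theta>) = P * s\<^sup>2" "s powr (- \<theta> - 1) = P * s" "s powr (- \<theta> - 1 - 1) = P"
  proof -
    have "s powr (r + 2) = s powr r * s\<^sup>2" "s powr (r + 1) = s powr r * s" for r
      using s by (simp_all add: powr_add)
    note this(1)[of "- \<theta> - 2"] this(2)[of "- \<theta> - 2"]
    moreover have e: "- \<theta> - 2 + 2 = - \<theta>" "- \<theta> - 2 + 1 = - \<theta> - 1" "- \<theta> - 1 - 1 = - \<theta> - 2" by simp_all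
    ultimately show "s powr (- \<theta>) = P * s\<^sup>2" "s powr (- \<theta> - 1) = P * s" "s powr (- \<theta> - 1 - 1) = P"
      unfolding P_def e by blast+
  qed
  have dt: "((\<lambda>s. ln s / m) has_real_derivative 1 / s / m) (at s)"
    using s m_pos by (auto intro!: derivative_eq_intros)
  have dy: "((\<lambda>s. y (ln s / m)) has_real_derivative z t * (1 / s / m)) (at s)"
    using DERIV_chain2[OF emdenD(2)[OF em] dt] by (simp add: t_def)
  have dz: "((\<lambda>s. z (ln s / m)) has_real_derivative rhs t (y t) (z t) * (1 / s / m)) (at s)"
    using DERIV_chain2[OF emdenD(3)[OF em] dt] by (simp add: t_def)
  have dp: "((\<lambda>s. A * s powr r) has_real_derivative A * (r * s powr (r - 1))) (at s)" for r
    by (intro DERIV_cmult has_real_derivative_powr s)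
  show "(rad_u y has_real_derivative rad_v y z s) (at s)"
    unfolding rad_u_def
    by (rule DERIV_cong[OF DERIV_mult[OF dp dy]])
       (use s m_pos in \<open>simp add: rad_v_def t_def[symmetric] P1 field_simps power2_eq_square\<close>)
  have "(rad_v y z has_real_derivative
      A * ((- \<theta> - 1) * P) * (z t / m - \<theta> * y t)
      + (rhs t (y t) (z t) * (1 / s / m) / m - \<theta> * (z t * (1 / s / m))) * (A * (P * s))) (at s)"
    unfolding rad_v_def
    by (rule DERIV_cong[OF DERIV_mult[OF dp DERIV_diff[OF DERIV_cdivide[OF dz, of m] DERIV_cmult[OF dy, of \<theta>]]]])
       (simp only: t_def[symmetric] P1)
  moreover have "A * ((- \<theta> - 1) * P) * (z t / m - \<theta> * y t)
      + (rhs t (y t) (z t) * (1 / s / m) / m - \<theta> * (z t * (1 / s / m))) * (A * (P * s))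
     = - (real N - 1) / s * rad_v y z s - fnl p (rad_u y s)"
  proof -
    have e2: "exp (2 * m * t) = s\<^sup>2"
    proof -
      have "exp (2 * m * t) = (exp (m * t))\<^sup>2" by (simp add: mult.assoc exp_double)
      also have "m * t = ln s" using m_pos by (simp add: t_def)
      finally show ?thesis using s by simp
    qed
    have u: "rad_u y s = A * (P * s\<^sup>2) * y t" by (simp add: rad_u_def P1 t_def)
    have v: "rad_v y z s = A * (P * s) * (z t / m - \<theta> * y t)" by (simp add: rad_v_def P1 t_def)
    have "rad_u y s powr p = A powr p * (s powr (- \<theta>)) powr p * y t powr p"
      using A_pos s y by (simp add: rad_u_def t_def powr_mult)
    also have "(s powr (- \<theta>)) powr p = P"
    proof -
      have "- \<theta> * p = - \<theta> - 2" using theta_p by simp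
      then show ?thesis by (simp add: powr_powr P_def)
    qed
    also have "A powr p = A / m\<^sup>2" using A_powr_p m_pos by (simp add: field_simps)
    finally have up: "rad_u y s powr p = A / m\<^sup>2 * P * y t powr p" .
    have one: "m\<^sup>2 * (\<theta> * (real N - 2 - \<theta>)) = 1" using m_sq by (simp add: \<kappa>_def)
    have *: "A * ((- T - 1) * P) * (Z / M - T * Y)
      + ((- (M * (n - 2 - 2 * T)) * Z + Y - W + M\<^sup>2 * s\<^sup>2 * Y) * (1 / s / M) / M - T * (Z * (1 / s / M))) * (A * (P * s))
      = - (n - 1) / s * (A * (P * s) * (Z / M - T * Y)) - (- (A * (P * s\<^sup>2) * Y) + A / M\<^sup>2 * P * W)"
      if one: "M\<^sup>2 * (T * (n - 2 - T)) = 1" and M: "0 < M" for M T Y Z W n :: real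
    proof -
      have "T * (n - 2 - T) = 1 / M\<^sup>2" using one M by (simp add: eq_divide_eq mult.commute)
      then have Y: "Y / M\<^sup>2 = Y * (T * (n - 2 - T))" by simp
      have "(- (M * (n - 2 - 2 * T)) * Z + Y - W + M\<^sup>2 * s\<^sup>2 * Y) * (1 / s / M) / M * (A * (P * s))
        = A * P * (- ((n - 2 - 2 * T) * Z / M) + Y / M\<^sup>2 - W / M\<^sup>2 + s\<^sup>2 * Y)"
        using s M by (simp add: field_simps power2_eq_square)
      also have "\<dots> = A * P * (- ((n - 2 - 2 * T) * Z / M) + Y * (T * (n - 2 - T)) - W / M\<^sup>2 + s\<^sup>2 * Y)" unfolding Y ..
      finally have 1: "(- (M * (n - 2 - 2 * T)) * Z + Y - W + M\<^sup>2 * s\<^sup>2 * Y) * (1 / s / M) / M * (A * (P * s))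
        = A * P * (- ((n - 2 - 2 * T) * Z / M) + Y * (T * (n - 2 - T)) - W / M\<^sup>2 + s\<^sup>2 * Y)" .
      show ?thesis unfolding left_diff_distrib[of _ "T * (Z * (1 / s / M))"] 1
        using s M by (simp add: field_simps power2_eq_square)
    qed
    show ?thesis unfolding fnl_def up unfolding u v rhs_def e2 alphaconst_def by (rule *[OF one m_pos])
  qed
  ultimately show "(rad_v y z has_real_derivative - (real N - 1) / s * rad_v y z s - fnl p (rad_u y s)) (at s)"
    by simp
qed

text \<open>Up to a positive factor this is \<open>u'\<close> at \<open>exp (m * t)\<close>, see
  \<open>crit_fun_rad\<close> and \<open>crit_fun_regular\<close>.\<close>

definition crit_fun :: "(real \<Rightarrow> real) \<Rightarrow> (real \<Rightarrow> real) \<Rightarrow> real \<Rightarrow> real" where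
  "crit_fun y z t = z t - m * \<theta> * y t"

definition crit_fun' :: "(real \<Rightarrow> real) \<Rightarrow> (real \<Rightarrow> real) \<Rightarrow> real \<Rightarrow> real" where
  "crit_fun' y z t = rhs t (y t) (z t) - m * \<theta> * z t"

lemma crit_fun_deriv: "emden y z \<Longrightarrow> (crit_fun y z has_real_derivative crit_fun' y z t) (at t)"
  unfolding crit_fun_def crit_fun'_def by (intro DERIV_diff DERIV_cmult emdenD)

lemma crit_fun'_isCont:
  assumes em: "emden y z"
  shows "isCont (crit_fun' y z) t"
proof -
  have "isCont y t" "isCont z t" using emdenD[OF em] DERIV_isCont by blast+
  then show ?thesis using emdenD(1)[OF em, of t]
    unfolding crit_fun'_def rhs_def by (intro continuous_intros) auto
qed

lemma crit_fun_rad: "crit_fun y z t = 0 \<longleftrightarrow> rad_v y z (exp (m * t)) = 0"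
proof -
  have "rad_v y z (exp (m * t)) = A * exp (m * t) powr (- \<theta> - 1) / m * crit_fun y z t"
    using m_pos by (simp add: rad_v_def crit_fun_def field_simps)
  then show ?thesis using A_pos m_pos by simp
qed

lemma crit_fun_regular: "crit_fun (emden_y u) (emden_z u v) t = 0 \<longleftrightarrow> v (exp (m * t)) = 0"
proof -
  have "crit_fun (emden_y u) (emden_z u v) t = m * exp (m * \<theta> * t) * exp (m * t) / A * v (exp (m * t))"
    by (simp add: crit_fun_def emden_z_def emden_y_def add_divide_distrib algebra_simps)
  then show ?thesis using A_pos m_pos by simp
qed

lemma star_crit_left:
  assumes st: "star y z"
  obtains M where "\<And>t. t \<le> - M \<Longrightarrow> crit_fun y z t \<noteq> 0"
proof -
  \<comment> \<open>The solution of \<open>\<eta> = m * \<theta> * (1 - \<eta>)\<close>: then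
    \<open>z < \<eta>\<close> and \<open>y > 1 - \<eta>\<close> just exclude
    \<open>z = m * \<theta> * y\<close>.\<close>
  define \<eta> where "\<eta> = m * \<theta> / (1 + m * \<theta>)"
  have mt: "0 < m * \<theta>" using m_pos theta_pos by simp
  have "(1 + m * \<theta>) * \<eta> = m * \<theta>" using mt by (simp add: \<eta>_def)
  then have \<eta>: "\<eta> + m * \<theta> * \<eta> = m * \<theta>" "0 < \<eta>"
    using mt by (simp add: distrib_right, simp add: \<eta>_def)
  obtain L M where LM: "\<And>y z s t. orbit y z \<Longrightarrow> energy y z s \<le> - (- well 1 / 2) \<Longrightarrow> s + L \<le> t \<Longrightarrow> t \<le> - M \<Longrightarrow> \<bar>y t - 1\<bar> < \<eta> \<and> \<bar>z t\<bar> < \<eta>"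
    using settling[of "- well 1 / 2" \<eta>] \<eta>(2) well_1_neg by (metis divide_pos_pos neg_0_less_iff_less zero_less_numeral)
  show ?thesis
  proof (rule that[of M])
    fix t assume "t \<le> - M"
    then have "\<bar>y t - 1\<bar> < \<eta> \<and> \<bar>z t\<bar> < \<eta>"
      using LM[OF star_orbit[OF st], of "t - L" t] star_energy[OF st] by simp
    then have "1 - \<eta> < y t" and zt: "z t < \<eta>" by auto
    then have "m * \<theta> * (1 - \<eta>) < m * \<theta> * y t" using mt by (intro mult_strict_left_mono)
    then show "crit_fun y z t \<noteq> 0" using zt \<eta>(1) unfolding crit_fun_def right_diff_distrib by linarith
  qed
qed

text \<open>Rewritten in \<open>s\<close>, the bound of \<open>energy_lower\<close> is the
  polynomial lower bound that \<open>radial_oscillation\<close> asks for; it excludes the decay of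
  \<open>u\<close> to 0 that would end the oscillation.\<close>

lemma star_oscillates:
  assumes st: "star y z"
  shows "\<exists>t>T. crit_fun y z t = 0"
proof -
  have em: "emden y z" using st by (simp add: star_def)
  have "\<exists>s>exp (m * T). rad_v y z s = 0"
  proof (rule radial_oscillation[OF emden_radial[OF em]])
    show "0 < A\<^sup>2 * (- well 1)" by (rule mult_pos_pos) (use A_pos well_1_neg in auto)
    fix s :: real assume s: "1 \<le> s"
    define t where "t = ln s / m"
    have e2: "exp (2 * m * t) = s\<^sup>2"
    proof -
      have "exp (2 * m * t) = (exp (m * t))\<^sup>2" by (simp add: mult.assoc exp_double)
      also have "m * t = ln s" using m_pos by (simp add: t_def)
      finally show ?thesis using s by simp
    qed
    have "2 * (- well 1 / 2) \<le> (y t)\<^sup>2 * (1 + m\<^sup>2 * exp (2 * m * t))"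
      using star_energy[OF st, of t] by (intro energy_lower[OF em]) simp
    then have "A\<^sup>2 * (- well 1) \<le> A\<^sup>2 * ((y t)\<^sup>2 * (1 + m\<^sup>2 * s\<^sup>2))"
      unfolding e2 by (intro mult_left_mono) auto
    also have "\<dots> = s powr (2 * \<theta>) * (1 + m\<^sup>2 * s\<^sup>2) * (rad_u y s)\<^sup>2"
    proof -
      have "s powr (2 * \<theta>) * (s powr (- \<theta>))\<^sup>2 = 1"
      proof -
        have "s powr (2 * \<theta>) = (s powr \<theta>)\<^sup>2" by (simp add: power2_eq_square flip: powr_add)
        then show ?thesis using s by (simp add: powr_minus power_inverse)
      qed
      moreover have "s powr (2 * \<theta>) * (1 + m\<^sup>2 * s\<^sup>2) * (rad_u y s)\<^sup>2
        = A\<^sup>2 * ((y t)\<^sup>2 * (1 + m\<^sup>2 * s\<^sup>2)) * (s powr (2 * \<theta>) * (s powr (- \<theta>))\<^sup>2)"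
        unfolding rad_u_def t_def[symmetric] power_mult_distrib by (simp only: mult_ac)
      ultimately show ?thesis by (metis mult_1_right)
    qed
    finally show "A\<^sup>2 * (- well 1) \<le> s powr (2 * \<theta>) * (1 + m\<^sup>2 * s\<^sup>2) * (rad_u y s)\<^sup>2" .
  qed
  then obtain s where s: "exp (m * T) < s" "rad_v y z s = 0" by blast
  have s0: "0 < s" using s(1) exp_gt_zero[of "m * T"] by linarith
  have e: "exp (m * (ln s / m)) = s" using s0 m_pos by simp
  have "m * T < m * (ln s / m)" using s(1) e by (metis exp_less_cancel_iff)
  then have "T < ln s / m" using m_pos by (simp only: mult_less_cancel_left_pos)
  moreover have "crit_fun y z (ln s / m) = 0" unfolding crit_fun_rad e by (rule s(2))
  ultimately show ?thesis by blast
qed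

section \<open>The family of regular solutions and the passage to the limit\<close>

lemma regular_family:
  obtains U V c where "0 < c" "\<And>\<gamma>. 1 < \<gamma> \<Longrightarrow> regular \<gamma> (U \<gamma>) (V \<gamma>)"
    "\<And>s. \<forall>\<^sub>F \<gamma> in at_top. energy (emden_y (U \<gamma>)) (emden_z (U \<gamma>) (V \<gamma>)) s \<le> - c"
proof -
  have "\<forall>\<gamma>. \<exists>u v. 1 < \<gamma> \<longrightarrow> regular \<gamma> u v" using regular_exists by blast
  then obtain U V where UV: "\<And>\<gamma>. 1 < \<gamma> \<Longrightarrow> regular \<gamma> (U \<gamma>) (V \<gamma>)" by metis
  obtain c \<tau> where c: "0 < c" "filterlim \<tau> at_bot at_top"
    and en: "\<And>\<gamma> u v t. regular \<gamma> u v \<Longrightarrow> 0 < \<gamma> \<Longrightarrow> \<tau> \<gamma> \<le> t \<Longrightarrow> energy (emden_y u) (emden_z u v) t \<le> - c"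
    using regular_energy_seed by metis
  have "\<forall>\<^sub>F \<gamma> in at_top. energy (emden_y (U \<gamma>)) (emden_z (U \<gamma>) (V \<gamma>)) s \<le> - c" for s
  proof -
    have "\<forall>\<^sub>F \<gamma> in at_top. \<tau> \<gamma> \<le> s" using c(2) by (simp add: filterlim_at_bot)
    then show ?thesis using eventually_gt_at_top[of 1]
    proof eventually_elim
      case (elim \<gamma>)
      then show ?case using en[OF UV[of \<gamma>]] by simp
    qed
  qed
  then show ?thesis using that[OF c(1) UV] by blast
qed

lemma star_family_exists: obtains y z where "star y z"
proof -
  obtain U V c where c: "0 < c" and UV: "\<And>\<gamma>. 1 < \<gamma> \<Longrightarrow> regular \<gamma> (U \<gamma>) (V \<gamma>)"
    and en: "\<And>s. \<forall>\<^sub>F \<gamma> in at_top. energy (emden_y (U \<gamma>)) (emden_z (U \<gamma>) (V \<gamma>)) s \<le> - c"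
    by (rule regular_family) blast
  have fl: "filterlim (\<lambda>n. 2 + real n) at_top sequentially"
    by (intro filterlim_tendsto_add_at_top[OF tendsto_const] filterlim_real_sequentially)
  have "\<forall>\<^sub>F n in sequentially. energy (emden_y (U (2 + real n))) (emden_z (U (2 + real n)) (V (2 + real n))) s \<le> - c" for s
    by (rule eventually_compose_filterlim[OF en fl])
  moreover have "orbit (emden_y (U (2 + real n))) (emden_z (U (2 + real n)) (V (2 + real n)))" for n
    by (rule regular_orbit[OF UV]) simp
  ultimately show ?thesis
    using star_exists[OF c, of "\<lambda>n. emden_y (U (2 + real n))" "\<lambda>n. emden_z (U (2 + real n)) (V (2 + real n))"] that
    by blast
qed

lemma lambda_n_tendsto:
  assumes n: "1 \<le> n"
  shows "((\<lambda>\<gamma>. lambda_n N p n \<gamma>) \<longlongrightarrow> lambda_star N p n) at_top"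
proof -
  obtain y z where st: "star y z" using star_family_exists .
  have em: "emden y z" using st by (simp add: star_def)
  let ?g = "crit_fun y z" and ?g' = "crit_fun' y z"
  have simple: "?g' t \<noteq> 0" if "?g t = 0" for t
    using star_simple_zero[OF st, of t] that by (simp add: crit_fun_def crit_fun'_def)
  obtain M1 where left: "\<And>t. t \<le> - M1 \<Longrightarrow> ?g t \<noteq> 0" using star_crit_left[OF st] by blast
  have fin: "finite {\<tau>. \<tau> \<le> t \<and> ?g \<tau> = 0}" for t
  proof (rule finite_subset)
    show "{\<tau>. \<tau> \<le> t \<and> ?g \<tau> = 0} \<subseteq> {\<tau>. - M1 \<le> \<tau> \<and> \<tau> \<le> t \<and> ?g \<tau> = 0}" using left linear by blast
  qed (rule finite_simple_zeros[OF crit_fun_deriv[OF em] simple])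
  obtain t0 where t0: "?g t0 = 0" "card {\<tau>. \<tau> < t0 \<and> ?g \<tau> = 0} = n - 1"
    using exists_nth_zero[OF fin star_oscillates[OF st]] by blast
  have "nth_pos_crit (rad_u y) n (exp (m * t0))"
    by (rule nth_pos_crit_exp[OF emden_radial(2)[OF em] crit_fun_rad m_pos t0(1) finite_subset[OF _ fin[of t0]] t0(2)]) auto
  moreover have "ustar N p = rad_u y" by (auto simp: ustar_def rad_u_def ystar_eq[OF st])
  ultimately have crit: "nth_pos_crit (ustar N p) n (exp (m * t0))" by simp
  have "sstar N p n = exp (m * t0)"
    unfolding sstar_def by (rule the_equality[where P = "nth_pos_crit (ustar N p) n", OF crit]) (rule nth_pos_crit_unique[OF _ crit n])
  then have ls: "lambda_star N p n = (exp (m * t0))\<^sup>2" by (simp add: lambda_star_def)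
  obtain U V c where c: "0 < c" and UV: "\<And>\<gamma>. 1 < \<gamma> \<Longrightarrow> regular \<gamma> (U \<gamma>) (V \<gamma>)"
    and en: "\<And>s. \<forall>\<^sub>F \<gamma> in at_top. energy (emden_y (U \<gamma>)) (emden_z (U \<gamma>) (V \<gamma>)) s \<le> - c"
    by (rule regular_family) blast
  define Y where "Y \<gamma> = emden_y (U \<gamma>)" for \<gamma>
  define Z where "Z \<gamma> = emden_z (U \<gamma>) (V \<gamma>)" for \<gamma>
  have orb: "orbit (Y \<gamma>) (Z \<gamma>)" if "1 < \<gamma>" for \<gamma> unfolding Y_def Z_def by (rule regular_orbit[OF UV[OF that]])
  have ev1: "\<forall>\<^sub>F \<gamma>::real in at_top. 1 < \<gamma>" by (rule eventually_gt_at_top)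
  have evo: "\<forall>\<^sub>F \<gamma> in at_top. orbit (Y \<gamma>) (Z \<gamma>)" using ev1 by eventually_elim (rule orb)
  have conv: "\<forall>\<^sub>F \<gamma> in at_top. \<forall>t\<in>{a..b}. \<bar>Y \<gamma> t - y t\<bar> < \<epsilon> \<and> \<bar>Z \<gamma> t - z t\<bar> < \<epsilon>" if "0 < \<epsilon>" for a b \<epsilon>
    using converges_to_star[OF st c that evo] en unfolding Y_def Z_def by blast
  have mt: "0 < m * \<theta>" using m_pos theta_pos by simp
  obtain M2 \<gamma>0 where early: "\<And>\<gamma> u v t. regular \<gamma> u v \<Longrightarrow> \<gamma>0 \<le> \<gamma> \<Longrightarrow> t \<le> - M2 \<Longrightarrow> emden_z u v t < m * \<theta> * emden_y u t"
    using regular_decreasing_early by metis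
  have near: "\<forall>\<^sub>F \<gamma> in at_top. \<exists>t. \<bar>t - t0\<bar> < e \<and> crit_fun (Y \<gamma>) (Z \<gamma>) t = 0 \<and>
      finite {\<tau>. \<tau> < t \<and> crit_fun (Y \<gamma>) (Z \<gamma>) \<tau> = 0} \<and>
      card {\<tau>. \<tau> < t \<and> crit_fun (Y \<gamma>) (Z \<gamma>) \<tau> = 0} = card {\<tau>. \<tau> < t0 \<and> ?g \<tau> = 0}" if e: "0 < e" for e
  \<comment> \<open>\<open>M1\<close> serves the limit and \<open>M2\<close> the regular solutions,
    so left of \<open>- max M1 M2\<close> neither has critical points.\<close>
  proof (rule nth_zero_converges[where a = "- max M1 M2" and G' = "\<lambda>\<gamma>. crit_fun' (Y \<gamma>) (Z \<gamma>)" and g' = ?g'])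
    show "(?g has_real_derivative ?g' t) (at t)" for t by (rule crit_fun_deriv[OF em])
    show "isCont ?g' t" for t by (rule crit_fun'_isCont[OF em])
    show "\<forall>\<^sub>F \<gamma> in at_top. \<forall>t. (crit_fun (Y \<gamma>) (Z \<gamma>) has_real_derivative crit_fun' (Y \<gamma>) (Z \<gamma>) t) (at t)"
      using evo by eventually_elim (blast intro: crit_fun_deriv orbitD(1))
    show "\<forall>\<^sub>F \<gamma> in at_top. \<forall>t. isCont (crit_fun' (Y \<gamma>) (Z \<gamma>)) t"
      using evo by eventually_elim (blast intro: crit_fun'_isCont orbitD(1))
    show "\<forall>\<^sub>F \<gamma> in at_top. \<forall>t\<le>- max M1 M2. crit_fun (Y \<gamma>) (Z \<gamma>) t \<noteq> 0"
      using ev1 eventually_ge_at_top[of \<gamma>0]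
    proof eventually_elim
      case (elim \<gamma>)
      show ?case
      proof (intro allI impI)
        fix t assume "t \<le> - max M1 M2"
        then have "Z \<gamma> t < m * \<theta> * Y \<gamma> t"
          unfolding Y_def Z_def using early[OF UV[OF elim(1)] elim(2), of t] by simp
        then show "crit_fun (Y \<gamma>) (Z \<gamma>) t \<noteq> 0" by (simp add: crit_fun_def)
      qed
    qed
    show "\<forall>\<^sub>F \<gamma> in at_top. \<forall>t\<in>{a..b}. \<bar>crit_fun (Y \<gamma>) (Z \<gamma>) t - ?g t\<bar> < \<delta>" if "0 < \<delta>" for a b \<delta>
    proof -
      define \<epsilon> where "\<epsilon> = \<delta> / (1 + m * \<theta>)"
      have "(1 + m * \<theta>) * \<epsilon> = \<delta>" using mt by (simp add: \<epsilon>_def)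
      then have \<epsilon>: "0 < \<epsilon>" "\<epsilon> + m * \<theta> * \<epsilon> = \<delta>"
        using that mt by (simp add: \<epsilon>_def, simp add: distrib_right)
      show ?thesis using conv[OF \<epsilon>(1), of a b]
      proof eventually_elim
        case (elim \<gamma>)
        show ?case
        proof
          fix t assume "t \<in> {a..b}"
          then have "\<bar>Y \<gamma> t - y t\<bar> < \<epsilon>" "\<bar>Z \<gamma> t - z t\<bar> < \<epsilon>" using elim by auto
          moreover from this have "m * \<theta> * \<bar>Y \<gamma> t - y t\<bar> \<le> m * \<theta> * \<epsilon>" using mt by (intro mult_left_mono) auto
          moreover have "crit_fun (Y \<gamma>) (Z \<gamma>) t - ?g t = (Z \<gamma> t - z t) - m * \<theta> * (Y \<gamma> t - y t)"
            by (simp add: crit_fun_def algebra_simps)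
          moreover have "\<bar>m * \<theta> * (Y \<gamma> t - y t)\<bar> = m * \<theta> * \<bar>Y \<gamma> t - y t\<bar>" using m_pos theta_pos by (simp add: abs_mult)
          ultimately show "\<bar>crit_fun (Y \<gamma>) (Z \<gamma>) t - ?g t\<bar> < \<delta>"
            using \<epsilon>(2) abs_triangle_ineq4[of "Z \<gamma> t - z t" "m * \<theta> * (Y \<gamma> t - y t)"] by linarith
        qed
      qed
    qed
    show "\<forall>\<^sub>F \<gamma> in at_top. \<forall>t\<in>{a..b}. \<bar>crit_fun' (Y \<gamma>) (Z \<gamma>) t - ?g' t\<bar> < \<delta>" if "0 < \<delta>" for a b \<delta>
    proof -
      obtain B where B: "\<And>y z t. orbit y z \<Longrightarrow> t \<le> b \<Longrightarrow> y t \<le> B" using orbit_bounded[of b] by metis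
      obtain C where C: "0 < C" "\<And>t y1 y2 z1 z2. t \<le> b \<Longrightarrow> 0 \<le> y1 \<Longrightarrow> y1 \<le> B \<Longrightarrow> 0 \<le> y2 \<Longrightarrow> y2 \<le> B \<Longrightarrow>
        \<bar>rhs t y1 z1 - rhs t y2 z2\<bar> \<le> C * (\<bar>y1 - y2\<bar> + \<bar>z1 - z2\<bar>)" using rhs_lipschitz by metis
      \<comment> \<open>Splits \<open>\<delta>\<close> between the Lipschitz bound for
        \<open>rhs\<close> and the term \<open>m * \<theta> * z\<close>.\<close>
      define \<epsilon> where "\<epsilon> = \<delta> / (2 * C + m * \<theta>)"
      have \<epsilon>: "0 < \<epsilon>" "C * (\<epsilon> + \<epsilon>) + m * \<theta> * \<epsilon> = \<delta>"
      proof -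
        have "0 < 2 * C + m * \<theta>" using C(1) mt by simp
        moreover have "C * (\<epsilon> + \<epsilon>) + m * \<theta> * \<epsilon> = (2 * C + m * \<theta>) * \<epsilon>" by (simp add: algebra_simps)
        ultimately show "0 < \<epsilon>" "C * (\<epsilon> + \<epsilon>) + m * \<theta> * \<epsilon> = \<delta>" using that by (simp_all add: \<epsilon>_def)
      qed
      show ?thesis using conv[OF \<epsilon>(1), of a b] evo
      proof eventually_elim
        case (elim \<gamma>)
        show ?case
        proof
          fix t assume t: "t \<in> {a..b}"
          have Y: "\<bar>Y \<gamma> t - y t\<bar> < \<epsilon>" "\<bar>Z \<gamma> t - z t\<bar> < \<epsilon>" using elim(1) t by auto
          have "\<bar>rhs t (Y \<gamma> t) (Z \<gamma> t) - rhs t (y t) (z t)\<bar> \<le> C * (\<bar>Y \<gamma> t - y t\<bar> + \<bar>Z \<gamma> t - z t\<bar>)"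
            using t B[OF elim(2), of t] B[OF star_orbit[OF st], of t]
              emdenD(1)[OF orbitD(1)[OF elim(2)], of t] emdenD(1)[OF em, of t] by (intro C(2)) auto
          also have "\<dots> < C * (\<epsilon> + \<epsilon>)" using Y C(1) by (intro mult_strict_left_mono add_strict_mono)
          finally have "\<bar>rhs t (Y \<gamma> t) (Z \<gamma> t) - rhs t (y t) (z t)\<bar> < C * (\<epsilon> + \<epsilon>)" .
          moreover have "m * \<theta> * \<bar>Z \<gamma> t - z t\<bar> \<le> m * \<theta> * \<epsilon>" using Y mt by (intro mult_left_mono) auto
          moreover have "crit_fun' (Y \<gamma>) (Z \<gamma>) t - ?g' t = (rhs t (Y \<gamma> t) (Z \<gamma> t) - rhs t (y t) (z t)) - m * \<theta> * (Z \<gamma> t - z t)"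
            by (simp add: crit_fun'_def algebra_simps)
          moreover have "\<bar>m * \<theta> * (Z \<gamma> t - z t)\<bar> = m * \<theta> * \<bar>Z \<gamma> t - z t\<bar>" using m_pos theta_pos by (simp add: abs_mult)
          ultimately show "\<bar>crit_fun' (Y \<gamma>) (Z \<gamma>) t - ?g' t\<bar> < \<delta>"
            using \<epsilon>(2) abs_triangle_ineq4[of "rhs t (Y \<gamma> t) (Z \<gamma> t) - rhs t (y t) (z t)" "m * \<theta> * (Z \<gamma> t - z t)"] by linarith
        qed
      qed
    qed
    show "?g t \<noteq> 0" if "t \<le> - max M1 M2" for t using left that by simp
  qed (use simple t0 e in auto)
  show ?thesis
  proof (rule tendstoI)
    fix \<epsilon> :: real assume \<epsilon>: "0 < \<epsilon>"
    \<comment> \<open>Convergence of the zero in \<open>t\<close> turns into convergence of the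
      squared critical point \<open>s = exp (m * t)\<close>.\<close>
    have "isCont (\<lambda>t. (exp (m * t))\<^sup>2) t0" by (intro continuous_intros)
    then obtain e where e: "0 < e" "\<And>t. dist t t0 < e \<Longrightarrow> dist ((exp (m * t))\<^sup>2) ((exp (m * t0))\<^sup>2) < \<epsilon>"
      using \<epsilon> unfolding continuous_at_eps_delta by blast
    show "\<forall>\<^sub>F \<gamma> in at_top. dist (lambda_n N p n \<gamma>) (lambda_star N p n) < \<epsilon>"
      using near[OF e(1)] ev1
    proof eventually_elim
      case (elim \<gamma>)
      then obtain t where t: "\<bar>t - t0\<bar> < e" "crit_fun (Y \<gamma>) (Z \<gamma>) t = 0"
        "finite {\<tau>. \<tau> < t \<and> crit_fun (Y \<gamma>) (Z \<gamma>) \<tau> = 0}"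
        "card {\<tau>. \<tau> < t \<and> crit_fun (Y \<gamma>) (Z \<gamma>) \<tau> = 0} = n - 1"
        using t0(2) by auto
      note r = UV[OF elim(2)]
      have "nth_pos_crit (U \<gamma>) n (exp (m * t))"
      proof (rule nth_pos_crit_exp[where g = "crit_fun (Y \<gamma>) (Z \<gamma>)" and v = "V \<gamma>"])
        show "(U \<gamma> has_real_derivative V \<gamma> s) (at s)" if "0 < s" for s by (rule regularD(3)[OF r that])
        show "crit_fun (Y \<gamma>) (Z \<gamma>) t = 0 \<longleftrightarrow> V \<gamma> (exp (m * t)) = 0" for t
          unfolding Y_def Z_def by (rule crit_fun_regular)
      qed (fact t(2-4) m_pos)+
      then have "lambda_n N p n \<gamma> = (exp (m * t))\<^sup>2" using lambda_n_eq[OF r _ n] elim(2) by simp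
      then show ?case using e(2)[of t] t(1) by (simp add: ls dist_real_def)
    qed
  qed
qed

end

theorem theorem5p2:
  fixes N n :: nat and p :: real
  assumes "N \<ge> 3" and "p > (real N + 2) / (real N - 2)" and "n \<ge> 1"
  shows "((\<lambda>\<gamma>. lambda_n N p n \<gamma>) \<longlongrightarrow> lambda_star N p n) at_top"
proof -
  interpret supercritical N p using assms by unfold_locales
  show ?thesis using assms(3) by (rule lambda_n_tendsto)
qed

end
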